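(* Let $M$ be a compact, connected, $n$-dimensional Riemannian manifold with metric $g$. For each $p\in M$ let $\mu_p$ be a positive, finite measure on $T_pM$, and for $N\in\mathbb{N}$ let $$L_Nf(p)=\int_{T_pM}\big(f(p(1/N,\eta))-f(p)\big)\,\mu_p(d\eta).$$ Suppose that: (1) $\sup_{p\in M}\sup_{\eta\in\operatorname{supp}\mu_p}\|\eta\|<\infty$; (2) $\sup_{p\in M}\mu_p(T_pM)<\infty$; (3) for every $p\in M$ and every coordinate system around $p$, $\int\eta^i\,\mu_p(d\eta)=0$ and $\int\eta^i\eta^j\,\mu_p(d\eta)=g^{ij}(p)$ for all $i,j\in\{1,\dots,n\}$. Then for every $f\in C^\infty(M)$, $N^2L_Nf\to\frac12\Delta_Mf$ uniformly on $M$ as $N\to\infty$.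
   Context: For $p\in M$ and $\xi\in T_pM$, $p(\cdot,\xi)$ denotes the geodesic with $p(0,\xi)=p$ and tangent vector $\xi$ at $p$, so $p(t,\xi)=\exp_p(t\xi)$. For a coordinate system $(x,U)$ around $p$, $\eta^1,\dots,\eta^n$ are the components of $\eta\in T_pM$ defined by $\eta=\sum_i\eta^i\frac{\partial}{\partial x^i}|_p$, and $(g^{ij}(p))$ is the inverse of the matrix $(g_{ij}(p))$ of the metric in these coordinates. $\Delta_M$ is the Laplace-Beltrami operator. *)

theory Defs
  imports "HOL-Analysis.Analysis"
begin

section \<open>Smooth maps between Euclidean spaces\<close>

primrec Ck_on :: "nat \<Rightarrow> ('e::real_normed_vector \<Rightarrow> 'f::real_normed_vector) \<Rightarrow> 'e set \<Rightarrow> bool" where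
  "Ck_on 0 f S \<longleftrightarrow> continuous_on S f"
| "Ck_on (Suc k) f S \<longleftrightarrow>
     (\<forall>x\<in>S. f differentiable (at x)) \<and> (\<forall>v. Ck_on k (\<lambda>x. frechet_derivative f (at x) v) S)"

text \<open>Only used for open sets \<open>S\<close>.\<close>

definition smooth_on :: "('e::real_normed_vector) set \<Rightarrow> ('e \<Rightarrow> 'f::real_normed_vector) \<Rightarrow> bool" where
  "smooth_on S f \<longleftrightarrow> (\<forall>k. Ck_on k f S)"


section \<open>Smooth manifolds\<close>

text \<open>The manifold is the whole type \<open>'a\<close>, and its dimension is \<open>CARD('n)\<close>. A chart \<open>(U, x)\<close>
  consists of its domain and a total function \<open>x\<close>, of which only the values on \<open>U\<close> matter.\<close>

type_synonym ('a, 'n) chart = "'a set \<times> ('a \<Rightarrow> real ^ 'n)"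

definition chart_inv :: "('a, 'n) chart \<Rightarrow> real ^ 'n \<Rightarrow> 'a" where
  "chart_inv c = inv_into (fst c) (snd c)"

definition is_chart :: "('a::topological_space, 'n::finite) chart \<Rightarrow> bool" where
  "is_chart c \<longleftrightarrow> open (fst c) \<and> open (snd c ` fst c) \<and>
     homeomorphism (fst c) (snd c ` fst c) (snd c) (chart_inv c)"

definition compatible :: "('a, 'n::finite) chart \<Rightarrow> ('a, 'n) chart \<Rightarrow> bool" where
  "compatible c d \<longleftrightarrow>
     smooth_on (snd c ` (fst c \<inter> fst d)) (snd d \<circ> chart_inv c) \<and>
     smooth_on (snd d ` (fst c \<inter> fst d)) (snd c \<circ> chart_inv d)"

text \<open>A smooth structure is a maximal smooth atlas; its members are all the coordinate systems
  of the manifold.\<close>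

definition smooth_structure :: "('a::topological_space, 'n::finite) chart set \<Rightarrow> bool" where
  "smooth_structure A \<longleftrightarrow>
     (\<forall>c\<in>A. is_chart c) \<and>
     (\<Union>c\<in>A. fst c) = UNIV \<and>
     (\<forall>c\<in>A. \<forall>d\<in>A. compatible c d) \<and>
     (\<forall>c. is_chart c \<and> (\<forall>d\<in>A. compatible c d) \<longrightarrow> c \<in> A)"

definition charts_at :: "('a, 'n) chart set \<Rightarrow> 'a \<Rightarrow> ('a, 'n) chart set" where
  "charts_at A p = {c \<in> A. p \<in> fst c}"

definition smooth_fun :: "('a, 'n::finite) chart set \<Rightarrow> ('a \<Rightarrow> real) \<Rightarrow> bool" where
  "smooth_fun A f \<longleftrightarrow> (\<forall>c\<in>A. smooth_on (snd c ` fst c) (f \<circ> chart_inv c))"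

definition smooth_near ::
    "('a::topological_space, 'n::finite) chart set \<Rightarrow> 'a \<Rightarrow> ('a \<Rightarrow> real) \<Rightarrow> bool" where
  "smooth_near A p f \<longleftrightarrow>
     (\<exists>W. open W \<and> p \<in> W \<and> (\<forall>c\<in>A. smooth_on (snd c ` (fst c \<inter> W)) (f \<circ> chart_inv c)))"

definition partial :: "('a, 'n::finite) chart \<Rightarrow> 'n \<Rightarrow> ('a \<Rightarrow> real) \<Rightarrow> 'a \<Rightarrow> real" where
  "partial c i f p = frechet_derivative (f \<circ> chart_inv c) (at (snd c p)) (axis i 1)"


section \<open>Tangent spaces\<close>

text \<open>Tangent vectors at \<open>p\<close> are operators on the functions that are smooth near \<open>p\<close>. They are
  set to \<open>0\<close> on all other functions, so that equality of tangent vectors is equality of operators.\<close>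

type_synonym 'a tvec = "('a \<Rightarrow> real) \<Rightarrow> real"

definition coord_vec ::
    "('a::topological_space, 'n::finite) chart set \<Rightarrow> ('a, 'n) chart \<Rightarrow> 'n \<Rightarrow> 'a \<Rightarrow> 'a tvec" where
  "coord_vec A c i p = (\<lambda>f. if smooth_near A p f then partial c i f p else 0)"

definition from_components ::
    "('a::topological_space, 'n::finite) chart set \<Rightarrow> ('a, 'n) chart \<Rightarrow> 'a \<Rightarrow> real ^ 'n \<Rightarrow> 'a tvec" where
  "from_components A c p v = (\<lambda>f. \<Sum>i\<in>UNIV. v $ i * coord_vec A c i p f)"

definition tangent_space ::
    "('a::topological_space, 'n::finite) chart set \<Rightarrow> 'a \<Rightarrow> 'a tvec set" where
  "tangent_space A p = (\<Union>c\<in>charts_at A p. range (from_components A c p))"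

definition tvec_components ::
    "('a::topological_space, 'n::finite) chart set \<Rightarrow> ('a, 'n) chart \<Rightarrow> 'a \<Rightarrow> 'a tvec \<Rightarrow> real ^ 'n" where
  "tvec_components A c p \<eta> = (THE v. \<eta> = from_components A c p v)"

text \<open>The usual topology of the finite-dimensional vector space \<open>T\<^sub>pM\<close>, and its Borel sets.\<close>

definition tangent_open ::
    "('a::topological_space, 'n::finite) chart set \<Rightarrow> 'a \<Rightarrow> 'a tvec set \<Rightarrow> bool" where
  "tangent_open A p W \<longleftrightarrow>
     W \<subseteq> tangent_space A p \<and> (\<forall>c\<in>charts_at A p. open (tvec_components A c p ` W))"

definition tangent_borel ::
    "('a::topological_space, 'n::finite) chart set \<Rightarrow> 'a \<Rightarrow> 'a tvec measure" where
  "tangent_borel A p = sigma (tangent_space A p) {W. tangent_open A p W}"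

definition support ::
    "('a::topological_space, 'n::finite) chart set \<Rightarrow> 'a \<Rightarrow> 'a tvec measure \<Rightarrow> 'a tvec set" where
  "support A p m =
     {\<eta> \<in> tangent_space A p. \<forall>W. tangent_open A p W \<and> \<eta> \<in> W \<longrightarrow> emeasure m W > 0}"


section \<open>Riemannian metrics\<close>

type_synonym 'a metric = "'a \<Rightarrow> 'a tvec \<Rightarrow> 'a tvec \<Rightarrow> real"

definition metric_matrix ::
    "('a::topological_space, 'n::finite) chart set \<Rightarrow> 'a metric \<Rightarrow> ('a, 'n) chart \<Rightarrow> 'a \<Rightarrow> real ^ 'n ^ 'n" where
  "metric_matrix A g c p = (\<chi> i j. g p (coord_vec A c i p) (coord_vec A c j p))"

definition inverse_metric ::
    "('a::topological_space, 'n::finite) chart set \<Rightarrow> 'a metric \<Rightarrow> ('a, 'n) chart \<Rightarrow> 'a \<Rightarrow> real ^ 'n ^ 'n" where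
  "inverse_metric A g c p = matrix_inv (metric_matrix A g c p)"

definition riemannian_metric ::
    "('a::topological_space, 'n::finite) chart set \<Rightarrow> 'a metric \<Rightarrow> bool" where
  "riemannian_metric A g \<longleftrightarrow>
     (\<forall>p. \<forall>\<xi>\<in>tangent_space A p. \<forall>\<eta>\<in>tangent_space A p. \<forall>\<zeta>\<in>tangent_space A p. \<forall>a b.
        g p (\<lambda>f. a * \<xi> f + b * \<eta> f) \<zeta> = a * g p \<xi> \<zeta> + b * g p \<eta> \<zeta>) \<and>
     (\<forall>p. \<forall>\<xi>\<in>tangent_space A p. \<forall>\<eta>\<in>tangent_space A p. g p \<xi> \<eta> = g p \<eta> \<xi>) \<and>
     (\<forall>p. \<forall>\<xi>\<in>tangent_space A p. \<xi> \<noteq> (\<lambda>f. 0) \<longrightarrow> g p \<xi> \<xi> > 0) \<and>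
     (\<forall>c\<in>A. \<forall>i j. smooth_on (snd c ` fst c) ((\<lambda>p. metric_matrix A g c p $ i $ j) \<circ> chart_inv c))"

definition tangent_norm :: "'a metric \<Rightarrow> 'a \<Rightarrow> 'a tvec \<Rightarrow> real" where
  "tangent_norm g p \<eta> = sqrt (g p \<eta> \<eta>)"

text \<open>\<open>christoffel A g c k i j\<close> is \<open>\<Gamma>\<^sup>k\<^sub>i\<^sub>j\<close> of the Levi-Civita connection.\<close>

definition christoffel ::
    "('a::topological_space, 'n::finite) chart set \<Rightarrow> 'a metric \<Rightarrow> ('a, 'n) chart \<Rightarrow>
      'n \<Rightarrow> 'n \<Rightarrow> 'n \<Rightarrow> 'a \<Rightarrow> real" where
  "christoffel A g c k i j p = (1/2) * (\<Sum>l\<in>UNIV. inverse_metric A g c p $ k $ l *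
     (partial c i (\<lambda>q. metric_matrix A g c q $ j $ l) p
      + partial c j (\<lambda>q. metric_matrix A g c q $ i $ l) p
      - partial c l (\<lambda>q. metric_matrix A g c q $ i $ j) p))"


section \<open>Geodesics\<close>

text \<open>\<open>J\<close> is meant to be open, so that \<open>v\<close> below is the derivative of the coordinate
  representation of \<open>\<gamma>\<close> in a neighbourhood of each \<open>t\<close> in question.\<close>

definition is_geodesic ::
    "('a::topological_space, 'n::finite) chart set \<Rightarrow> 'a metric \<Rightarrow> real set \<Rightarrow> (real \<Rightarrow> 'a) \<Rightarrow> bool" where
  "is_geodesic A g J \<gamma> \<longleftrightarrow> continuous_on J \<gamma> \<and>
     (\<forall>c\<in>A. \<exists>v :: real \<Rightarrow> real ^ 'n. \<forall>t\<in>J. \<gamma> t \<in> fst c \<longrightarrow>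
        ((\<lambda>s. snd c (\<gamma> s)) has_vector_derivative v t) (at t) \<and>
        (v has_vector_derivative
           (\<chi> k. - (\<Sum>i\<in>UNIV. \<Sum>j\<in>UNIV. christoffel A g c k i j (\<gamma> t) * v t $ i * v t $ j))) (at t))"

definition velocity ::
    "('a::topological_space, 'n::finite) chart set \<Rightarrow> (real \<Rightarrow> 'a) \<Rightarrow> real \<Rightarrow> 'a tvec" where
  "velocity A \<gamma> t = (\<lambda>f. if smooth_near A (\<gamma> t) f then deriv (\<lambda>s. f (\<gamma> s)) t else 0)"

text \<open>\<open>geodesic A g p t \<xi>\<close> is \<open>p(t, \<xi>) = exp\<^sub>p(t\<xi>)\<close>, the position at time \<open>t\<close> of the geodesic that
  starts at \<open>p\<close> with velocity \<open>\<xi>\<close>.\<close>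

definition geodesic ::
    "('a::topological_space, 'n::finite) chart set \<Rightarrow> 'a metric \<Rightarrow> 'a \<Rightarrow> real \<Rightarrow> 'a tvec \<Rightarrow> 'a" where
  "geodesic A g p t \<xi> = (THE q. \<exists>J \<gamma>. open J \<and> is_interval J \<and> 0 \<in> J \<and> t \<in> J \<and>
     is_geodesic A g J \<gamma> \<and> \<gamma> 0 = p \<and> velocity A \<gamma> 0 = \<xi> \<and> \<gamma> t = q)"


section \<open>The Laplace-Beltrami operator\<close>

definition gradient ::
    "('a::topological_space, 'n::finite) chart set \<Rightarrow> 'a metric \<Rightarrow> ('a \<Rightarrow> real) \<Rightarrow> 'a \<Rightarrow> 'a tvec" where
  "gradient A g f p =
     (THE \<xi>. \<xi> \<in> tangent_space A p \<and> (\<forall>\<eta>\<in>tangent_space A p. g p \<xi> \<eta> = \<eta> f))"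

text \<open>The divergence of \<open>X\<close> is the trace of \<open>Y \<mapsto> \<nabla>\<^sub>YX\<close>, in coordinates
  \<open>\<Sum>\<^sub>i (\<partial>\<^sub>iX\<^sup>i + \<Sum>\<^sub>k \<Gamma>\<^sup>i\<^sub>i\<^sub>kX\<^sup>k)\<close>. As a trace, it does not depend on the chosen chart.\<close>

definition divergence ::
    "('a::topological_space, 'n::finite) chart set \<Rightarrow> 'a metric \<Rightarrow> ('a \<Rightarrow> 'a tvec) \<Rightarrow> 'a \<Rightarrow> real" where
  "divergence A g X p = (let c = (SOME c. c \<in> charts_at A p) in
     \<Sum>i\<in>UNIV. (partial c i (\<lambda>q. tvec_components A c q (X q) $ i) p
       + (\<Sum>k\<in>UNIV. christoffel A g c i i k p * tvec_components A c p (X p) $ k)))"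

definition laplace_beltrami ::
    "('a::topological_space, 'n::finite) chart set \<Rightarrow> 'a metric \<Rightarrow> ('a \<Rightarrow> real) \<Rightarrow> 'a \<Rightarrow> real" where
  "laplace_beltrami A g f = divergence A g (gradient A g f)"


section \<open>The generator of the geodesic random walk\<close>

definition L_gen ::
    "('a::topological_space, 'n::finite) chart set \<Rightarrow> 'a metric \<Rightarrow> ('a \<Rightarrow> 'a tvec measure) \<Rightarrow>
      nat \<Rightarrow> ('a \<Rightarrow> real) \<Rightarrow> 'a \<Rightarrow> real" where
  "L_gen A g \<mu> N f p = (LINT \<eta>|\<mu> p. f (geodesic A g p (1 / real N) \<eta>) - f p)"

end

theory Submission
  imports Defs
begin

text \<open>
  Let \<open>H(x, v) = \<Sum>\<^sub>i\<^sub>j (\<partial>\<^sub>i\<partial>\<^sub>jf - \<Sum>\<^sub>k \<Gamma>\<^sup>k\<^sub>i\<^sub>j \<partial>\<^sub>kf) v\<^sup>iv\<^sup>j\<close> be the second derivative of \<open>f\<close> along the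
  geodesic with state \<open>(x, v)\<close>. By Taylor's formula and the uniform continuity of \<open>H\<close> on compact
  sets of states, \<open>f(p(t, \<eta>)) - f(p) = t df(\<eta>) + t\<^sup>2/2 H(p, \<eta>) + o(t\<^sup>2)\<close> uniformly for \<open>p\<close> in a small
  coordinate ball and \<open>\<eta>\<close> in a bounded set. Integrating with respect to \<open>\<mu>\<^sub>p\<close>, the first moments cancel
  the linear term and the second moments turn \<open>H\<close> into its trace, which is the Laplacian.

  The measurability of \<open>\<eta> \<mapsto> f(p(t, \<eta>))\<close> on all of \<open>T\<^sub>pM\<close> does not need geodesic completeness:
  the set of \<open>\<eta>\<close> whose geodesic reaches time \<open>t\<close> is open, the endpoint depends continuously on \<open>\<eta>\<close>
  there, and it is a constant junk value elsewhere.
\<close>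

subsection \<open>Smooth functions\<close>

text \<open>\<open>is_geodesic\<close> demands the geodesic equation in every chart of the maximal
  atlas, whereas the theory of ordinary differential equations yields solutions in one chart. The
  transformation law of the acceleration bridges the two; it is derived from the kinetic energy,
  without transforming Christoffel symbols. \<open>geodesic\<close> is a definite description, so
  its values are accessible only through uniqueness, which rests on the Hausdorff property.
  \<open>divergence\<close> is computed in a chart picked by \<open>SOME\<close>; that any chart may
  be used instead is read off from the limit of the rescaled generator, whose definition mentions no
  chart. The uniform remainder needs a time of existence and a modulus of continuity common to all
  starting points near a given one. A flow box over a ball whose double still lies in the chart
  supplies both, and compactness of the manifold reduces the claim to finitely many such
  balls.\<close>

lemma frechet_derivative_transform_open:
  assumes "open S" "x \<in> S" "\<And>y. y \<in> S \<Longrightarrow> f y = g y"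
  shows "f differentiable (at x) \<longleftrightarrow> g differentiable (at x)"
    and "frechet_derivative f (at x) = frechet_derivative g (at x)"
proof -
  have "(f has_derivative D) (at x) \<longleftrightarrow> (g has_derivative D) (at x)" for D
    using assms by (metis has_derivative_transform_within_open)
  then show "f differentiable (at x) \<longleftrightarrow> g differentiable (at x)"
    and "frechet_derivative f (at x) = frechet_derivative g (at x)"
    by (simp_all add: differentiable_def frechet_derivative_def)
qed

lemma Ck_on_cong:
  assumes "open S" "\<And>x. x \<in> S \<Longrightarrow> f x = g x" "Ck_on k f S"
  shows "Ck_on k g S"
  using assms(2,3)
proof (induction k arbitrary: f g)
  case 0
  then show ?case by (metis Ck_on.simps(1) continuous_on_cong)
next
  case (Suc k)
  have d: "f differentiable (at x) \<longleftrightarrow> g differentiable (at x)"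
    "frechet_derivative f (at x) = frechet_derivative g (at x)" if "x \<in> S" for x
    using frechet_derivative_transform_open[OF assms(1) that Suc.prems(1)] by auto
  have "Ck_on k (\<lambda>x. frechet_derivative g (at x) v) S" for v
    by (rule Suc.IH[of "\<lambda>x. frechet_derivative f (at x) v"]) (use Suc.prems(2) d in auto)
  then show ?case using Suc.prems d by auto
qed

lemma Ck_on_subset: "Ck_on k f S \<Longrightarrow> T \<subseteq> S \<Longrightarrow> Ck_on k f T"
  by (induction k arbitrary: f) (auto intro: continuous_on_subset)

lemma Ck_on_SucD: "Ck_on (Suc k) f S \<Longrightarrow> Ck_on k f S"
proof (induction k arbitrary: f)
  case 0
  then show ?case
    by (auto intro!: continuous_at_imp_continuous_on differentiable_imp_continuous_within)
next
  case (Suc k)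
  have "Ck_on k (\<lambda>x. frechet_derivative f (at x) v) S" for v
    by (rule Suc.IH) (use Suc.prems in auto)
  then show ?case using Suc.prems by auto
qed

text \<open>Uniqueness of the derivative identifies any exhibited family \<open>D\<close> with
  \<open>frechet_derivative\<close>, so the closure properties below only have to name a
  derivative.\<close>

lemma Ck_on_SucI:
  assumes "open S" "\<And>x. x \<in> S \<Longrightarrow> (f has_derivative D x) (at x)" "\<And>v. Ck_on k (\<lambda>x. D x v) S"
  shows "Ck_on (Suc k) f S"
proof -
  have "frechet_derivative f (at x) = D x" if "x \<in> S" for x
    using frechet_derivative_at[OF assms(2)[OF that]] by simp
  then have "Ck_on k (\<lambda>x. frechet_derivative f (at x) v) S" for v
    by (intro Ck_on_cong[OF assms(1) _ assms(3)[of v]]) auto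
  then show ?thesis using assms(2) by (auto simp: differentiable_def)
qed

lemma Ck_on_const: "open S \<Longrightarrow> Ck_on k (\<lambda>x. c) S"
proof (induction k arbitrary: c)
  case (Suc k)
  show ?case by (rule Ck_on_SucI[OF Suc.prems, where D = "\<lambda>x v. 0"]) (auto intro: Suc)
qed auto

lemma Ck_on_bounded_linear:
  assumes "open S" "bounded_linear l"
  shows "Ck_on k f S \<Longrightarrow> Ck_on k (\<lambda>x. l (f x)) S"
proof (induction k arbitrary: f)
  case 0
  then show ?case by (auto intro: bounded_linear.continuous_on[OF assms(2)])
next
  case (Suc k)
  show ?case
    by (rule Ck_on_SucI[OF assms(1), where D = "\<lambda>x v. l (frechet_derivative f (at x) v)"])
      (use Suc in \<open>auto simp: frechet_derivative_works
        intro!: bounded_linear.has_derivative[OF assms(2)]\<close>)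
qed

lemma Ck_on_add:
  assumes "open S"
  shows "Ck_on k f S \<Longrightarrow> Ck_on k g S \<Longrightarrow> Ck_on k (\<lambda>x. f x + g x) S"
proof (induction k arbitrary: f g)
  case 0
  then show ?case by (auto intro: continuous_intros)
next
  case (Suc k)
  show ?case
    by (rule Ck_on_SucI[OF assms(1),
          where D = "\<lambda>x v. frechet_derivative f (at x) v + frechet_derivative g (at x) v"])
      (use Suc in \<open>auto simp: frechet_derivative_works intro!: has_derivative_add\<close>)
qed

text \<open>The product rule leaves undifferentiated factors behind, so the induction step also uses
  that order \<open>Suc k\<close> implies order \<open>k\<close>.\<close>

lemma Ck_on_mult:
  fixes f g :: "'e::real_normed_vector \<Rightarrow> real"
  assumes "open S"
  shows "Ck_on k f S \<Longrightarrow> Ck_on k g S \<Longrightarrow> Ck_on k (\<lambda>x. f x * g x) S"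
proof (induction k arbitrary: f g)
  case 0
  then show ?case by (auto intro: continuous_intros)
next
  case (Suc k)
  then have "Ck_on k f S" "Ck_on k g S" by (blast intro: Ck_on_SucD)+
  with Suc show ?case
    by (intro Ck_on_SucI[OF assms(1),
          where D = "\<lambda>x v. f x * frechet_derivative g (at x) v + frechet_derivative f (at x) v * g x"])
      (auto simp: frechet_derivative_works intro!: has_derivative_mult Ck_on_add assms)
qed

lemma Ck_on_inverse:
  fixes f :: "'e::real_normed_vector \<Rightarrow> real"
  assumes "open S" "\<And>x. x \<in> S \<Longrightarrow> f x \<noteq> 0"
  shows "Ck_on k f S \<Longrightarrow> Ck_on k (\<lambda>x. inverse (f x)) S"
proof (induction k)
  case 0
  then show ?case using assms by (auto intro: continuous_intros)
next
  case (Suc k)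
  \<comment> \<open>The derivative of the reciprocal contains the reciprocal itself; the induction
    hypothesis provides its regularity of order \<open>k\<close>.\<close>
  then have I: "Ck_on k (\<lambda>x. inverse (f x)) S" by (blast intro: Ck_on_SucD)
  have "Ck_on k (\<lambda>x. (-1) * (inverse (f x) * frechet_derivative f (at x) v * inverse (f x))) S" for v
    by (intro Ck_on_mult I Ck_on_const assms) (use Suc in auto)
  with Suc assms show ?case
    by (intro Ck_on_SucI[OF assms(1),
          where D = "\<lambda>x v. - (inverse (f x) * frechet_derivative f (at x) v * inverse (f x))"])
      (auto simp: frechet_derivative_works intro!: has_derivative_inverse)
qed

lemma smooth_on_continuous_on: "smooth_on S f \<Longrightarrow> continuous_on S f"
  unfolding smooth_on_def by (metis Ck_on.simps(1))

lemma smooth_on_cong: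
  "open S \<Longrightarrow> smooth_on S f \<Longrightarrow> (\<And>x. x \<in> S \<Longrightarrow> f x = g x) \<Longrightarrow> smooth_on S g"
  unfolding smooth_on_def using Ck_on_cong by blast

lemma smooth_on_subset: "smooth_on S f \<Longrightarrow> T \<subseteq> S \<Longrightarrow> smooth_on T f"
  unfolding smooth_on_def using Ck_on_subset by blast

lemma smooth_on_differentiable: "smooth_on S f \<Longrightarrow> x \<in> S \<Longrightarrow> f differentiable (at x)"
  unfolding smooth_on_def by (metis Ck_on.simps(2))

lemma smooth_on_has_derivative:
  "smooth_on S f \<Longrightarrow> x \<in> S \<Longrightarrow> (f has_derivative frechet_derivative f (at x)) (at x)"
  using smooth_on_differentiable frechet_derivative_works by blast

lemma smooth_on_frechet_derivative:
  "smooth_on S f \<Longrightarrow> smooth_on S (\<lambda>x. frechet_derivative f (at x) v)"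
  unfolding smooth_on_def by (metis Ck_on.simps(2))

lemma smooth_on_const: "open S \<Longrightarrow> smooth_on S (\<lambda>x. c)"
  unfolding smooth_on_def using Ck_on_const by blast

lemma smooth_on_bounded_linear:
  "open S \<Longrightarrow> smooth_on S f \<Longrightarrow> bounded_linear l \<Longrightarrow> smooth_on S (\<lambda>x. l (f x))"
  unfolding smooth_on_def using Ck_on_bounded_linear by blast

lemma smooth_on_nth:
  fixes f :: "'e::real_normed_vector \<Rightarrow> real ^ 'n"
  shows "open S \<Longrightarrow> smooth_on S f \<Longrightarrow> smooth_on S (\<lambda>x. f x $ i)"
  using smooth_on_bounded_linear[OF _ _ bounded_linear_vec_nth] by blast

lemma smooth_on_add:
  "open S \<Longrightarrow> smooth_on S f \<Longrightarrow> smooth_on S g \<Longrightarrow> smooth_on S (\<lambda>x. f x + g x)"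
  unfolding smooth_on_def using Ck_on_add by blast

lemma smooth_on_mult:
  fixes f g :: "'e::real_normed_vector \<Rightarrow> real"
  shows "open S \<Longrightarrow> smooth_on S f \<Longrightarrow> smooth_on S g \<Longrightarrow> smooth_on S (\<lambda>x. f x * g x)"
  unfolding smooth_on_def using Ck_on_mult by blast

lemma smooth_on_diff:
  fixes f g :: "'e::real_normed_vector \<Rightarrow> real"
  assumes "open S" "smooth_on S f" "smooth_on S g"
  shows "smooth_on S (\<lambda>x. f x - g x)"
  using smooth_on_add[OF assms(1,2) smooth_on_mult[OF assms(1) smooth_on_const[of _ "-1"] assms(3)]]
    assms(1) by simp

lemma smooth_on_divide:
  fixes f g :: "'e::real_normed_vector \<Rightarrow> real"
  shows "open S \<Longrightarrow> smooth_on S f \<Longrightarrow> smooth_on S g \<Longrightarrow> (\<And>x. x \<in> S \<Longrightarrow> g x \<noteq> 0) \<Longrightarrow>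
    smooth_on S (\<lambda>x. f x / g x)"
  unfolding divide_inverse
  by (intro smooth_on_mult) (auto simp: smooth_on_def intro!: Ck_on_inverse)

lemma smooth_on_sum:
  assumes "open S" "\<And>i. i \<in> I \<Longrightarrow> smooth_on S (f i)"
  shows "smooth_on S (\<lambda>x. \<Sum>i\<in>I. f i x)"
  using assms(2)
  by (induction I rule: infinite_finite_induct) (auto intro: smooth_on_add smooth_on_const assms(1))

lemma smooth_on_prod:
  fixes f :: "'i \<Rightarrow> 'e::real_normed_vector \<Rightarrow> real"
  assumes "open S" "\<And>i. i \<in> I \<Longrightarrow> smooth_on S (f i)"
  shows "smooth_on S (\<lambda>x. \<Prod>i\<in>I. f i x)"
  using assms(2)
  by (induction I rule: infinite_finite_induct) (auto intro: smooth_on_mult smooth_on_const assms(1))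

section \<open>Determinants and inverse matrices\<close>

lemma smooth_on_det:
  fixes M :: "'e::real_normed_vector \<Rightarrow> real ^ 'n ^ 'n"
  assumes "open S" "\<And>i j. smooth_on S (\<lambda>x. M x $ i $ j)"
  shows "smooth_on S (\<lambda>x. det (M x))"
  unfolding det_def by (intro smooth_on_sum smooth_on_mult smooth_on_prod smooth_on_const assms)

lemma matrix_inv_mult:
  fixes M :: "'a::field ^ 'n ^ 'n"
  assumes "det M \<noteq> 0"
  shows "M ** matrix_inv M = mat 1" "matrix_inv M ** M = mat 1"
  using assms someI_ex[of "\<lambda>B. M ** B = mat 1 \<and> B ** M = mat 1"]
  unfolding matrix_inv_def invertible_det_nz[symmetric] invertible_def by auto

text \<open>\<open>matrix_inv\<close> is defined by choice. Solving for the column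
  \<open>matrix_inv M *v axis l 1\<close> by Cramer's rule writes its entries as quotients of
  determinants, from which smoothness can be read off.\<close>

lemma matrix_inv_cramer:
  fixes M :: "real ^ 'n ^ 'n"
  assumes "det M \<noteq> 0"
  shows "matrix_inv M $ k $ l = det (\<chi> i j. if j = k then axis l 1 $ i else M $ i $ j) / det M"
proof -
  have "M ** matrix_inv M = mat 1"
    using assms by (rule matrix_inv_mult)
  then have "M *v (matrix_inv M *v axis l 1) = axis l 1"
    by (simp add: matrix_vector_mul_assoc)
  then have "matrix_inv M *v axis l 1 = (\<chi> k. det (\<chi> i j. if j = k then axis l 1 $ i else M $ i $ j) / det M)"
    using cramer[OF assms] by blast
  then have "(matrix_inv M *v axis l 1) $ k = det (\<chi> i j. if j = k then axis l 1 $ i else M $ i $ j) / det M"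
    by simp
  moreover have "(matrix_inv M *v axis l 1) $ k = matrix_inv M $ k $ l"
    by (simp add: matrix_vector_mult_def axis_def if_distrib cong: if_cong)
  ultimately show ?thesis by simp
qed

lemma smooth_on_matrix_inv:
  fixes M :: "'e::real_normed_vector \<Rightarrow> real ^ 'n ^ 'n"
  assumes "open S" "\<And>i j. smooth_on S (\<lambda>x. M x $ i $ j)" "\<And>x. x \<in> S \<Longrightarrow> det (M x) \<noteq> 0"
  shows "smooth_on S (\<lambda>x. matrix_inv (M x) $ k $ l)"
proof (rule smooth_on_cong[OF assms(1)])
  have "smooth_on S (\<lambda>x. if j = k then axis l 1 $ i else M x $ i $ j)" for i j
    using assms by (cases "j = k") (auto intro: smooth_on_const)
  then show "smooth_on S (\<lambda>x. det (\<chi> i j. if j = k then axis l 1 $ i else M x $ i $ j) / det (M x))"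
    by (intro smooth_on_divide smooth_on_det assms) auto
qed (rule matrix_inv_cramer[OF assms(3), symmetric])

section \<open>Symmetry of second derivatives\<close>

text \<open>Two applications of the mean value theorem, one in direction \<open>u\<close> and one in
  direction \<open>h\<close>. The intermediate point stays in the parallelogram spanned by
  \<open>s *\<^sub>R u\<close> and \<open>s *\<^sub>R h\<close> at \<open>x\<close>, whence the
  bound on its distance.\<close>

lemma frechet_derivative_second_difference:
  fixes f :: "'e::real_normed_vector \<Rightarrow> real"
  assumes S: "smooth_on (ball x r) f" and r: "0 < s" "s * (norm u + norm h) < r"
  shows "\<exists>y. norm (y - x) \<le> s * (norm u + norm h) \<and>
    f (x + s *\<^sub>R u + s *\<^sub>R h) - f (x + s *\<^sub>R u) - f (x + s *\<^sub>R h) + f x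
      = s\<^sup>2 * frechet_derivative (\<lambda>x. frechet_derivative f (at x) u) (at y) h"
proof -
  let ?D = "\<lambda>x. frechet_derivative f (at x)"
  let ?DD = "\<lambda>y. frechet_derivative (\<lambda>x. ?D x u) (at y)"
  have b: "norm (a *\<^sub>R u + b *\<^sub>R h) \<le> s * (norm u + norm h)"
    if "0 \<le> a" "a \<le> s" "0 \<le> b" "b \<le> s" for a b
  proof -
    have "norm (a *\<^sub>R u + b *\<^sub>R h) \<le> a * norm u + b * norm h"
      using norm_triangle_ineq[of "a *\<^sub>R u" "b *\<^sub>R h"] that by simp
    also have "\<dots> \<le> s * norm u + s * norm h"
      using that by (intro add_mono mult_right_mono) auto
    finally show ?thesis by (simp add: algebra_simps)
  qed
  have inb: "x + a *\<^sub>R u + b *\<^sub>R h \<in> ball x r" if "0 \<le> a" "a \<le> s" "0 \<le> b" "b \<le> s" for a b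
  proof -
    have "dist x (x + (a *\<^sub>R u + b *\<^sub>R h)) = norm (a *\<^sub>R u + b *\<^sub>R h)"
      by (simp only: dist_norm norm_minus_commute[of x] add_diff_cancel_left')
    then show ?thesis using b[OF that] r(2) by (simp add: add.assoc)
  qed
  have D: "(f has_derivative ?D y) (at y)" "((\<lambda>x. ?D x u) has_derivative ?DD y) (at y)"
    if "y \<in> ball x r" for y
    using that S by (auto intro!: smooth_on_has_derivative smooth_on_frechet_derivative)
  have lin: "?D y (a *\<^sub>R v) = a * ?D y v" "?DD y (a *\<^sub>R v) = a * ?DD y v" if "y \<in> ball x r" for y a v
    using D[OF that, THEN has_derivative_bounded_linear]
    by (simp_all add: linear_simps)
  \<comment> \<open>The second difference is the increment over [0, s] of the function that sends a
    to f(x + au + sh) - f(x + au).\<close>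
  have "\<exists>\<xi>. 0 < \<xi> \<and> \<xi> < s \<and>
    (f (x + s *\<^sub>R u + s *\<^sub>R h) - f (x + s *\<^sub>R u + 0 *\<^sub>R h)) - (f (x + 0 *\<^sub>R u + s *\<^sub>R h) - f (x + 0 *\<^sub>R u + 0 *\<^sub>R h))
      = (s - 0) * (?D (x + \<xi> *\<^sub>R u + s *\<^sub>R h) u - ?D (x + \<xi> *\<^sub>R u + 0 *\<^sub>R h) u)"
  proof (rule MVT2[OF r(1)])
    fix a :: real assume a: "0 \<le> a" "a \<le> s"
    have d: "((\<lambda>a. f (x + a *\<^sub>R u + b *\<^sub>R h)) has_real_derivative ?D (x + a *\<^sub>R u + b *\<^sub>R h) u) (at a)"
      if b: "0 \<le> b" "b \<le> s" for b
    proof (rule has_derivative_imp_has_field_derivative)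
      show "((\<lambda>a. f (x + a *\<^sub>R u + b *\<^sub>R h)) has_derivative (\<lambda>t. ?D (x + a *\<^sub>R u + b *\<^sub>R h) (t *\<^sub>R u))) (at a)"
        by (rule has_derivative_compose[of "\<lambda>a. x + a *\<^sub>R u + b *\<^sub>R h" "\<lambda>t. t *\<^sub>R u" a UNIV, OF _ D(1)[OF inb]])
          (use a b in \<open>auto intro!: derivative_eq_intros\<close>)
      show "t * ?D (x + a *\<^sub>R u + b *\<^sub>R h) u = ?D (x + a *\<^sub>R u + b *\<^sub>R h) (t *\<^sub>R u)" for t
        by (rule lin(1)[OF inb, symmetric]) (use a b in auto)
    qed
    show "((\<lambda>a. f (x + a *\<^sub>R u + s *\<^sub>R h) - f (x + a *\<^sub>R u + 0 *\<^sub>R h)) has_real_derivative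
        ?D (x + a *\<^sub>R u + s *\<^sub>R h) u - ?D (x + a *\<^sub>R u + 0 *\<^sub>R h) u) (at a)"
      by (intro DERIV_diff d) (use r in auto)
  qed
  then obtain \<xi> where \<xi>: "0 < \<xi>" "\<xi> < s" "f (x + s *\<^sub>R u + s *\<^sub>R h) - f (x + s *\<^sub>R u) - f (x + s *\<^sub>R h) + f x
      = s * (?D (x + \<xi> *\<^sub>R u + s *\<^sub>R h) u - ?D (x + \<xi> *\<^sub>R u + 0 *\<^sub>R h) u)"
    by auto
  have "\<exists>\<zeta>. 0 < \<zeta> \<and> \<zeta> < s \<and>
    ?D (x + \<xi> *\<^sub>R u + s *\<^sub>R h) u - ?D (x + \<xi> *\<^sub>R u + 0 *\<^sub>R h) u = (s - 0) * ?DD (x + \<xi> *\<^sub>R u + \<zeta> *\<^sub>R h) h"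
  proof (rule MVT2[OF r(1)])
    fix b :: real assume a: "0 \<le> b" "b \<le> s"
    show "((\<lambda>b. ?D (x + \<xi> *\<^sub>R u + b *\<^sub>R h) u) has_real_derivative ?DD (x + \<xi> *\<^sub>R u + b *\<^sub>R h) h) (at b)"
    proof (rule has_derivative_imp_has_field_derivative)
      show "((\<lambda>b. ?D (x + \<xi> *\<^sub>R u + b *\<^sub>R h) u) has_derivative (\<lambda>t. ?DD (x + \<xi> *\<^sub>R u + b *\<^sub>R h) (t *\<^sub>R h))) (at b)"
        by (rule has_derivative_compose[of "\<lambda>b. x + \<xi> *\<^sub>R u + b *\<^sub>R h" "\<lambda>t. t *\<^sub>R h" b UNIV, OF _ D(2)[OF inb]])
          (use a \<xi> in \<open>auto intro!: derivative_eq_intros\<close>)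
      show "t * ?DD (x + \<xi> *\<^sub>R u + b *\<^sub>R h) h = ?DD (x + \<xi> *\<^sub>R u + b *\<^sub>R h) (t *\<^sub>R h)" for t
        by (rule lin(2)[OF inb, symmetric]) (use a \<xi> in auto)
    qed
  qed
  then obtain \<zeta> where \<zeta>: "0 < \<zeta>" "\<zeta> < s"
    "?D (x + \<xi> *\<^sub>R u + s *\<^sub>R h) u - ?D (x + \<xi> *\<^sub>R u + 0 *\<^sub>R h) u = s * ?DD (x + \<xi> *\<^sub>R u + \<zeta> *\<^sub>R h) h"
    by auto
  show ?thesis
    by (rule exI[of _ "x + \<xi> *\<^sub>R u + \<zeta> *\<^sub>R h"])
      (use b[of \<xi> \<zeta>] \<xi> \<zeta> in \<open>auto simp: power2_eq_square add.assoc\<close>)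
qed

text \<open>The intermediate point tends to \<open>x\<close> with \<open>s\<close>, and the second
  derivative is continuous at \<open>x\<close>.\<close>

lemma frechet_derivative_second_difference_tendsto:
  fixes f :: "'e::real_normed_vector \<Rightarrow> real"
  assumes S: "smooth_on S f" "open S" "x \<in> S"
  shows "((\<lambda>s. (f (x + s *\<^sub>R u + s *\<^sub>R h) - f (x + s *\<^sub>R u) - f (x + s *\<^sub>R h) + f x) / s\<^sup>2) \<longlongrightarrow>
    frechet_derivative (\<lambda>x. frechet_derivative f (at x) u) (at x) h) (at_right 0)"
proof (rule tendstoI)
  let ?DD = "\<lambda>y. frechet_derivative (\<lambda>x. frechet_derivative f (at x) u) (at y) h"
  fix e :: real assume e: "e > 0"
  obtain r where r: "r > 0" "ball x r \<subseteq> S" using S openE by blast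
  have sm: "smooth_on (ball x r) f" using S(1) r(2) smooth_on_subset by blast
  have "smooth_on S ?DD" by (intro smooth_on_frechet_derivative S)
  then have "isCont ?DD x" using smooth_on_continuous_on S continuous_on_eq_continuous_at by blast
  then obtain d where d: "d > 0" "\<And>y. dist y x < d \<Longrightarrow> dist (?DD y) (?DD x) < e"
    using e unfolding continuous_at_eps_delta by metis
  \<comment> \<open>The summand 1 keeps \<open>c\<close> positive when both directions
    vanish.\<close>
  define c where "c = norm u + norm h + 1"
  have c: "c > 0" unfolding c_def by (smt (verit) norm_ge_zero)
  show "\<forall>\<^sub>F s in at_right 0. dist ((f (x + s *\<^sub>R u + s *\<^sub>R h) - f (x + s *\<^sub>R u) - f (x + s *\<^sub>R h) + f x) / s\<^sup>2)
    (?DD x) < e"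
    unfolding eventually_at_right_field
  proof (intro exI[of _ "min r d / c"] conjI allI impI)
    show "0 < min r d / c" using r d c by simp
    fix s :: real assume s: "0 < s" "s < min r d / c"
    then have "s * c < min r d" using c by (simp add: field_simps)
    moreover have "s * (norm u + norm h) \<le> s * c" using s by (simp add: c_def)
    ultimately have sc: "s * (norm u + norm h) < r" "s * (norm u + norm h) < d" by auto
    obtain y where "norm (y - x) \<le> s * (norm u + norm h)"
      "f (x + s *\<^sub>R u + s *\<^sub>R h) - f (x + s *\<^sub>R u) - f (x + s *\<^sub>R h) + f x = s\<^sup>2 * ?DD y"
      using frechet_derivative_second_difference[OF sm s(1) sc(1)] by blast
    then show "dist ((f (x + s *\<^sub>R u + s *\<^sub>R h) - f (x + s *\<^sub>R u) - f (x + s *\<^sub>R h) + f x) / s\<^sup>2) (?DD x) < e"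
      using d(2)[of y] sc s by (simp add: dist_norm)
  qed
qed

text \<open>The second difference is symmetric in \<open>u\<close> and \<open>h\<close>, so both
  iterated derivatives are limits of the same quotient.\<close>

lemma frechet_derivative_symmetric:
  fixes f :: "'e::real_normed_vector \<Rightarrow> real"
  assumes "smooth_on S f" "open S" "x \<in> S"
  shows "frechet_derivative (\<lambda>x. frechet_derivative f (at x) u) (at x) h
    = frechet_derivative (\<lambda>x. frechet_derivative f (at x) h) (at x) u"
proof -
  have "f (x + s *\<^sub>R h + s *\<^sub>R u) - f (x + s *\<^sub>R h) - f (x + s *\<^sub>R u) + f x
    = f (x + s *\<^sub>R u + s *\<^sub>R h) - f (x + s *\<^sub>R u) - f (x + s *\<^sub>R h) + f x" for s
    by (simp add: add.assoc add.commute[of "s *\<^sub>R h"])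
  then show ?thesis
    using frechet_derivative_second_difference_tendsto[OF assms, of h u]
    by (intro tendsto_unique[OF trivial_limit_at_right_real
          frechet_derivative_second_difference_tendsto[OF assms, of u h]]) presburger
qed

subsection \<open>Ordinary differential equations\<close>

lemma vector_derivative_bound:
  fixes h :: "real \<Rightarrow> 'e::real_normed_vector"
  assumes "convex T" "\<And>t. t \<in> T \<Longrightarrow> (h has_vector_derivative h' t) (at t within T)"
    "\<And>t. t \<in> T \<Longrightarrow> norm (h' t) \<le> B" "a \<in> T" "b \<in> T"
  shows "norm (h a - h b) \<le> B * \<bar>a - b\<bar>"
proof -
  have "onorm (\<lambda>t. t *\<^sub>R h' s) \<le> B" if "s \<in> T" for s
    by (rule onorm_le) (use assms(3)[OF that] in \<open>simp add: mult.commute[of B] mult_left_mono\<close>)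
  then show ?thesis
    using differentiable_bound[OF assms(1), of h "\<lambda>s t. t *\<^sub>R h' s" B a b] assms
    by (auto simp: has_vector_derivative_def)
qed

text \<open>A substitute for Gronwall's inequality on short intervals. Where the distance of the
  solutions is maximal, it has grown by at most \<open>d * L\<close> times that maximum, that is by
  at most half of it; this half is absorbed, which costs the factor 2.\<close>

lemma ode_difference_bound:
  fixes x y :: "real \<Rightarrow> 'e::real_normed_vector"
  assumes F: "L-lipschitz_on K F" and d: "0 \<le> d" "2 * d * L \<le> 1"
    and x: "\<And>t. t \<in> cball s d \<Longrightarrow> x t \<in> K \<and> (x has_vector_derivative F (x t)) (at t)"
    and y: "\<And>t. t \<in> cball s d \<Longrightarrow> y t \<in> K \<and> (y has_vector_derivative F (y t)) (at t)"
    and t: "t \<in> cball s d"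
  shows "dist (x t) (y t) \<le> 2 * dist (x s) (y s)"
proof -
  let ?h = "\<lambda>t. x t - y t"
  have h: "(?h has_vector_derivative (F (x t) - F (y t))) (at t)" if "t \<in> cball s d" for t
    using x[OF that] y[OF that] by (auto intro: derivative_intros)
  then have "continuous_on (cball s d) ?h"
    by (intro continuous_at_imp_continuous_on ballI) (rule has_vector_derivative_continuous)
  then have c: "continuous_on (cball s d) (\<lambda>t. norm (?h t))"
    by (rule continuous_on_norm)
  have "cball s d \<noteq> {}" using t by blast
  from continuous_attains_sup[OF compact_cball this c] obtain m where m: "m \<in> cball s d" "\<And>t. t \<in> cball s d \<Longrightarrow> norm (?h t) \<le> norm (?h m)"
    by blast
  have L: "L \<ge> 0" using F by (rule lipschitz_on_nonneg)
  have "norm (?h m - ?h s) \<le> (L * norm (?h m)) * \<bar>m - s\<bar>"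
  proof (rule vector_derivative_bound[OF convex_cball[of s d]])
    fix t assume t: "t \<in> cball s d"
    show "(?h has_vector_derivative (F (x t) - F (y t))) (at t within cball s d)"
      using h[OF t] has_vector_derivative_at_within by blast
    have "norm (F (x t) - F (y t)) \<le> L * norm (?h t)"
      using lipschitz_on_normD[OF F] x[OF t] y[OF t] by blast
    also have "\<dots> \<le> L * norm (?h m)" using m(2)[OF t] L by (rule mult_left_mono)
    finally show "norm (F (x t) - F (y t)) \<le> L * norm (?h m)" .
  qed (use m(1) d in auto)
  also have "\<dots> \<le> (L * norm (?h m)) * d"
    using m(1) L by (intro mult_left_mono) (auto simp: dist_real_def)
  also have "\<dots> = (d * L) * norm (?h m)" by simp
  also have "\<dots> \<le> (1/2) * norm (?h m)" using d by (intro mult_right_mono) auto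
  finally have "norm (?h m) \<le> 2 * norm (?h s)"
    using norm_triangle_ineq2[of "?h m" "?h s"] by linarith
  with m(2)[OF t] show ?thesis by (simp add: dist_norm)
qed

lemma ode_local_unique:
  fixes x y :: "real \<Rightarrow> 'e::real_normed_vector"
  assumes F: "L-lipschitz_on K F"
    and x: "\<forall>\<^sub>F t in nhds s. x t \<in> K \<and> (x has_vector_derivative F (x t)) (at t)"
    and y: "\<forall>\<^sub>F t in nhds s. y t \<in> K \<and> (y has_vector_derivative F (y t)) (at t)"
    and s: "x s = y s"
  shows "\<forall>\<^sub>F t in nhds s. x t = y t"
proof -
  obtain r where r: "r > 0" "\<And>t. dist t s < r \<Longrightarrow> x t \<in> K \<and> (x has_vector_derivative F (x t)) (at t)"
      "\<And>t. dist t s < r \<Longrightarrow> y t \<in> K \<and> (y has_vector_derivative F (y t)) (at t)"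
    using eventually_conj[OF x y] unfolding eventually_nhds_metric by blast
  have L: "L \<ge> 0" using F by (rule lipschitz_on_nonneg)
  \<comment> \<open>Halving \<open>r\<close> keeps the closed ball inside the open region where both
    equations hold; \<open>L + 1\<close> avoids dividing by zero.\<close>
  define d where "d = min (r / 2) (1 / (2 * (L + 1)))"
  have d: "d > 0" "d < r" "2 * d * (L + 1) \<le> 1"
    using r(1) L by (auto simp: d_def min_def field_simps)
  have "2 * d * L \<le> 2 * d * (L + 1)" using d by simp
  then have "2 * d * L \<le> 1" using d(3) by linarith
  then have "x t = y t" if "dist t s < d" for t
    using ode_difference_bound[OF F _ _ _ _, of d s x y t] r d s that
    by (simp add: dist_commute)
  then show ?thesis unfolding eventually_nhds_metric using d(1) by blast
qed

text \<open>Picard iteration as a contraction of the complete space of bounded continuous functions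
  on the whole line. The Picard operator integrates only up to a clamped time, so no space of
  functions on an interval is needed.\<close>

lemma ode_exists_globally_lipschitz:
  fixes G :: "'e::banach \<Rightarrow> 'e"
  assumes G: "L-lipschitz_on UNIV G" and B: "\<And>x. norm (G x) \<le> B"
    and \<tau>: "\<tau> > 0" "8 * \<tau> * L \<le> 1"
  shows "\<exists>x. x 0 = z \<and> (\<forall>t. \<bar>t\<bar> < \<tau> \<longrightarrow> (x has_vector_derivative G (x t)) (at t))"
proof -
  have L: "L \<ge> 0" using G by (rule lipschitz_on_nonneg)
  have B0: "B \<ge> 0" using B[of 0] norm_ge_zero order_trans by blast
  define cl where "cl t = max (-\<tau>) (min \<tau> t)" for t :: real
  have cl: "cl t \<in> {-\<tau>..\<tau>}" for t using \<tau> by (auto simp: cl_def)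
  \<comment> \<open>The oriented integral of \<open>h\<close> from 0 to \<open>cl t\<close>, as a
    difference that covers both signs of \<open>t\<close>. Each of the two integrals is over a
    length of at most 2\<tau>, so 4\<tau>L bounds the contraction constant; this explains the factor
    8 in the hypothesis.\<close>
  define I where "I h t = integral {-\<tau>..cl t} h - integral {-\<tau>..0} h" for h :: "real \<Rightarrow> 'e" and t
  define P where "P \<phi> = Bcontfun (\<lambda>t. z + I (\<lambda>s. G (apply_bcontfun \<phi> s)) t)" for \<phi> :: "real \<Rightarrow>\<^sub>C 'e"
  have Gc: "continuous_on UNIV G" using G lipschitz_on_continuous_on by blast
  have cont: "continuous_on T (\<lambda>s. G (apply_bcontfun \<phi> s))" for \<phi> T
    by (rule continuous_on_compose2[OF Gc]) auto
  have bnd: "norm (I h t) \<le> 4 * \<tau> * C" if "continuous_on UNIV h" "\<And>s. norm (h s) \<le> C" for h C t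
  proof -
    have C: "C \<ge> 0" using that(2)[of 0] norm_ge_zero order_trans by blast
    have *: "norm (integral {-\<tau>..u} h) \<le> 2 * \<tau> * C" if "u \<in> {-\<tau>..\<tau>}" for u
    proof -
      have "norm (integral {-\<tau>..u} h) \<le> C * (u - (-\<tau>))"
        using that \<open>continuous_on UNIV h\<close> \<open>\<And>s. norm (h s) \<le> C\<close>
        by (intro integral_bound) (auto intro: continuous_on_subset)
      also have "\<dots> \<le> C * (2 * \<tau>)" using that C by (intro mult_left_mono) auto
      finally show ?thesis by (simp add: mult_ac)
    qed
    have "norm (I h t) \<le> norm (integral {-\<tau>..cl t} h) + norm (integral {-\<tau>..0} h)"
      unfolding I_def by (rule norm_triangle_ineq4)
    also have "\<dots> \<le> 2 * \<tau> * C + 2 * \<tau> * C"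
      using cl \<tau> by (intro add_mono *) auto
    finally show ?thesis by (simp add: mult_ac)
  qed
  have Ic: "continuous_on UNIV (I h)" if "continuous_on UNIV h" for h
  proof -
    have "h integrable_on {-\<tau>..\<tau>}"
      using that by (intro integrable_continuous_real) (auto intro: continuous_on_subset)
    then have "continuous_on {-\<tau>..\<tau>} (\<lambda>u. integral {-\<tau>..u} h)"
      by (rule indefinite_integral_continuous_1)
    moreover have "continuous_on UNIV cl" unfolding cl_def by (intro continuous_intros)
    ultimately have "continuous_on UNIV (\<lambda>t. integral {-\<tau>..cl t} h)"
      using cl by (auto intro: continuous_on_compose2)
    then show ?thesis unfolding I_def by (intro continuous_intros)
  qed
  have P: "apply_bcontfun (P \<phi>) t = z + I (\<lambda>s. G (apply_bcontfun \<phi> s)) t" for \<phi> t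
  proof -
    have "(\<lambda>t. z + I (\<lambda>s. G (apply_bcontfun \<phi> s)) t) \<in> bcontfun"
    proof (rule bcontfun_normI)
      show "continuous_on UNIV (\<lambda>t. z + I (\<lambda>s. G (apply_bcontfun \<phi> s)) t)"
        by (intro continuous_intros Ic cont)
      show "norm (z + I (\<lambda>s. G (apply_bcontfun \<phi> s)) t) \<le> norm z + 4 * \<tau> * B" for t
        using norm_triangle_ineq[of z "I (\<lambda>s. G (apply_bcontfun \<phi> s)) t"] bnd[OF cont B, of \<phi> t] by simp
    qed
    then show ?thesis unfolding P_def by (simp add: Bcontfun_inverse)
  qed
  have "\<exists>!\<phi>. P \<phi> = \<phi>"
  proof (rule banach_fix_type[of "1/2"], safe)
    fix \<phi> \<psi> :: "real \<Rightarrow>\<^sub>C 'e"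
    show "dist (P \<phi>) (P \<psi>) \<le> 1/2 * dist \<phi> \<psi>"
    proof (rule dist_bound)
      fix t
      let ?h = "\<lambda>s. G (apply_bcontfun \<phi> s) - G (apply_bcontfun \<psi> s)"
      have int: "(\<lambda>s. G (apply_bcontfun \<phi> s)) integrable_on {-\<tau>..u}" for \<phi> u
        by (intro integrable_continuous_real cont)
      have "apply_bcontfun (P \<phi>) t - apply_bcontfun (P \<psi>) t = I ?h t"
        by (simp add: P I_def integral_diff[OF int int])
      moreover have "norm (I ?h t) \<le> 4 * \<tau> * (L * dist \<phi> \<psi>)"
      proof (rule bnd)
        show "continuous_on UNIV ?h" by (intro continuous_intros cont)
        show "norm (?h s) \<le> L * dist \<phi> \<psi>" for s
          using lipschitz_onD[OF G, of "apply_bcontfun \<phi> s" "apply_bcontfun \<psi> s"]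
            mult_left_mono[OF dist_bounded[of \<phi> s \<psi>] L]
          by (simp add: dist_norm)
      qed
      moreover have "4 * \<tau> * (L * dist \<phi> \<psi>) \<le> 1/2 * dist \<phi> \<psi>"
        using mult_right_mono[OF \<tau>(2), of "dist \<phi> \<psi>"] by simp
      ultimately show "dist (apply_bcontfun (P \<phi>) t) (apply_bcontfun (P \<psi>) t) \<le> 1/2 * dist \<phi> \<psi>"
        by (simp add: dist_norm)
    qed
  qed auto
  then obtain \<phi> where \<phi>: "P \<phi> = \<phi>" by blast
  let ?h = "\<lambda>s. G (apply_bcontfun \<phi> s)"
  have eq: "apply_bcontfun \<phi> t = z + I ?h t" for t using P[of \<phi> t] \<phi> by simp
  have "(apply_bcontfun \<phi> has_vector_derivative ?h t) (at t)" if t: "\<bar>t\<bar> < \<tau>" for t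
  proof -
    have "((\<lambda>u. integral {-\<tau>..u} ?h) has_vector_derivative ?h t) (at t within {-\<tau>..\<tau>})"
      by (rule integral_has_vector_derivative) (use t cont in auto)
    moreover have "at t within {-\<tau>..\<tau>} = at t"
      by (rule at_within_interior) (use t in auto)
    ultimately have "((\<lambda>u. z + (integral {-\<tau>..u} ?h - integral {-\<tau>..0} ?h)) has_vector_derivative ?h t) (at t)"
      by (auto intro!: derivative_eq_intros)
    \<comment> \<open>Strictly inside the time interval the clamping is inactive, and the fixed
      point equation can be differentiated.\<close>
    then show ?thesis
    proof (rule has_vector_derivative_transform_within_open[where S = "{-\<tau><..<\<tau>}"])
      fix u assume "u \<in> {-\<tau><..<\<tau>}"
      then show "z + (integral {-\<tau>..u} ?h - integral {-\<tau>..0} ?h) = apply_bcontfun \<phi> u"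
        by (subst eq) (simp add: I_def cl_def)
    qed (use t in auto)
  qed
  moreover have "apply_bcontfun \<phi> 0 = z" using eq[of 0] \<tau> by (simp add: I_def cl_def)
  ultimately show ?thesis by blast
qed

text \<open>\<open>F\<close> is controlled on \<open>K\<close> only. Composing it with the
  nearest-point projection onto the convex set \<open>K\<close>, which has Lipschitz constant 1,
  gives a bounded field that is Lipschitz everywhere and equals \<open>F\<close> on
  \<open>K\<close>. Its solutions are too slow to leave \<open>K\<close> within time \<tau>, hence
  they solve the original equation.\<close>

lemma ode_flow_box:
  fixes F :: "'e::euclidean_space \<Rightarrow> 'e"
  assumes K: "compact K" "convex K" and F: "L-lipschitz_on K F"
    and \<rho>: "\<rho> > 0" "\<And>z. z \<in> Z \<Longrightarrow> cball z \<rho> \<subseteq> K"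
  obtains \<tau> B \<Phi> where "\<tau> > 0" "B \<ge> 0"
    "\<And>z. z \<in> Z \<Longrightarrow> \<Phi> z 0 = z"
    "\<And>z t. z \<in> Z \<Longrightarrow> \<bar>t\<bar> < \<tau> \<Longrightarrow> \<Phi> z t \<in> cball z \<rho>"
    "\<And>z t. z \<in> Z \<Longrightarrow> \<bar>t\<bar> < \<tau> \<Longrightarrow> (\<Phi> z has_vector_derivative F (\<Phi> z t)) (at t)"
    "\<And>z t. z \<in> Z \<Longrightarrow> \<bar>t\<bar> < \<tau> \<Longrightarrow> dist (\<Phi> z t) z \<le> B * \<bar>t\<bar>"
    "\<And>z w t. z \<in> Z \<Longrightarrow> w \<in> Z \<Longrightarrow> \<bar>t\<bar> < \<tau> \<Longrightarrow> dist (\<Phi> z t) (\<Phi> w t) \<le> 2 * dist z w"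
proof (cases "Z = {}")
  case True
  then show ?thesis using that[of 1 0] by auto
next
  case False
  then have "K \<noteq> {}" using \<rho> by (metis all_not_in_conv centre_in_cball less_imp_le subset_empty)
  have clK: "closed K" using K(1) compact_imp_closed by blast
  define G where "G x = F (closest_point K x)" for x
  have cpK: "closest_point K x \<in> K" for x using closest_point_in_set[OF clK \<open>K \<noteq> {}\<close>] .
  have GF: "G x = F x" if "x \<in> K" for x using that by (simp add: G_def closest_point_self)
  have "1-lipschitz_on UNIV (closest_point K)"
    by (rule lipschitz_onI) (use closest_point_lipschitz[OF K(2) clK \<open>K \<noteq> {}\<close>] in auto)
  then have "(L * 1)-lipschitz_on UNIV G"
    unfolding G_def using cpK by (intro lipschitz_on_compose2) (auto intro: lipschitz_on_subset[OF F])
  then have G: "L-lipschitz_on UNIV G" by simp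
  have "compact (F ` K)"
    using compact_continuous_image[OF lipschitz_on_continuous_on[OF F] K(1)] .
  then obtain B where B: "B > 0" "\<And>x. x \<in> F ` K \<Longrightarrow> norm x \<le> B"
    using compact_imp_bounded bounded_pos by metis
  have GB: "norm (G x) \<le> B" for x unfolding G_def using B(2) cpK by blast
  have L: "L \<ge> 0" using F by (rule lipschitz_on_nonneg)
  \<comment> \<open>At speed at most \<open>B\<close> a solution stays within distance \<rho> up to
    time \<rho>/B; the other bound is the smallness required for existence.\<close>
  define \<tau> where "\<tau> = min (\<rho> / B) (1 / (8 * (L + 1)))"
  have \<tau>: "\<tau> > 0" "B * \<tau> \<le> \<rho>" "8 * \<tau> * (L + 1) \<le> 1"
    using \<rho>(1) B(1) L by (auto simp: \<tau>_def min_def field_simps)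
  have "8 * \<tau> * L \<le> 8 * \<tau> * (L + 1)" using \<tau> by simp
  then have \<tau>L: "8 * \<tau> * L \<le> 1" using \<tau>(3) by linarith
  obtain \<Phi> where \<Phi>: "\<And>z. \<Phi> z 0 = z"
    "\<And>z t. \<bar>t\<bar> < \<tau> \<Longrightarrow> (\<Phi> z has_vector_derivative G (\<Phi> z t)) (at t)"
    using ode_exists_globally_lipschitz[OF G GB \<tau>(1) \<tau>L] by metis
  have speed: "dist (\<Phi> z t) z \<le> B * \<bar>t\<bar>" if "\<bar>t\<bar> < \<tau>" for z t
  proof -
    have "norm (\<Phi> z t - \<Phi> z 0) \<le> B * \<bar>t - 0\<bar>"
      by (rule vector_derivative_bound[where T = "{-\<tau><..<\<tau>}" and h' = "\<lambda>t. G (\<Phi> z t)"])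
        (use that \<tau> GB in \<open>auto intro!: has_vector_derivative_at_within \<Phi>(2)\<close>)
    then show ?thesis by (simp add: dist_norm \<Phi>(1))
  qed
  have inball: "\<Phi> z t \<in> cball z \<rho>" if "\<bar>t\<bar> < \<tau>" for z t
  proof -
    have "B * \<bar>t\<bar> \<le> B * \<tau>" using that B(1) by (intro mult_left_mono) auto
    then show ?thesis using speed[OF that, of z] \<tau>(2) by (simp add: dist_commute)
  qed
  have deriv: "(\<Phi> z has_vector_derivative F (\<Phi> z t)) (at t)" if "z \<in> Z" "\<bar>t\<bar> < \<tau>" for z t
    using \<Phi>(2)[OF that(2), of z] inball[OF that(2), of z] \<rho>(2)[OF that(1)] GF by auto
  have dep: "dist (\<Phi> z t) (\<Phi> w t) \<le> 2 * dist z w" if "z \<in> Z" "w \<in> Z" "\<bar>t\<bar> < \<tau>" for z w t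
  proof -
    have "2 * \<bar>t\<bar> * L \<le> 8 * \<tau> * L" using that L \<tau> by (intro mult_right_mono) auto
    then have "2 * \<bar>t\<bar> * L \<le> 1" using \<tau>L by linarith
    then have "dist (\<Phi> z t) (\<Phi> w t) \<le> 2 * dist (\<Phi> z 0) (\<Phi> w 0)"
      using inball deriv \<rho>(2) that
      by (intro ode_difference_bound[OF F, of "\<bar>t\<bar>" 0]) (auto simp: dist_real_def subset_iff)
    then show ?thesis by (simp add: \<Phi>(1))
  qed
  show ?thesis by (rule that[OF \<tau>(1) less_imp_le[OF B(1)] \<Phi>(1) inball deriv speed dep])
qed

subsection \<open>Tangent spaces in coordinates\<close>

lemma linear_axis_sum:
  fixes L :: "real ^ 'n \<Rightarrow> 'b::real_vector"
  assumes "linear L"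
  shows "L v = (\<Sum>i\<in>UNIV. v $ i *\<^sub>R L (axis i 1))"
proof -
  have "L v = L (\<Sum>i\<in>UNIV. v $ i *\<^sub>R axis i 1)"
    by (simp add: basis_expansion flip: scalar_mult_eq_scaleR)
  also have "\<dots> = (\<Sum>i\<in>UNIV. v $ i *\<^sub>R L (axis i 1))"
    using assms by (simp add: linear_sum linear_scale)
  finally show ?thesis .
qed

locale smooth_manifold =
  fixes A :: "('a::t2_space, 'n::finite) chart set"
  assumes smooth_structure: "smooth_structure A"
begin

abbreviation img :: "('a, 'n) chart \<Rightarrow> (real ^ 'n) set" where
  "img c \<equiv> snd c ` fst c"

abbreviation transition :: "('a, 'n) chart \<Rightarrow> ('a, 'n) chart \<Rightarrow> real ^ 'n \<Rightarrow> real ^ 'n" where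
  "transition c d \<equiv> snd d \<circ> chart_inv c"

lemma charts_atI: "c \<in> A \<Longrightarrow> p \<in> fst c \<Longrightarrow> c \<in> charts_at A p"
  by (simp add: charts_at_def)

lemma charts_at_nonempty: "\<exists>c. c \<in> charts_at A p"
  using smooth_structure unfolding smooth_structure_def charts_at_def by blast

lemma charts_atD [simp]: "c \<in> charts_at A p \<Longrightarrow> c \<in> A" "c \<in> charts_at A p \<Longrightarrow> p \<in> fst c"
  by (simp_all add: charts_at_def)

context
  fixes c assumes c: "c \<in> A"
begin

lemma chart_homeo: "homeomorphism (fst c) (img c) (snd c) (chart_inv c)"
  and open_dom: "open (fst c)" and open_img: "open (img c)"
  using smooth_structure c by (auto simp: smooth_structure_def is_chart_def)

lemma chart_inv_left: "q \<in> fst c \<Longrightarrow> chart_inv c (snd c q) = q"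
  and chart_inv_right: "x \<in> img c \<Longrightarrow> snd c (chart_inv c x) = x"
  and chart_inv_dom: "x \<in> img c \<Longrightarrow> chart_inv c x \<in> fst c"
  using chart_homeo by (force simp: homeomorphism_def)+

lemma chart_isCont: "q \<in> fst c \<Longrightarrow> isCont (snd c) q"
  and chart_inv_isCont: "x \<in> img c \<Longrightarrow> isCont (chart_inv c) x"
  using chart_homeo open_dom open_img
  by (auto simp: homeomorphism_def continuous_on_eq_continuous_at)

lemma chart_image_Int: "snd c ` (fst c \<inter> W) = img c \<inter> chart_inv c -` W"
  using chart_inv_left chart_inv_right chart_inv_dom by (auto simp: image_iff)

lemma open_chart_image_Int: "open W \<Longrightarrow> open (snd c ` (fst c \<inter> W))"
  unfolding chart_image_Int
  using chart_homeo by (intro continuous_open_preimage open_img) (auto simp: homeomorphism_def)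

end

declare chart_inv_left [simp] chart_inv_right [simp] chart_inv_dom [simp]

lemma smooth_transition:
  "c \<in> A \<Longrightarrow> d \<in> A \<Longrightarrow> smooth_on (snd c ` (fst c \<inter> fst d)) (transition c d)"
  using smooth_structure by (auto simp: smooth_structure_def compatible_def)

lemma open_overlap: "c \<in> A \<Longrightarrow> d \<in> A \<Longrightarrow> open (snd c ` (fst c \<inter> fst d))"
  by (simp add: open_chart_image_Int open_dom)

lemma transition_has_derivative:
  "c \<in> charts_at A p \<Longrightarrow> d \<in> charts_at A p \<Longrightarrow>
    (transition c d has_derivative frechet_derivative (transition c d) (at (snd c p))) (at (snd c p))"
  by (rule smooth_on_has_derivative[OF smooth_transition]) auto

text \<open>Makes coordinate functions admissible arguments of tangent vectors, so that applying a
  vector to them recovers its components.\<close>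

lemma smooth_near_coordinate:
  assumes "c \<in> charts_at A p"
  shows "smooth_near A p (\<lambda>q. snd c q $ i)"
proof -
  have "smooth_on (snd d ` (fst d \<inter> fst c)) ((\<lambda>q. snd c q $ i) \<circ> chart_inv d)" if "d \<in> A" for d
    using smooth_on_nth[OF open_overlap smooth_transition, of d c i] that assms by (simp add: o_def)
  then show ?thesis
    unfolding smooth_near_def using assms open_dom by (intro exI[of _ "fst c"]) auto
qed

lemma smooth_near_differentiable:
  assumes "c \<in> charts_at A p" "smooth_near A p f"
  shows "(f \<circ> chart_inv c) differentiable (at (snd c p))"
proof -
  obtain W where "p \<in> W" "smooth_on (snd c ` (fst c \<inter> W)) (f \<circ> chart_inv c)"
    using assms unfolding smooth_near_def by auto
  then show ?thesis using assms by (auto intro: smooth_on_differentiable)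
qed

lemma smooth_fun_smooth_near: "smooth_fun A f \<Longrightarrow> smooth_near A p f"
  unfolding smooth_fun_def smooth_near_def by (auto intro!: exI[of _ UNIV])

lemma partial_at_img:
  "c \<in> A \<Longrightarrow> x \<in> img c \<Longrightarrow>
    partial c i f (chart_inv c x) = frechet_derivative (f \<circ> chart_inv c) (at x) (axis i 1)"
  by (simp add: partial_def chart_inv_right)

lemma from_components_apply:
  assumes "c \<in> charts_at A p"
  shows "from_components A c p v f =
    (if smooth_near A p f then frechet_derivative (f \<circ> chart_inv c) (at (snd c p)) v else 0)"
proof (cases "smooth_near A p f")
  case True
  then have "linear (frechet_derivative (f \<circ> chart_inv c) (at (snd c p)))"
    using smooth_near_differentiable[OF assms] linear_frechet_derivative by blast
  from linear_axis_sum[OF this, of v] True show ?thesis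
    by (simp add: from_components_def coord_vec_def partial_def)
qed (simp add: from_components_def coord_vec_def)

lemma from_components_coordinate:
  assumes "c \<in> charts_at A p"
  shows "from_components A c p v (\<lambda>q. snd c q $ i) = v $ i"
proof -
  have p: "snd c p \<in> img c" "c \<in> A" using assms by auto
  have "((\<lambda>x. x $ i) has_derivative (\<lambda>v. v $ i)) (at (snd c p))"
    by (rule bounded_linear_imp_has_derivative[OF bounded_linear_vec_nth])
  then have "((\<lambda>q. snd c q $ i) \<circ> chart_inv c has_derivative (\<lambda>v. v $ i)) (at (snd c p))"
    by (rule has_derivative_transform_within_open[OF _ open_img p(1)])
      (use p in auto)
  from frechet_derivative_at[OF this, symmetric] show ?thesis
    by (simp add: from_components_apply[OF assms] smooth_near_coordinate[OF assms])
qed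

text \<open>Evaluation at the coordinate functions separates components; this is what makes the
  definite description in \<open>tvec_components\<close> meaningful.\<close>

lemma from_components_inject:
  "c \<in> charts_at A p \<Longrightarrow> from_components A c p v = from_components A c p w \<longleftrightarrow> v = w"
  using from_components_coordinate by (metis vec_eq_iff)

lemma tvec_components_from_components [simp]:
  "c \<in> charts_at A p \<Longrightarrow> tvec_components A c p (from_components A c p v) = v"
  unfolding tvec_components_def by (rule the_equality) (auto simp: from_components_inject)

text \<open>The chain rule: near \<open>p\<close>, the representation of \<open>f\<close> in
  \<open>c\<close> is its representation in \<open>d\<close> composed with the transition map. On
  functions that are not smooth near \<open>p\<close> both operators are 0.\<close>

lemma from_components_transition:
  assumes c: "c \<in> charts_at A p" and d: "d \<in> charts_at A p"
  shows "from_components A c p v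
    = from_components A d p (frechet_derivative (transition c d) (at (snd c p)) v)"
proof
  fix f
  show "from_components A c p v f
    = from_components A d p (frechet_derivative (transition c d) (at (snd c p)) v) f"
  proof (cases "smooth_near A p f")
    case True
    let ?U = "snd c ` (fst c \<inter> fst d)"
    have U: "open ?U" "snd c p \<in> ?U" using c d open_overlap by auto
    have "(f \<circ> chart_inv d) differentiable (at (transition c d (snd c p)))"
      using smooth_near_differentiable[OF d True] c by simp
    then have "((f \<circ> chart_inv d) \<circ> transition c d has_derivative
      frechet_derivative (f \<circ> chart_inv d) (at (transition c d (snd c p)))
       \<circ> frechet_derivative (transition c d) (at (snd c p))) (at (snd c p))"
      by (intro diff_chain_at transition_has_derivative[OF c d]) (simp add: frechet_derivative_works)
    then have "(f \<circ> chart_inv c has_derivative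
      frechet_derivative (f \<circ> chart_inv d) (at (transition c d (snd c p)))
       \<circ> frechet_derivative (transition c d) (at (snd c p))) (at (snd c p))"
      by (rule has_derivative_transform_within_open[OF _ U])
        (use c d in auto)
    from frechet_derivative_at[OF this, symmetric] show ?thesis
      using True c
      by (simp add: from_components_apply[OF c] from_components_apply[OF d])
  qed (simp add: from_components_apply c d)
qed

text \<open>The tangent space is defined as a union over charts; the change of components shows that
  one chart already yields all of it.\<close>

lemma tangent_space_eq:
  assumes "c \<in> charts_at A p"
  shows "tangent_space A p = range (from_components A c p)"
  unfolding tangent_space_def using from_components_transition[OF _ assms] assms by blast

lemma from_components_in_tangent_space [simp]:
  "c \<in> charts_at A p \<Longrightarrow> from_components A c p v \<in> tangent_space A p"
  using tangent_space_eq by blast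

lemma from_components_tvec_components:
  "c \<in> charts_at A p \<Longrightarrow> \<eta> \<in> tangent_space A p \<Longrightarrow>
    from_components A c p (tvec_components A c p \<eta>) = \<eta>"
  using tangent_space_eq[of c p] by auto

lemma from_components_add_scale:
  "from_components A c p (a *\<^sub>R v + b *\<^sub>R w)
    = (\<lambda>f. a * from_components A c p v f + b * from_components A c p w f)"
  by (auto simp: from_components_def sum.distrib sum_distrib_left algebra_simps)

lemma from_components_0: "from_components A c p 0 = (\<lambda>f. 0)"
  by (simp add: from_components_def)

lemma from_components_axis: "from_components A c p (axis i 1) = coord_vec A c i p"
  by (simp add: from_components_def axis_def if_distrib[of "\<lambda>x. x * _"] cong: if_cong)

lemma eventually_in_dom:
  "isCont \<gamma> t \<Longrightarrow> c \<in> charts_at A (\<gamma> t) \<Longrightarrow> \<forall>\<^sub>F s in nhds t. \<gamma> s \<in> fst c"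
  by (metis charts_atD open_dom isCont_def tendsto_nhds_iff topological_tendstoD)

lemma velocity_from_components:
  fixes \<gamma> :: "real \<Rightarrow> 'a"
  assumes \<gamma>: "isCont \<gamma> t" and c: "c \<in> charts_at A (\<gamma> t)"
    and v: "((\<lambda>s. snd c (\<gamma> s)) has_vector_derivative v) (at t)"
  shows "velocity A \<gamma> t = from_components A c (\<gamma> t) v"
proof
  fix f
  show "velocity A \<gamma> t f = from_components A c (\<gamma> t) v f"
  proof (cases "smooth_near A (\<gamma> t) f")
    case True
    let ?D = "frechet_derivative (f \<circ> chart_inv c) (at (snd c (\<gamma> t)))"
    obtain T where T: "open T" "t \<in> T" "\<And>s. s \<in> T \<Longrightarrow> \<gamma> s \<in> fst c"
      using eventually_in_dom[OF \<gamma> c] unfolding eventually_nhds by blast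
    have D: "(f \<circ> chart_inv c has_derivative ?D) (at (snd c (\<gamma> t)))"
      using smooth_near_differentiable[OF c True] frechet_derivative_works by blast
    have "((f \<circ> chart_inv c) \<circ> (\<lambda>s. snd c (\<gamma> s)) has_derivative ?D \<circ> (\<lambda>s. s *\<^sub>R v)) (at t)"
      using v D unfolding has_vector_derivative_def by (intro diff_chain_at)
    then have "((\<lambda>s. f (\<gamma> s)) has_derivative ?D \<circ> (\<lambda>s. s *\<^sub>R v)) (at t)"
      by (rule has_derivative_transform_within_open[OF _ T(1,2)])
        (use T c in auto)
    then have "((\<lambda>s. f (\<gamma> s)) has_real_derivative ?D v) (at t)"
      by (rule has_derivative_imp_has_field_derivative)
        (use linear_frechet_derivative[OF smooth_near_differentiable[OF c True]] in \<open>simp add: linear_scale\<close>)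
    then show ?thesis
      using True by (simp add: velocity_def from_components_apply[OF c] DERIV_imp_deriv)
  qed (simp add: velocity_def from_components_apply[OF c])
qed

lemma has_vector_derivative_transition:
  fixes \<gamma> :: "real \<Rightarrow> 'a"
  assumes \<gamma>: "isCont \<gamma> t" and c: "c \<in> charts_at A (\<gamma> t)" and d: "d \<in> charts_at A (\<gamma> t)"
    and v: "((\<lambda>s. snd c (\<gamma> s)) has_vector_derivative v) (at t)"
  shows "((\<lambda>s. snd d (\<gamma> s)) has_vector_derivative
    frechet_derivative (transition c d) (at (snd c (\<gamma> t))) v) (at t)"
proof -
  let ?D = "frechet_derivative (transition c d) (at (snd c (\<gamma> t)))"
  obtain T where T: "open T" "t \<in> T" "\<And>s. s \<in> T \<Longrightarrow> \<gamma> s \<in> fst c"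
    using eventually_in_dom[OF \<gamma> c] unfolding eventually_nhds by blast
  have "(transition c d \<circ> (\<lambda>s. snd c (\<gamma> s)) has_derivative ?D \<circ> (\<lambda>s. s *\<^sub>R v)) (at t)"
    using v transition_has_derivative[OF c d] unfolding has_vector_derivative_def by (intro diff_chain_at)
  then have "((\<lambda>s. snd d (\<gamma> s)) has_derivative ?D \<circ> (\<lambda>s. s *\<^sub>R v)) (at t)"
    by (rule has_derivative_transform_within_open[OF _ T(1,2)])
      (use T c in auto)
  then show ?thesis
    using linear_scale[OF has_derivative_linear[OF transition_has_derivative[OF c d]]]
    by (simp add: has_vector_derivative_def o_def)
qed

end

subsection \<open>The metric in coordinates\<close>

locale riemannian_manifold = smooth_manifold A for A :: "('a::t2_space, 'n::finite) chart set" +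
  fixes g :: "'a metric"
  assumes riemannian_metric: "riemannian_metric A g"
begin

definition gmat :: "('a, 'n) chart \<Rightarrow> real ^ 'n \<Rightarrow> real ^ 'n ^ 'n" where
  "gmat c x = metric_matrix A g c (chart_inv c x)"

text \<open>The point comes last so that \<open>gform c u v\<close>, with constant component
  vectors, is a function on the chart image that can be differentiated.\<close>

definition gform :: "('a, 'n) chart \<Rightarrow> real ^ 'n \<Rightarrow> real ^ 'n \<Rightarrow> real ^ 'n \<Rightarrow> real" where
  "gform c u v x = (\<Sum>i\<in>UNIV. \<Sum>j\<in>UNIV. u $ i * v $ j * gmat c x $ i $ j)"

lemma metric_linear:
  "\<lbrakk>\<xi> \<in> tangent_space A p; \<eta> \<in> tangent_space A p; \<zeta> \<in> tangent_space A p\<rbrakk> \<Longrightarrow>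
    g p (\<lambda>f. a * \<xi> f + b * \<eta> f) \<zeta> = a * g p \<xi> \<zeta> + b * g p \<eta> \<zeta>"
  and metric_sym: "\<lbrakk>\<xi> \<in> tangent_space A p; \<eta> \<in> tangent_space A p\<rbrakk> \<Longrightarrow> g p \<xi> \<eta> = g p \<eta> \<xi>"
  and metric_pos: "\<lbrakk>\<xi> \<in> tangent_space A p; \<xi> \<noteq> (\<lambda>f. 0)\<rbrakk> \<Longrightarrow> g p \<xi> \<xi> > 0"
  using riemannian_metric unfolding riemannian_metric_def by blast+

lemma linear_metric_from_components:
  assumes c: "c \<in> charts_at A p" and \<zeta>: "\<zeta> \<in> tangent_space A p"
  shows "linear (\<lambda>u. g p (from_components A c p u) \<zeta>)"
proof -
  have *: "g p (from_components A c p (a *\<^sub>R v + b *\<^sub>R w)) \<zeta>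
    = a * g p (from_components A c p v) \<zeta> + b * g p (from_components A c p w) \<zeta>" for a b v w
    unfolding from_components_add_scale by (intro metric_linear) (use c \<zeta> in auto)
  show ?thesis
    using *[of 1 _ 1] *[of _ _ 0 0] by (intro linearI) auto
qed

lemma metric_from_components:
  assumes c: "c \<in> charts_at A p"
  shows "g p (from_components A c p u) (from_components A c p v) = gform c u v (snd c p)"
proof -
  have T: "coord_vec A c i p \<in> tangent_space A p" for i
    using from_components_in_tangent_space[OF c, of "axis i 1"] by (simp add: from_components_axis)
  have e: "g p (from_components A c p w) \<zeta> = (\<Sum>i\<in>UNIV. w $ i * g p (coord_vec A c i p) \<zeta>)"
    if "\<zeta> \<in> tangent_space A p" for w \<zeta>
    using linear_axis_sum[OF linear_metric_from_components[OF c that], of w]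
    by (simp add: from_components_axis)
  have "g p (coord_vec A c i p) (from_components A c p v)
      = (\<Sum>j\<in>UNIV. v $ j * g p (coord_vec A c i p) (coord_vec A c j p))" for i
    using e[OF T, of v i] metric_sym[OF T[of i]] T c by simp
  then show ?thesis
    using c by (simp add: e gform_def gmat_def metric_matrix_def sum_distrib_left mult.assoc)
qed

context
  fixes c assumes c: "c \<in> A"
begin

lemma gform_at: "x \<in> img c \<Longrightarrow> gform c u v x
    = g (chart_inv c x) (from_components A c (chart_inv c x) u) (from_components A c (chart_inv c x) v)"
  using metric_from_components[OF charts_atI[OF c chart_inv_dom[OF c]]] by (simp add: c chart_inv_right)

lemma gform_sym: "x \<in> img c \<Longrightarrow> gform c u v x = gform c v u x"
  unfolding gform_at using charts_atI[OF c chart_inv_dom[OF c]] by (intro metric_sym) auto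

lemma gform_pos:
  assumes "x \<in> img c" "v \<noteq> 0" shows "gform c v v x > 0"
proof -
  have p: "c \<in> charts_at A (chart_inv c x)" using charts_atI[OF c chart_inv_dom[OF c assms(1)]] .
  then have "from_components A c (chart_inv c x) v \<noteq> (\<lambda>f. 0)"
    using from_components_inject[OF p, of v 0] assms(2) by (simp add: from_components_0)
  then show ?thesis unfolding gform_at[OF assms(1)] using p by (intro metric_pos) auto
qed

lemma gmat_sym: "x \<in> img c \<Longrightarrow> gmat c x $ i $ j = gmat c x $ j $ i"
  using charts_atI[OF c chart_inv_dom[OF c]]
  by (auto simp: gmat_def metric_matrix_def simp flip: from_components_axis intro!: metric_sym)

lemma gform_inner: "gform c u v x = u \<bullet> (gmat c x *v v)"
  by (simp add: gform_def inner_vec_def matrix_vector_mult_def sum_distrib_left mult_ac)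

text \<open>A nonzero vector in the kernel of the metric matrix would have length zero.\<close>

lemma det_gmat: "x \<in> img c \<Longrightarrow> det (gmat c x) \<noteq> 0"
proof
  assume x: "x \<in> img c" and "det (gmat c x) = 0"
  then have "\<not> inj ((*v) (gmat c x))"
    using det_nz_iff_inj[of "(*v) (gmat c x)"] by simp
  then obtain v where "v \<noteq> 0" "gmat c x *v v = 0"
    using linear_injective_0[OF matrix_vector_mul_linear] by blast
  then show False using gform_pos[OF x] gform_inner by fastforce
qed

lemma smooth_gmat: "smooth_on (img c) (\<lambda>x. gmat c x $ i $ j)"
  using riemannian_metric c unfolding riemannian_metric_def gmat_def by (simp add: o_def)

lemma smooth_gmat_inv: "smooth_on (img c) (\<lambda>x. matrix_inv (gmat c x) $ i $ j)"
  by (intro smooth_on_matrix_inv open_img smooth_gmat det_gmat c)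

end

lemma linear_gform: "linear (\<lambda>v. gform c u v x)" "linear (\<lambda>u. gform c u v x)"
  by (auto intro!: linearI simp: gform_def sum.distrib sum_distrib_left algebra_simps)

end

subsection \<open>The geodesic equation\<close>

lemma frechet_derivative_nth:
  fixes f :: "'e::real_normed_vector \<Rightarrow> real ^ 'm"
  assumes "f differentiable (at x)"
  shows "frechet_derivative (\<lambda>x. f x $ i) (at x) v = frechet_derivative f (at x) v $ i"
proof -
  have "((\<lambda>x. f x $ i) has_derivative (\<lambda>v. frechet_derivative f (at x) v $ i)) (at x)"
    using assms by (intro bounded_linear.has_derivative[OF bounded_linear_vec_nth])
      (simp add: frechet_derivative_works)
  from frechet_derivative_at[OF this, symmetric] show ?thesis by simp
qed

lemma frechet_derivative_symmetric_vec:
  fixes f :: "'e::real_normed_vector \<Rightarrow> real ^ 'm"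
  assumes f: "smooth_on S f" "open S" "x \<in> S"
  shows "frechet_derivative (\<lambda>x. frechet_derivative f (at x) u) (at x) h
    = frechet_derivative (\<lambda>x. frechet_derivative f (at x) h) (at x) u"
proof -
  have *: "frechet_derivative (\<lambda>x. frechet_derivative f (at x) u) (at x) h $ i
    = frechet_derivative (\<lambda>x. frechet_derivative (\<lambda>x. f x $ i) (at x) u) (at x) h" for i u h
  proof -
    have "frechet_derivative (\<lambda>x. frechet_derivative f (at x) u) (at x) h $ i
      = frechet_derivative (\<lambda>x. frechet_derivative f (at x) u $ i) (at x) h"
      by (rule frechet_derivative_nth[symmetric])
        (rule smooth_on_differentiable[OF smooth_on_frechet_derivative[OF f(1)] f(3)])
    moreover have "frechet_derivative (\<lambda>x. frechet_derivative f (at x) u $ i) (at x)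
      = frechet_derivative (\<lambda>x. frechet_derivative (\<lambda>x. f x $ i) (at x) u) (at x)"
      by (rule frechet_derivative_transform_open(2)[OF f(2,3)])
        (simp add: frechet_derivative_nth smooth_on_differentiable[OF f(1)])
    ultimately show ?thesis by simp
  qed
  show ?thesis
    unfolding vec_eq_iff *
    using frechet_derivative_symmetric[OF smooth_on_nth[OF f(2,1)] f(2,3)] by blast
qed

context riemannian_manifold
begin

abbreviation dgmat :: "('a, 'n) chart \<Rightarrow> 'n \<Rightarrow> 'n \<Rightarrow> 'n \<Rightarrow> real ^ 'n \<Rightarrow> real" where
  "dgmat c k i j x \<equiv> frechet_derivative (\<lambda>x. gmat c x $ i $ j) (at x) (axis k 1)"

definition acceleration :: "('a, 'n) chart \<Rightarrow> real ^ 'n \<Rightarrow> real ^ 'n \<Rightarrow> real ^ 'n" where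
  "acceleration c x v = (\<chi> k. - (\<Sum>i\<in>UNIV. \<Sum>j\<in>UNIV. christoffel A g c k i j (chart_inv c x) * v $ i * v $ j))"

text \<open>The geodesic equation as a first-order autonomous system for pairs of position and
  velocity.\<close>

definition spray :: "('a, 'n) chart \<Rightarrow> (real ^ 'n) \<times> (real ^ 'n) \<Rightarrow> (real ^ 'n) \<times> (real ^ 'n)" where
  "spray c z = (snd z, acceleration c (fst z) (snd z))"

text \<open>The velocity is computed from the curve, which replaces the existentially quantified
  \<open>v\<close> of \<open>is_geodesic\<close>.\<close>

definition state :: "('a, 'n) chart \<Rightarrow> (real \<Rightarrow> 'a) \<Rightarrow> real \<Rightarrow> (real ^ 'n) \<times> (real ^ 'n)" where
  "state c \<gamma> t = (snd c (\<gamma> t), vector_derivative (\<lambda>s. snd c (\<gamma> s)) (at t))"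

lemma inverse_metric_eq: "inverse_metric A g c (chart_inv c x) = matrix_inv (gmat c x)"
  by (simp add: inverse_metric_def gmat_def)

lemma christoffel_eq:
  assumes "c \<in> A" "x \<in> img c"
  shows "christoffel A g c k i j (chart_inv c x) = 1/2 * (\<Sum>l\<in>UNIV. matrix_inv (gmat c x) $ k $ l *
    (dgmat c i j l x + dgmat c j i l x - dgmat c l i j x))"
  using assms by (simp add: christoffel_def partial_at_img inverse_metric_eq o_def flip: gmat_def)

lemma frechet_derivative_gmat_sum:
  assumes "c \<in> A" "x \<in> img c"
  shows "frechet_derivative (\<lambda>x. gmat c x $ i $ j) (at x) h = (\<Sum>k\<in>UNIV. h $ k * dgmat c k i j x)"
  using linear_axis_sum[OF linear_frechet_derivative[OF smooth_on_differentiable[OF smooth_gmat]], OF assms, of i j h]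
  by simp

lemma dgmat_sym:
  assumes "c \<in> A" "x \<in> img c"
  shows "dgmat c k i j x = dgmat c k j i x"
  using frechet_derivative_transform_open(2)[OF open_img[OF assms(1)] assms(2),
      of "\<lambda>x. gmat c x $ i $ j" "\<lambda>x. gmat c x $ j $ i"] gmat_sym[OF assms(1)] by simp

text \<open>The product rule when the point and both vectors vary. The vectors must be allowed to
  vary because a change of charts turns constant components into \<open>dtrans y u\<close>, which
  depends on \<open>y\<close>.\<close>

lemma gform_compose_has_derivative:
  assumes d: "d \<in> A" "\<phi> x \<in> img d" and D: "(\<alpha> has_derivative \<alpha>') (at x)"
    "(\<beta> has_derivative \<beta>') (at x)" "(\<phi> has_derivative \<phi>') (at x)"
  shows "((\<lambda>y. gform d (\<alpha> y) (\<beta> y) (\<phi> y)) has_derivative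
    (\<lambda>h. gform d (\<alpha>' h) (\<beta> x) (\<phi> x) + gform d (\<alpha> x) (\<beta>' h) (\<phi> x)
      + (\<Sum>i\<in>UNIV. \<Sum>j\<in>UNIV. \<alpha> x $ i * \<beta> x $ j
          * frechet_derivative (\<lambda>y. gmat d y $ i $ j) (at (\<phi> x)) (\<phi>' h)))) (at x)"
proof -
  have G: "((\<lambda>y. gmat d (\<phi> y) $ i $ j) has_derivative
     (\<lambda>h. frechet_derivative (\<lambda>y. gmat d y $ i $ j) (at (\<phi> x)) (\<phi>' h))) (at x)" for i j
    using diff_chain_at[OF D(3) smooth_on_has_derivative[OF smooth_gmat[OF d(1)] d(2)]]
    by (simp add: o_def)
  have n: "((\<lambda>y. \<alpha> y $ i) has_derivative (\<lambda>h. \<alpha>' h $ i)) (at x)"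
    "((\<lambda>y. \<beta> y $ i) has_derivative (\<lambda>h. \<beta>' h $ i)) (at x)" for i
    using D by (auto intro: bounded_linear.has_derivative[OF bounded_linear_vec_nth])
  have "((\<lambda>y. \<alpha> y $ i * \<beta> y $ j * gmat d (\<phi> y) $ i $ j) has_derivative
     (\<lambda>h. \<alpha>' h $ i * \<beta> x $ j * gmat d (\<phi> x) $ i $ j + \<alpha> x $ i * \<beta>' h $ j * gmat d (\<phi> x) $ i $ j
       + \<alpha> x $ i * \<beta> x $ j * frechet_derivative (\<lambda>y. gmat d y $ i $ j) (at (\<phi> x)) (\<phi>' h))) (at x)" for i j
    by (rule has_derivative_eq_rhs[OF has_derivative_mult[OF has_derivative_mult[OF n] G]])
      (simp add: fun_eq_iff algebra_simps)
  then have "((\<lambda>y. \<Sum>i\<in>UNIV. \<Sum>j\<in>UNIV. \<alpha> y $ i * \<beta> y $ j * gmat d (\<phi> y) $ i $ j) has_derivative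
     (\<lambda>h. \<Sum>i\<in>UNIV. \<Sum>j\<in>UNIV. \<alpha>' h $ i * \<beta> x $ j * gmat d (\<phi> x) $ i $ j + \<alpha> x $ i * \<beta>' h $ j * gmat d (\<phi> x) $ i $ j
       + \<alpha> x $ i * \<beta> x $ j * frechet_derivative (\<lambda>y. gmat d y $ i $ j) (at (\<phi> x)) (\<phi>' h))) (at x)"
    by (intro has_derivative_sum)
  then show ?thesis by (simp add: gform_def sum.distrib)
qed

lemma frechet_derivative_gform:
  assumes "c \<in> A" "x \<in> img c"
  shows "frechet_derivative (gform c u v) (at x) h
    = (\<Sum>i\<in>UNIV. \<Sum>j\<in>UNIV. u $ i * v $ j * frechet_derivative (\<lambda>x. gmat c x $ i $ j) (at x) h)"
proof -
  have "((\<lambda>y. gform c u v y) has_derivative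
    (\<lambda>h. gform c 0 v x + gform c u 0 x + (\<Sum>i\<in>UNIV. \<Sum>j\<in>UNIV. u $ i * v $ j
          * frechet_derivative (\<lambda>y. gmat c y $ i $ j) (at x) h))) (at x)"
    by (rule gform_compose_has_derivative[OF assms(1), where \<phi> = "\<lambda>y. y" and \<alpha> = "\<lambda>y. u" and \<beta> = "\<lambda>y. v"])
      (use assms in auto)
  moreover have "gform c 0 v x = 0" "gform c u 0 x = 0" by (simp_all add: gform_def)
  ultimately show ?thesis using frechet_derivative_at[symmetric, of "gform c u v"] by simp
qed

text \<open>The geodesic equation is the Euler--Lagrange equation of the kinetic energy
  \<open>gform c v v x / 2\<close>. In this form it is easily transformed to other coordinates.\<close>

lemma gform_acceleration:
  assumes c: "c \<in> A" "x \<in> img c"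
  shows "gform c u (acceleration c x v) x
    = 1/2 * frechet_derivative (gform c v v) (at x) u - frechet_derivative (gform c u v) (at x) v"
proof -
  \<comment> \<open>Twice the Christoffel symbols with lowered index, contracted with
    \<open>v\<close> in both lower arguments. Pairing with the metric cancels the inverse metric and
    leaves this vector.\<close>
  define w :: "real ^ 'n" where "w = (\<chi> l. \<Sum>i\<in>UNIV. \<Sum>j\<in>UNIV.
    (dgmat c i j l x + dgmat c j i l x - dgmat c l i j x) * v $ i * v $ j)"
  have acc: "acceleration c x v = - (1/2) *\<^sub>R (matrix_inv (gmat c x) *v w)"
  proof -
    have "(\<Sum>i\<in>UNIV. \<Sum>j\<in>UNIV. christoffel A g c k i j (chart_inv c x) * v $ i * v $ j)
      = 1/2 * (\<Sum>l\<in>UNIV. matrix_inv (gmat c x) $ k $ l * w $ l)" for k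
    proof -
      have "(\<Sum>i\<in>UNIV. \<Sum>j\<in>UNIV. christoffel A g c k i j (chart_inv c x) * v $ i * v $ j)
        = (\<Sum>i\<in>UNIV. \<Sum>j\<in>UNIV. \<Sum>l\<in>UNIV. 1/2 * (matrix_inv (gmat c x) $ k $ l *
          ((dgmat c i j l x + dgmat c j i l x - dgmat c l i j x) * v $ i * v $ j)))"
        by (simp add: christoffel_eq[OF c] sum_distrib_left sum_distrib_right mult.assoc)
      also have "\<dots> = (\<Sum>i\<in>UNIV. \<Sum>l\<in>UNIV. \<Sum>j\<in>UNIV. 1/2 * (matrix_inv (gmat c x) $ k $ l *
          ((dgmat c i j l x + dgmat c j i l x - dgmat c l i j x) * v $ i * v $ j)))"
        by (intro sum.cong refl sum.swap)
      also have "\<dots> = (\<Sum>l\<in>UNIV. \<Sum>i\<in>UNIV. \<Sum>j\<in>UNIV. 1/2 * (matrix_inv (gmat c x) $ k $ l *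
          ((dgmat c i j l x + dgmat c j i l x - dgmat c l i j x) * v $ i * v $ j)))"
        by (rule sum.swap)
      finally show ?thesis by (simp add: w_def sum_distrib_left)
    qed
    then show ?thesis
      by (simp add: acceleration_def vec_eq_iff matrix_vector_mult_def)
  qed
  have "gform c u (acceleration c x v) x = - (1/2) * (u \<bullet> (gmat c x *v (matrix_inv (gmat c x) *v w)))"
    unfolding gform_inner[OF c(1)] acc by (simp add: matrix_vector_mult_scaleR flip: scaleR_minus_left)
  also have "gmat c x *v (matrix_inv (gmat c x) *v w) = w"
    by (simp add: matrix_vector_mul_assoc matrix_inv_mult[OF det_gmat[OF c]])
  also have "u \<bullet> w = 2 * frechet_derivative (gform c u v) (at x) v - frechet_derivative (gform c v v) (at x) u"
  proof -
    \<comment> \<open>Two of the three derivative terms coincide after the symmetric contraction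
      with \<open>v\<close>.\<close>
    have 1: "(\<Sum>i\<in>UNIV. \<Sum>j\<in>UNIV. dgmat c j i l x * v $ i * v $ j)
        = (\<Sum>i\<in>UNIV. \<Sum>j\<in>UNIV. dgmat c i j l x * v $ i * v $ j)" for l
      by (subst sum.swap) (simp add: mult_ac)
    have "frechet_derivative (gform c u v) (at x) v
      = (\<Sum>l\<in>UNIV. \<Sum>j\<in>UNIV. \<Sum>i\<in>UNIV. u $ l * (dgmat c i l j x * v $ i * v $ j))"
      by (simp add: frechet_derivative_gform[OF c] frechet_derivative_gmat_sum[OF c, of _ _ v] sum_distrib_left mult_ac)
    also have "\<dots> = (\<Sum>l\<in>UNIV. \<Sum>i\<in>UNIV. \<Sum>j\<in>UNIV. u $ l * (dgmat c i l j x * v $ i * v $ j))"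
      by (intro sum.cong refl sum.swap)
    finally have 2: "frechet_derivative (gform c u v) (at x) v
      = (\<Sum>l\<in>UNIV. u $ l * (\<Sum>i\<in>UNIV. \<Sum>j\<in>UNIV. dgmat c i j l x * v $ i * v $ j))"
      by (simp add: sum_distrib_left dgmat_sym[OF c, of _ l for l])
    have "frechet_derivative (gform c v v) (at x) u
      = (\<Sum>i\<in>UNIV. \<Sum>j\<in>UNIV. \<Sum>l\<in>UNIV. u $ l * (dgmat c l i j x * v $ i * v $ j))"
      by (simp add: frechet_derivative_gform[OF c] frechet_derivative_gmat_sum[OF c, of _ _ u] sum_distrib_left mult_ac)
    also have "\<dots> = (\<Sum>i\<in>UNIV. \<Sum>l\<in>UNIV. \<Sum>j\<in>UNIV. u $ l * (dgmat c l i j x * v $ i * v $ j))"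
      by (intro sum.cong refl sum.swap)
    also have "\<dots> = (\<Sum>l\<in>UNIV. \<Sum>i\<in>UNIV. \<Sum>j\<in>UNIV. u $ l * (dgmat c l i j x * v $ i * v $ j))"
      by (rule sum.swap)
    finally have 3: "frechet_derivative (gform c v v) (at x) u
      = (\<Sum>l\<in>UNIV. u $ l * (\<Sum>i\<in>UNIV. \<Sum>j\<in>UNIV. dgmat c l i j x * v $ i * v $ j))"
      by (simp add: sum_distrib_left)
    have "u \<bullet> w = (\<Sum>l\<in>UNIV. u $ l * ((\<Sum>i\<in>UNIV. \<Sum>j\<in>UNIV. dgmat c i j l x * v $ i * v $ j)
      + (\<Sum>i\<in>UNIV. \<Sum>j\<in>UNIV. dgmat c j i l x * v $ i * v $ j)
      - (\<Sum>i\<in>UNIV. \<Sum>j\<in>UNIV. dgmat c l i j x * v $ i * v $ j)))"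
      by (simp add: inner_vec_def w_def left_diff_distrib distrib_right sum.distrib sum_subtractf)
    also have "\<dots> = 2 * frechet_derivative (gform c u v) (at x) v - frechet_derivative (gform c v v) (at x) u"
      unfolding 1 2 3 by (simp add: sum_distrib_left sum.distrib sum_subtractf algebra_simps)
    finally show ?thesis .
  qed
  finally show ?thesis by (simp add: field_simps)
qed

section \<open>Change of charts in the geodesic equation\<close>

context
  fixes c d x
  assumes c: "c \<in> A" and d: "d \<in> A" and x: "x \<in> snd c ` (fst c \<inter> fst d)"
begin

abbreviation dtrans :: "real ^ 'n \<Rightarrow> real ^ 'n \<Rightarrow> real ^ 'n" where
  "dtrans y \<equiv> frechet_derivative (transition c d) (at y)"

abbreviation ddtrans :: "real ^ 'n \<Rightarrow> real ^ 'n \<Rightarrow> real ^ 'n" where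
  "ddtrans u \<equiv> frechet_derivative (\<lambda>y. dtrans y u) (at x)"

lemma gform_transition:
  assumes "y \<in> snd c ` (fst c \<inter> fst d)"
  shows "gform c u v y = gform d (dtrans y u) (dtrans y v) (transition c d y)"
proof -
  obtain p where p: "p \<in> fst c" "p \<in> fst d" "y = snd c p" using assms by auto
  then have cd: "c \<in> charts_at A p" "d \<in> charts_at A p" using c d by (auto intro: charts_atI)
  show ?thesis
    using metric_from_components[OF cd(1), of u v] metric_from_components[OF cd(2)]
      from_components_transition[OF cd] p c by simp
qed

lemma dtrans_has_derivative: "(transition c d has_derivative dtrans x) (at x)"
  and ddtrans_has_derivative: "((\<lambda>y. dtrans y u) has_derivative ddtrans u) (at x)"
  using x by (auto intro!: smooth_on_has_derivative[OF smooth_transition[OF c d]]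
    smooth_on_has_derivative[OF smooth_on_frechet_derivative[OF smooth_transition[OF c d]]])

lemma ddtrans_sym: "ddtrans u h = ddtrans h u"
  by (rule frechet_derivative_symmetric_vec[OF smooth_transition[OF c d] open_overlap[OF c d] x])

lemma transition_in_img: "transition c d x \<in> img d" and x_in_img: "x \<in> img c"
  using x c by auto

lemma frechet_derivative_gform_transition:
  "frechet_derivative (gform c u v) (at x) h
    = gform d (ddtrans u h) (dtrans x v) (transition c d x)
    + gform d (dtrans x u) (ddtrans v h) (transition c d x)
    + frechet_derivative (gform d (dtrans x u) (dtrans x v)) (at (transition c d x)) (dtrans x h)"
proof -
  have "((\<lambda>y. gform d (dtrans y u) (dtrans y v) (transition c d y)) has_derivative
    (\<lambda>h. gform d (ddtrans u h) (dtrans x v) (transition c d x)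
    + gform d (dtrans x u) (ddtrans v h) (transition c d x)
    + frechet_derivative (gform d (dtrans x u) (dtrans x v)) (at (transition c d x)) (dtrans x h))) (at x)"
    unfolding frechet_derivative_gform[OF d transition_in_img]
    by (rule gform_compose_has_derivative[OF d, where \<phi> = "transition c d"])
      (intro transition_in_img dtrans_has_derivative ddtrans_has_derivative)+
  then have "(gform c u v has_derivative
    (\<lambda>h. gform d (ddtrans u h) (dtrans x v) (transition c d x)
    + gform d (dtrans x u) (ddtrans v h) (transition c d x)
    + frechet_derivative (gform d (dtrans x u) (dtrans x v)) (at (transition c d x)) (dtrans x h))) (at x)"
    by (rule has_derivative_transform_within_open[OF _ open_overlap[OF c d] x])
      (rule gform_transition[symmetric])
  from frechet_derivative_at[OF this, symmetric] show ?thesis by simp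
qed

text \<open>The derivative of the reverse transition is a right inverse, since changing components
  back and forth fixes the tangent vector.\<close>

lemma dtrans_surj: "\<exists>u. dtrans x u = w"
proof -
  obtain p where p: "p \<in> fst c" "p \<in> fst d" "x = snd c p" using x by auto
  then have cd: "c \<in> charts_at A p" "d \<in> charts_at A p" using c d by (auto intro: charts_atI)
  have "from_components A d p w
    = from_components A d p (dtrans x (frechet_derivative (transition d c) (at (snd d p)) w))"
    using from_components_transition[OF cd] from_components_transition[OF cd(2,1)] p by simp
  then show ?thesis unfolding from_components_inject[OF cd(2)] by metis
qed

text \<open>Let \<open>w\<close> be the difference of the two sides and choose \<open>u\<close> with
  \<open>dtrans x u = w\<close>. In the Euler--Lagrange form, pairing with \<open>w\<close> in
  \<open>d\<close> and with \<open>u\<close> in \<open>c\<close> gives the same first-order terms up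
  to second derivatives of the transition map. These cancel by their symmetry, so \<open>w\<close>
  has length zero.\<close>

lemma acceleration_transition:
  "acceleration d (transition c d x) (dtrans x v)
    = dtrans x (acceleration c x v) + ddtrans v v"
proof -
  let ?y = "transition c d x"
  note lg = linear_add[OF linear_gform(1)] linear_diff[OF linear_gform(1)]
  define w where "w = dtrans x (acceleration c x v) + ddtrans v v - acceleration d ?y (dtrans x v)"
  obtain u where u: "dtrans x u = w" using dtrans_surj by blast
  have "gform d w w ?y = gform d w (dtrans x (acceleration c x v)) ?y + gform d w (ddtrans v v) ?y
    - gform d w (acceleration d ?y (dtrans x v)) ?y"
    by (subst (2) w_def) (simp add: lg del: o_apply)
  also have "gform d w (dtrans x (acceleration c x v)) ?y = gform c u (acceleration c x v) x"
    using gform_transition[OF x, of u "acceleration c x v"] u by simp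
  finally have "gform d w w ?y = 0"
    unfolding gform_acceleration[OF c x_in_img] gform_acceleration[OF d transition_in_img]
      frechet_derivative_gform_transition u
    by (simp add: ddtrans_sym[of u v] gform_sym[OF d transition_in_img, of "ddtrans v u"] field_simps
        del: o_apply)
  then have "w = 0" using gform_pos[OF d transition_in_img, of w] by fastforce
  then show ?thesis by (simp add: w_def)
qed

end

lemma state_eqI:
  "((\<lambda>s. snd c (\<gamma> s)) has_vector_derivative v) (at t) \<Longrightarrow> state c \<gamma> t = (snd c (\<gamma> t), v)"
  unfolding state_def by (simp add: vector_derivative_at)

lemma state_derivativeD:
  assumes "(state c \<gamma> has_vector_derivative spray c (state c \<gamma> t)) (at t)"
  shows "((\<lambda>s. snd c (\<gamma> s)) has_vector_derivative snd (state c \<gamma> t)) (at t)"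
    "((\<lambda>s. snd (state c \<gamma> s)) has_vector_derivative
      acceleration c (snd c (\<gamma> t)) (snd (state c \<gamma> t))) (at t)"
  using bounded_linear.has_vector_derivative[OF bounded_linear_fst assms]
    bounded_linear.has_vector_derivative[OF bounded_linear_snd assms]
  by (simp_all add: state_def spray_def)

lemma state_transition:
  assumes "isCont \<gamma> t" "c \<in> charts_at A (\<gamma> t)" "d \<in> charts_at A (\<gamma> t)"
    "((\<lambda>s. snd c (\<gamma> s)) has_vector_derivative snd (state c \<gamma> t)) (at t)"
  shows "state d \<gamma> t = (snd d (\<gamma> t), frechet_derivative (transition c d) (at (snd c (\<gamma> t))) (snd (state c \<gamma> t)))"
  by (rule state_eqI[OF has_vector_derivative_transition[OF assms]])

text \<open>Velocities transform by the Jacobian of the transition map; differentiating this along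
  the curve yields exactly the transformation law of the acceleration. The equation in
  \<open>c\<close> is assumed near \<open>t\<close>, because the state in \<open>d\<close> must be
  known near \<open>t\<close> before it can be differentiated.\<close>

lemma geodesic_equation_transition:
  assumes cont: "\<forall>\<^sub>F s in nhds t. isCont \<gamma> s"
    and c: "c \<in> charts_at A (\<gamma> t)" and d: "d \<in> charts_at A (\<gamma> t)"
    and eq: "\<forall>\<^sub>F s in nhds t. (state c \<gamma> has_vector_derivative spray c (state c \<gamma> s)) (at s)"
  shows "(state d \<gamma> has_vector_derivative spray d (state d \<gamma> t)) (at t)"
proof -
  define x where "x = (\<lambda>s. snd c (\<gamma> s))"
  define v where "v = (\<lambda>s. snd (state c \<gamma> s))"
  let ?P = "\<lambda>y. frechet_derivative (transition c d) (at y)"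
  let ?Q = "\<lambda>u. frechet_derivative (\<lambda>y. ?P y u) (at (x t))"
  have contt: "isCont \<gamma> t" and eqt: "(state c \<gamma> has_vector_derivative spray c (state c \<gamma> t)) (at t)"
    using cont eq by (auto dest: eventually_nhds_x_imp_x)
  note cA = charts_atD(1)[OF c] and dA = charts_atD(1)[OF d]
  have xt: "x t \<in> snd c ` (fst c \<inter> fst d)" using c d by (auto simp: x_def)
  have ev: "\<forall>\<^sub>F s in nhds t. isCont \<gamma> s \<and> (state c \<gamma> has_vector_derivative spray c (state c \<gamma> s)) (at s)
    \<and> \<gamma> s \<in> fst c \<and> \<gamma> s \<in> fst d"
    using cont eq eventually_in_dom[OF contt c] eventually_in_dom[OF contt d] by eventually_elim auto
  then obtain T where T: "open T" "t \<in> T" "\<And>s. s \<in> T \<Longrightarrow> isCont \<gamma> s"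
    "\<And>s. s \<in> T \<Longrightarrow> (state c \<gamma> has_vector_derivative spray c (state c \<gamma> s)) (at s)"
    "\<And>s. s \<in> T \<Longrightarrow> \<gamma> s \<in> fst c" "\<And>s. s \<in> T \<Longrightarrow> \<gamma> s \<in> fst d"
    unfolding eventually_nhds by blast
  \<comment> \<open>Both the base point and the argument of the Jacobian vary in time. Expanding
    over the basis separates them into products, to which the product rule applies.\<close>
  have lin: "?P y u = (\<Sum>i\<in>UNIV. u $ i *\<^sub>R ?P y (axis i 1))" if "y \<in> snd c ` (fst c \<inter> fst d)" for y u
    using linear_axis_sum[OF has_derivative_linear[OF dtrans_has_derivative[OF cA dA that]]] .
  have st: "state d \<gamma> s = (snd d (\<gamma> s), \<Sum>i\<in>UNIV. v s $ i *\<^sub>R ?P (x s) (axis i 1))" if "s \<in> T" for s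
    using state_transition[OF T(3)[OF that] charts_atI[OF cA T(5)[OF that]] charts_atI[OF dA T(6)[OF that]]
        state_derivativeD(1)[OF T(4)[OF that]]] lin[of "x s" "v s"] T(5,6)[OF that]
    by (auto simp: x_def v_def)
  have xd: "(x has_vector_derivative v t) (at t)"
    using state_derivativeD(1)[OF eqt] by (simp add: x_def v_def)
  have vd: "(v has_vector_derivative acceleration c (x t) (v t)) (at t)"
    using state_derivativeD(2)[OF eqt] by (simp add: x_def v_def)
  have Pd: "((\<lambda>s. ?P (x s) u) has_vector_derivative ?Q u (v t)) (at t)" for u
    using diff_chain_at[OF xd[unfolded has_vector_derivative_def] ddtrans_has_derivative[OF cA dA xt, of u]]
      linear_scale[OF has_derivative_linear[OF ddtrans_has_derivative[OF cA dA xt]]]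
    by (simp add: has_vector_derivative_def o_def)
  have nd: "((\<lambda>s. v s $ i) has_vector_derivative acceleration c (x t) (v t) $ i) (at t)" for i
    using bounded_linear.has_vector_derivative[OF bounded_linear_vec_nth vd] .
  have "((\<lambda>s. v s $ i *\<^sub>R ?P (x s) (axis i 1)) has_vector_derivative
    (v t $ i *\<^sub>R ?Q (axis i 1) (v t) + acceleration c (x t) (v t) $ i *\<^sub>R ?P (x t) (axis i 1))) (at t)" for i
    using has_vector_derivative_scaleR[OF nd[of i, folded has_real_derivative_iff_has_vector_derivative] Pd[of "axis i 1"]] .
  then have "((\<lambda>s. \<Sum>i\<in>UNIV. v s $ i *\<^sub>R ?P (x s) (axis i 1)) has_vector_derivative
    (\<Sum>i\<in>UNIV. v t $ i *\<^sub>R ?Q (axis i 1) (v t) + acceleration c (x t) (v t) $ i *\<^sub>R ?P (x t) (axis i 1))) (at t)"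
    by (intro has_vector_derivative_sum)
  also have "(\<Sum>i\<in>UNIV. v t $ i *\<^sub>R ?Q (axis i 1) (v t) + acceleration c (x t) (v t) $ i *\<^sub>R ?P (x t) (axis i 1))
    = ?Q (v t) (v t) + ?P (x t) (acceleration c (x t) (v t))"
    using linear_axis_sum[OF has_derivative_linear[OF ddtrans_has_derivative[OF cA dA xt, of "v t"]], of "v t"]
      lin[OF xt, of "acceleration c (x t) (v t)"]
    by (simp add: sum.distrib ddtrans_sym[OF cA dA xt, of "axis _ 1"])
  also have "\<dots> = acceleration d (transition c d (x t)) (?P (x t) (v t))"
    by (simp only: acceleration_transition[OF cA dA xt] add.commute)
  also have "transition c d (x t) = snd d (\<gamma> t)" using c by (simp add: x_def)
  finally have w: "((\<lambda>s. \<Sum>i\<in>UNIV. v s $ i *\<^sub>R ?P (x s) (axis i 1)) has_vector_derivative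
     acceleration d (snd d (\<gamma> t)) (?P (x t) (v t))) (at t)" .
  have "((\<lambda>s. snd d (\<gamma> s)) has_vector_derivative ?P (x t) (v t)) (at t)"
    using has_vector_derivative_transition[OF contt c d state_derivativeD(1)[OF eqt]] by (simp add: x_def v_def)
  from has_vector_derivative_Pair[OF this w] have "(state d \<gamma> has_vector_derivative
     (?P (x t) (v t), acceleration d (snd d (\<gamma> t)) (?P (x t) (v t)))) (at t)"
    by (rule has_vector_derivative_transform_within_open[OF _ T(1,2)]) (simp add: st)
  then show ?thesis using st[OF T(2)] lin[OF xt, of "v t"] by (simp add: spray_def)
qed

text \<open>Openness of \<open>J\<close> is essential: the function \<open>v\<close> of
  \<open>is_geodesic\<close> agrees with the derivative of the coordinates on a neighbourhood of
  \<open>t\<close>, so its own derivative is that of the velocity in \<open>state\<close>.\<close>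

lemma is_geodesic_iff:
  assumes J: "open J"
  shows "is_geodesic A g J \<gamma> \<longleftrightarrow> continuous_on J \<gamma> \<and>
    (\<forall>t\<in>J. \<forall>c\<in>charts_at A (\<gamma> t). (state c \<gamma> has_vector_derivative spray c (state c \<gamma> t)) (at t))"
proof safe
  fix t c assume g: "is_geodesic A g J \<gamma>" and t: "t \<in> J" and c: "c \<in> charts_at A (\<gamma> t)"
  have cont: "isCont \<gamma> t" using g t J by (simp add: is_geodesic_def continuous_on_eq_continuous_at)
  have "c \<in> A" using c by simp
  then obtain v where v: "\<And>t. t \<in> J \<Longrightarrow> \<gamma> t \<in> fst c \<Longrightarrow> ((\<lambda>s. snd c (\<gamma> s)) has_vector_derivative v t) (at t)"
    "\<And>t. t \<in> J \<Longrightarrow> \<gamma> t \<in> fst c \<Longrightarrow> (v has_vector_derivative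
      (\<chi> k. - (\<Sum>i\<in>UNIV. \<Sum>j\<in>UNIV. christoffel A g c k i j (\<gamma> t) * v t $ i * v t $ j))) (at t)"
    using g unfolding is_geodesic_def by blast
  have "\<forall>\<^sub>F s in nhds t. s \<in> J \<and> \<gamma> s \<in> fst c"
    using eventually_in_dom[OF cont c] eventually_nhds_in_open[OF J t] by eventually_elim auto
  then obtain T where T: "open T" "t \<in> T" "\<And>s. s \<in> T \<Longrightarrow> s \<in> J" "\<And>s. s \<in> T \<Longrightarrow> \<gamma> s \<in> fst c"
    unfolding eventually_nhds by blast
  have st: "state c \<gamma> s = (snd c (\<gamma> s), v s)" if "s \<in> T" for s
    by (rule state_eqI[OF v(1)[OF T(3,4)[OF that]]])
  have "((\<lambda>s. (snd c (\<gamma> s), v s)) has_vector_derivative (v t, acceleration c (snd c (\<gamma> t)) (v t))) (at t)"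
    using v[OF t charts_atD(2)[OF c]] c
    by (intro has_vector_derivative_Pair) (simp_all add: acceleration_def)
  then have "(state c \<gamma> has_vector_derivative (v t, acceleration c (snd c (\<gamma> t)) (v t))) (at t)"
    by (rule has_vector_derivative_transform_within_open[OF _ T(1,2)]) (simp add: st)
  then show "(state c \<gamma> has_vector_derivative spray c (state c \<gamma> t)) (at t)"
    by (simp add: spray_def st[OF T(2)])
next
  assume cont: "continuous_on J \<gamma>" and
    eq: "\<forall>t\<in>J. \<forall>c\<in>charts_at A (\<gamma> t). (state c \<gamma> has_vector_derivative spray c (state c \<gamma> t)) (at t)"
  show "is_geodesic A g J \<gamma>"
    unfolding is_geodesic_def
  proof (intro conjI ballI cont)
    fix c assume c: "c \<in> A"
    show "\<exists>v. \<forall>t\<in>J. \<gamma> t \<in> fst c \<longrightarrow> ((\<lambda>s. snd c (\<gamma> s)) has_vector_derivative v t) (at t) \<and>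
      (v has_vector_derivative
        (\<chi> k. - (\<Sum>i\<in>UNIV. \<Sum>j\<in>UNIV. christoffel A g c k i j (\<gamma> t) * v t $ i * v t $ j))) (at t)"
    proof (intro exI[of _ "\<lambda>s. snd (state c \<gamma> s)"] ballI impI conjI)
      fix t assume t: "t \<in> J" "\<gamma> t \<in> fst c"
      have "(state c \<gamma> has_vector_derivative spray c (state c \<gamma> t)) (at t)"
        using eq t charts_atI[OF c t(2)] by blast
      from state_derivativeD[OF this]
      show "((\<lambda>s. snd c (\<gamma> s)) has_vector_derivative snd (state c \<gamma> t)) (at t)"
        "((\<lambda>s. snd (state c \<gamma> s)) has_vector_derivative (\<chi> k. - (\<Sum>i\<in>UNIV. \<Sum>j\<in>UNIV.
          christoffel A g c k i j (\<gamma> t) * snd (state c \<gamma> t) $ i * snd (state c \<gamma> t) $ j))) (at t)"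
        using c t(2) by (simp_all add: acceleration_def)
    qed
  qed
qed (simp add: is_geodesic_def)

lemma is_geodesic_isCont: "open J \<Longrightarrow> is_geodesic A g J \<gamma> \<Longrightarrow> t \<in> J \<Longrightarrow> isCont \<gamma> t"
  by (simp add: is_geodesic_def continuous_on_eq_continuous_at)

lemma is_geodesic_state:
  "\<lbrakk>open J; is_geodesic A g J \<gamma>; t \<in> J; c \<in> charts_at A (\<gamma> t)\<rbrakk> \<Longrightarrow>
    (state c \<gamma> has_vector_derivative spray c (state c \<gamma> t)) (at t)"
  using is_geodesic_iff by blast

lemma is_geodesic_velocity:
  assumes "open J" "is_geodesic A g J \<gamma>" "t \<in> J" "c \<in> charts_at A (\<gamma> t)"
  shows "velocity A \<gamma> t = from_components A c (\<gamma> t) (snd (state c \<gamma> t))"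
  using assms by (intro velocity_from_components is_geodesic_isCont state_derivativeD is_geodesic_state)

lemma is_geodesic_cong:
  assumes "open J" "is_geodesic A g J \<gamma>" "\<And>t. t \<in> J \<Longrightarrow> \<gamma> t = \<gamma>' t"
  shows "is_geodesic A g J \<gamma>'" and "t \<in> J \<Longrightarrow> state c \<gamma>' t = state c \<gamma> t"
proof -
  have st: "state c \<gamma>' t = state c \<gamma> t" if "t \<in> J" for t c
  proof -
    have "((\<lambda>s. snd c (\<gamma> s)) has_vector_derivative v) (at t)
      \<longleftrightarrow> ((\<lambda>s. snd c (\<gamma>' s)) has_vector_derivative v) (at t)" for v
      using has_vector_derivative_transform_within_open[OF _ assms(1) that] assms(3)
      by (metis (mono_tags, lifting))
    then show ?thesis using assms(3)[OF that] by (simp add: state_def vector_derivative_def)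
  qed
  then show "t \<in> J \<Longrightarrow> state c \<gamma>' t = state c \<gamma> t" .
  have "continuous_on J \<gamma>'"
    using assms continuous_on_cong is_geodesic_def by metis
  moreover have "(state c \<gamma>' has_vector_derivative spray c (state c \<gamma>' t)) (at t)"
    if t: "t \<in> J" and c: "c \<in> charts_at A (\<gamma>' t)" for t c
  proof -
    have "(state c \<gamma> has_vector_derivative spray c (state c \<gamma> t)) (at t)"
      using is_geodesic_state[OF assms(1,2) t] c assms(3)[OF t] by simp
    then have "(state c \<gamma>' has_vector_derivative spray c (state c \<gamma> t)) (at t)"
      by (rule has_vector_derivative_transform_within_open[OF _ assms(1) t]) (simp add: st)
    then show ?thesis by (simp add: st[OF t])
  qed
  ultimately show "is_geodesic A g J \<gamma>'" by (simp add: is_geodesic_iff[OF assms(1)])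
qed

text \<open>The equation holds in \<open>c\<close> by assumption and is carried to every other chart
  by the transformation law.\<close>

lemma geodesic_of_chart_solution:
  assumes c: "c \<in> A" and J: "open J" and img: "\<And>t. t \<in> J \<Longrightarrow> fst (\<phi> t) \<in> img c"
    and \<phi>: "\<And>t. t \<in> J \<Longrightarrow> (\<phi> has_vector_derivative spray c (\<phi> t)) (at t)"
  defines "\<gamma> \<equiv> \<lambda>t. chart_inv c (fst (\<phi> t))"
  shows "is_geodesic A g J \<gamma>" and "\<And>t. t \<in> J \<Longrightarrow> state c \<gamma> t = \<phi> t"
    and "\<And>t. t \<in> J \<Longrightarrow> c \<in> charts_at A (\<gamma> t)"
proof -
  show cc: "c \<in> charts_at A (\<gamma> t)" if "t \<in> J" for t
    unfolding \<gamma>_def using img[OF that] c by (intro charts_atI) auto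
  have eq: "snd c (\<gamma> t) = fst (\<phi> t)" if "t \<in> J" for t
    using img[OF that] c by (simp add: \<gamma>_def)
  show st: "state c \<gamma> t = \<phi> t" if "t \<in> J" for t
  proof -
    have "((\<lambda>s. fst (\<phi> s)) has_vector_derivative snd (\<phi> t)) (at t)"
      using bounded_linear.has_vector_derivative[OF bounded_linear_fst \<phi>[OF that]] by (simp add: spray_def)
    then have "((\<lambda>s. snd c (\<gamma> s)) has_vector_derivative snd (\<phi> t)) (at t)"
      by (rule has_vector_derivative_transform_within_open[OF _ J that]) (simp add: eq)
    from state_eqI[OF this] show ?thesis by (simp add: eq[OF that])
  qed
  have cont: "isCont \<gamma> t" if "t \<in> J" for t
  proof -
    have "isCont (\<lambda>t. fst (\<phi> t)) t"
      using has_vector_derivative_continuous[OF \<phi>[OF that]] by (intro continuous_intros)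
    then show ?thesis
      unfolding \<gamma>_def using chart_inv_isCont[OF c img[OF that]] by (rule isCont_o2)
  qed
  have eqn: "(state c \<gamma> has_vector_derivative spray c (state c \<gamma> t)) (at t)" if "t \<in> J" for t
    using \<phi>[OF that] unfolding st[OF that]
    by (rule has_vector_derivative_transform_within_open[OF _ J that]) (simp add: st)
  have "(state d \<gamma> has_vector_derivative spray d (state d \<gamma> t)) (at t)"
    if "t \<in> J" "d \<in> charts_at A (\<gamma> t)" for t d
    using cc[OF that(1)] that(2) eventually_nhds_in_open[OF J that(1)] cont eqn
    by (intro geodesic_equation_transition[of \<gamma> t c d]) (auto elim: eventually_mono)
  then show "is_geodesic A g J \<gamma>"
    unfolding is_geodesic_iff[OF J] using cont by (auto intro: continuous_at_imp_continuous_on)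
qed

end

subsection \<open>Existence, uniqueness and continuous dependence of geodesics\<close>

text \<open>The partial derivatives are bounded on the compact set, so the operator norm of the
  derivative is bounded by the sum of their bounds; convexity then allows the mean value
  inequality.\<close>

lemma smooth_on_imp_lipschitz:
  fixes h :: "real ^ 'n \<Rightarrow> real"
  assumes h: "smooth_on S h" and K: "compact K" "convex K" "K \<subseteq> S"
  shows "\<exists>L. L-lipschitz_on K h"
proof -
  let ?D = "\<lambda>x. frechet_derivative h (at x)"
  have "\<exists>B. \<forall>x\<in>K. \<bar>?D x (axis i 1)\<bar> \<le> B" for i
  proof -
    have "continuous_on K (\<lambda>x. ?D x (axis i 1))"
      using smooth_on_continuous_on[OF smooth_on_frechet_derivative[OF h]] K(3) by (rule continuous_on_subset)
    then have "bounded ((\<lambda>x. ?D x (axis i 1)) ` K)"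
      using K(1) compact_continuous_image compact_imp_bounded by blast
    then show ?thesis by (simp add: bounded_iff)
  qed
  then obtain B where B: "\<And>i x. x \<in> K \<Longrightarrow> \<bar>?D x (axis i 1)\<bar> \<le> B i" by metis
  have D: "(h has_derivative ?D x) (at x)" if "x \<in> K" for x
    using smooth_on_has_derivative[OF h] that K(3) by blast
  have on: "onorm (?D x) \<le> (\<Sum>i\<in>UNIV. \<bar>B i\<bar>)" if "x \<in> K" for x
  proof (rule onorm_le)
    fix v
    have "norm (?D x v) = \<bar>\<Sum>i\<in>UNIV. v $ i * ?D x (axis i 1)\<bar>"
      using linear_axis_sum[OF has_derivative_linear[OF D[OF that]], of v] by simp
    also have "\<dots> \<le> (\<Sum>i\<in>UNIV. \<bar>v $ i * ?D x (axis i 1)\<bar>)" by (rule sum_abs)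
    also have "\<dots> \<le> (\<Sum>i\<in>UNIV. norm v * \<bar>B i\<bar>)"
    proof (intro sum_mono)
      fix i
      have "\<bar>?D x (axis i 1)\<bar> \<le> \<bar>B i\<bar>" using B[OF that, of i] by linarith
      then show "\<bar>v $ i * ?D x (axis i 1)\<bar> \<le> norm v * \<bar>B i\<bar>"
        unfolding abs_mult using component_le_norm_cart[of v i] by (intro mult_mono) auto
    qed
    finally show "norm (?D x v) \<le> (\<Sum>i\<in>UNIV. \<bar>B i\<bar>) * norm v"
      by (simp add: sum_distrib_left mult.commute)
  qed
  have "(\<Sum>i\<in>UNIV. \<bar>B i\<bar>)-lipschitz_on K h"
    unfolding lipschitz_on_def dist_norm
    by (intro conjI ballI differentiable_bound[OF K(2), where f' = ?D] on)
      (auto intro: has_derivative_at_withinI D sum_nonneg)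
  then show ?thesis by blast
qed

lemma lipschitz_on_mult_compact:
  fixes a b :: "'e::metric_space \<Rightarrow> real"
  assumes K: "compact K" and ab: "\<exists>L. L-lipschitz_on K a" "\<exists>L. L-lipschitz_on K b"
  shows "\<exists>L. L-lipschitz_on K (\<lambda>x. a x * b x)"
proof -
  obtain La Lb where L: "La-lipschitz_on K a" "Lb-lipschitz_on K b" using ab by blast
  have "bounded (a ` K)" "bounded (b ` K)"
    using L K lipschitz_on_continuous_on compact_continuous_image compact_imp_bounded by metis+
  then obtain Ba Bb where B: "Ba > 0" "Bb > 0" "\<And>x. x \<in> K \<Longrightarrow> \<bar>a x\<bar> \<le> Ba" "\<And>x. x \<in> K \<Longrightarrow> \<bar>b x\<bar> \<le> Bb"
    unfolding bounded_pos by auto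
  have "(Ba * Lb + La * Bb)-lipschitz_on K (\<lambda>x. a x * b x)"
  proof (rule lipschitz_onI)
    fix x y assume xy: "x \<in> K" "y \<in> K"
    have "a x * b x - a y * b y = a x * (b x - b y) + (a x - a y) * b y" by (simp add: algebra_simps)
    then have "\<bar>a x * b x - a y * b y\<bar> \<le> \<bar>a x\<bar> * \<bar>b x - b y\<bar> + \<bar>a x - a y\<bar> * \<bar>b y\<bar>"
      by (metis abs_mult abs_triangle_ineq)
    also have "\<dots> \<le> Ba * (Lb * dist x y) + (La * dist x y) * Bb"
      using B xy lipschitz_onD[OF L(1) xy] lipschitz_onD[OF L(2) xy]
      by (intro add_mono mult_mono) (auto simp: dist_real_def)
    finally show "dist (a x * b x) (a y * b y) \<le> (Ba * Lb + La * Bb) * dist x y"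
      by (simp add: dist_real_def algebra_simps)
  qed (use B L[THEN lipschitz_on_nonneg] in auto)
  then show ?thesis by blast
qed

lemma lipschitz_on_sum_ex:
  fixes f :: "'i \<Rightarrow> 'e::metric_space \<Rightarrow> 'b::real_normed_vector"
  assumes "\<And>i. i \<in> I \<Longrightarrow> \<exists>L. L-lipschitz_on K (f i)"
  shows "\<exists>L. L-lipschitz_on K (\<lambda>x. \<Sum>i\<in>I. f i x)"
  using assms
proof (induction I rule: infinite_finite_induct)
  case (insert i I)
  then obtain L L' where "L-lipschitz_on K (f i)" "L'-lipschitz_on K (\<lambda>x. \<Sum>i\<in>I. f i x)"
    by blast
  from lipschitz_on_add[OF this] insert show ?case by auto
qed (auto intro: lipschitz_on_constant)

lemma lipschitz_on_vec_ex:
  fixes f :: "'n::finite \<Rightarrow> 'e::metric_space \<Rightarrow> real"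
  assumes "\<And>i. \<exists>L. L-lipschitz_on K (f i)"
  shows "\<exists>L. L-lipschitz_on K (\<lambda>x. \<chi> i. f i x)"
proof -
  obtain L where L: "\<And>i. (L i)-lipschitz_on K (f i)" using assms by metis
  have "(\<Sum>i\<in>UNIV. L i)-lipschitz_on K (\<lambda>x. \<chi> i. f i x)"
  proof (rule lipschitz_onI)
    fix x y assume xy: "x \<in> K" "y \<in> K"
    have "dist (\<chi> i. f i x) (\<chi> i. f i y) \<le> (\<Sum>i\<in>UNIV. \<bar>f i x - f i y\<bar>)"
      unfolding dist_norm using norm_le_l1_cart[of "(\<chi> i. f i x) - (\<chi> i. f i y)"] by simp
    also have "\<dots> \<le> (\<Sum>i\<in>UNIV. L i * dist x y)"
      using lipschitz_onD[OF L xy] by (intro sum_mono) (simp add: dist_real_def)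
    finally show "dist (\<chi> i. f i x) (\<chi> i. f i y) \<le> (\<Sum>i\<in>UNIV. L i) * dist x y"
      by (simp add: sum_distrib_right)
  qed (use L[THEN lipschitz_on_nonneg] in \<open>auto intro: sum_nonneg\<close>)
  then show ?thesis by blast
qed

lemma bounded_linear_lipschitz_ex: "bounded_linear f \<Longrightarrow> \<exists>L. L-lipschitz_on K f"
  by (metis bounded_linear.lipschitz_boundE)

lemma has_vector_derivative_shift:
  assumes "(f has_vector_derivative D) (at (t - a))"
  shows "((\<lambda>u. f (u - a)) has_vector_derivative D) (at t)"
proof -
  have "((\<lambda>u. u - a) has_derivative (\<lambda>h. h)) (at t)" by (auto intro!: derivative_eq_intros)
  from diff_chain_at[OF this] assms show ?thesis
    unfolding has_vector_derivative_def by (simp add: o_def)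
qed

lemma eventually_nhds_dist: "0 < e \<Longrightarrow> \<forall>\<^sub>F x in nhds a. dist x a < e"
  unfolding eventually_nhds_metric by blast

text \<open>The local hypothesis says that both the set where \<open>P\<close> holds and its
  complement are relatively open in \<open>J\<close>.\<close>

lemma connected_clopen_induct:
  assumes J: "connected J" and ab: "a \<in> J" "b \<in> J" "P a"
    and loc: "\<And>t. t \<in> J \<Longrightarrow> (\<forall>\<^sub>F s in nhds t. s \<in> J \<longrightarrow> P s) \<or> (\<forall>\<^sub>F s in nhds t. \<not> P s)"
  shows "P b"
proof (rule connected_induction_simple[OF J ab(1,2), where P = P, OF ab(3)])
  fix t assume t: "t \<in> J"
  from loc[OF t] obtain T where "open T" "t \<in> T" "(\<forall>s\<in>T. s \<in> J \<longrightarrow> P s) \<or> (\<forall>s\<in>T. \<not> P s)"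
    unfolding eventually_nhds by blast
  then show "\<exists>T. openin (top_of_set J) T \<and> t \<in> T \<and> (\<forall>x\<in>T. \<forall>y\<in>T. P x \<longrightarrow> P y)"
    using t by (intro exI[of _ "J \<inter> T"]) auto
qed

context riemannian_manifold
begin

lemma smooth_christoffel:
  assumes c: "c \<in> A"
  shows "smooth_on (img c) (\<lambda>x. christoffel A g c k i j (chart_inv c x))"
proof (rule smooth_on_cong[OF open_img[OF c]])
  show "smooth_on (img c) (\<lambda>x. 1/2 * (\<Sum>l\<in>UNIV. matrix_inv (gmat c x) $ k $ l *
    (dgmat c i j l x + dgmat c j i l x - dgmat c l i j x)))"
    by (intro smooth_on_mult smooth_on_sum smooth_on_diff smooth_on_add smooth_on_const
        smooth_gmat_inv smooth_on_frechet_derivative smooth_gmat c open_img)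
qed (simp add: christoffel_eq[OF c])

text \<open>The components are sums of products of smooth coefficients of the position and
  components of the velocity. Products preserve the Lipschitz property only where the factors are
  bounded, which compactness of \<open>K\<close> guarantees.\<close>

lemma spray_lipschitz:
  assumes c: "c \<in> A" and K: "compact K" "convex K" "K \<subseteq> img c \<times> UNIV"
  shows "\<exists>L. L-lipschitz_on K (spray c)"
proof -
  have F: "compact (fst ` K)" "convex (fst ` K)" "fst ` K \<subseteq> img c"
    using K compact_continuous_image[OF continuous_on_fst[OF continuous_on_id] K(1)]
    by (auto intro: convex_linear_image linear_fst)
  have 1: "\<exists>L. L-lipschitz_on K (\<lambda>z. christoffel A g c k i j (chart_inv c (fst z)))" for k i j
  proof -
    obtain L where L: "L-lipschitz_on (fst ` K) (\<lambda>x. christoffel A g c k i j (chart_inv c x))"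
      using smooth_on_imp_lipschitz[OF smooth_christoffel[OF c] F] by blast
    obtain M where "M-lipschitz_on K fst" using bounded_linear_lipschitz_ex[OF bounded_linear_fst] by blast
    from lipschitz_on_compose2[OF this L] show ?thesis by blast
  qed
  have 2: "\<exists>L. L-lipschitz_on K (\<lambda>z. snd z $ i)" for i :: 'n
    by (intro bounded_linear_lipschitz_ex bounded_linear_compose[OF bounded_linear_vec_nth bounded_linear_snd])
  have "\<exists>L. L-lipschitz_on K (\<lambda>z. - (\<Sum>i\<in>UNIV. \<Sum>j\<in>UNIV.
      christoffel A g c k i j (chart_inv c (fst z)) * snd z $ i * snd z $ j))" for k
    unfolding lipschitz_on_minus_iff by (intro lipschitz_on_sum_ex lipschitz_on_mult_compact K(1) 1 2)
  from lipschitz_on_vec_ex[where f = "\<lambda>k z. - (\<Sum>i\<in>UNIV. \<Sum>j\<in>UNIV.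
      christoffel A g c k i j (chart_inv c (fst z)) * snd z $ i * snd z $ j)", OF this]
  obtain La where "La-lipschitz_on K (\<lambda>z. acceleration c (fst z) (snd z))"
    unfolding acceleration_def by blast
  moreover obtain Ls where "Ls-lipschitz_on K (snd :: (real ^ 'n) \<times> (real ^ 'n) \<Rightarrow> _)"
    using bounded_linear_lipschitz_ex[OF bounded_linear_snd] by blast
  ultimately show ?thesis
    unfolding spray_def[abs_def] using lipschitz_on_Pair by blast
qed

text \<open>One time \<tau> serves all starting positions within \<open>r\<close> of
  \<open>x0\<close> and all velocities up to \<open>R\<close>; during it, position and velocity
  change by at most \<open>r\<close>. \<open>\<Phi>\<close> is the flow in coordinates, used for
  estimates; \<open>\<Gamma> z s\<close> is the geodesic on the manifold that has state
  \<open>z\<close> at time \<open>s\<close>, used for gluing.\<close>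

lemma geodesic_flow_box:
  assumes c: "c \<in> A" and r: "r > 0" "cball x0 (2 * r) \<subseteq> img c"
  obtains \<tau> B \<Phi> \<Gamma> where "\<tau> > 0" "B \<ge> 0"
    "\<And>z t. z \<in> cball x0 r \<times> cball 0 R \<Longrightarrow> \<bar>t\<bar> < \<tau> \<Longrightarrow> \<Phi> z t \<in> cball x0 (2 * r) \<times> cball 0 (R + r)"
    "\<And>z. z \<in> cball x0 r \<times> cball 0 R \<Longrightarrow> \<Phi> z 0 = z"
    "\<And>z t. z \<in> cball x0 r \<times> cball 0 R \<Longrightarrow> \<bar>t\<bar> < \<tau> \<Longrightarrow> (\<Phi> z has_vector_derivative spray c (\<Phi> z t)) (at t)"
    "\<And>z t. z \<in> cball x0 r \<times> cball 0 R \<Longrightarrow> \<bar>t\<bar> < \<tau> \<Longrightarrow> dist (\<Phi> z t) z \<le> B * \<bar>t\<bar>"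
    "\<And>z w t. z \<in> cball x0 r \<times> cball 0 R \<Longrightarrow> w \<in> cball x0 r \<times> cball 0 R \<Longrightarrow> \<bar>t\<bar> < \<tau> \<Longrightarrow>
      dist (\<Phi> z t) (\<Phi> w t) \<le> 2 * dist z w"
    "\<And>z s. z \<in> cball x0 r \<times> cball 0 R \<Longrightarrow> is_geodesic A g {s - \<tau><..<s + \<tau>} (\<Gamma> z s)"
    "\<And>z s u. z \<in> cball x0 r \<times> cball 0 R \<Longrightarrow> u \<in> {s - \<tau><..<s + \<tau>} \<Longrightarrow>
      c \<in> charts_at A (\<Gamma> z s u) \<and> state c (\<Gamma> z s) u = \<Phi> z (u - s)"
proof -
  let ?Z = "cball x0 r \<times> cball (0 :: real ^ 'n) R"
  let ?K = "cball x0 (2 * r) \<times> cball (0 :: real ^ 'n) (R + r)"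
  have K: "compact ?K" "convex ?K" by (auto intro: compact_Times convex_Times)
  obtain L where L: "L-lipschitz_on ?K (spray c)" using spray_lipschitz[OF c K] r by auto
  have sub: "cball z r \<subseteq> ?K" if z: "z \<in> ?Z" for z
  proof
    fix w assume "w \<in> cball z r"
    then have "dist (fst z) (fst w) \<le> r" "dist (snd z) (snd w) \<le> r"
      using dist_fst_le[of z w] dist_snd_le[of z w] by auto
    then show "w \<in> ?K" using z dist_triangle[of x0 "fst w" "fst z"] dist_triangle[of 0 "snd w" "snd z"]
      by (auto simp: mem_Times_iff)
  qed
  from ode_flow_box[OF K L r(1) sub] obtain \<tau> B \<Phi> where \<Phi>: "\<tau> > 0" "B \<ge> 0"
    "\<And>z. z \<in> ?Z \<Longrightarrow> \<Phi> z 0 = z"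
    "\<And>z t. z \<in> ?Z \<Longrightarrow> \<bar>t\<bar> < \<tau> \<Longrightarrow> \<Phi> z t \<in> cball z r"
    "\<And>z t. z \<in> ?Z \<Longrightarrow> \<bar>t\<bar> < \<tau> \<Longrightarrow> (\<Phi> z has_vector_derivative spray c (\<Phi> z t)) (at t)"
    "\<And>z t. z \<in> ?Z \<Longrightarrow> \<bar>t\<bar> < \<tau> \<Longrightarrow> dist (\<Phi> z t) z \<le> B * \<bar>t\<bar>"
    "\<And>z w t. z \<in> ?Z \<Longrightarrow> w \<in> ?Z \<Longrightarrow> \<bar>t\<bar> < \<tau> \<Longrightarrow> dist (\<Phi> z t) (\<Phi> w t) \<le> 2 * dist z w"
    by blast
  have inK: "\<Phi> z t \<in> ?K" if "z \<in> ?Z" "\<bar>t\<bar> < \<tau>" for z t using \<Phi>(4)[OF that] sub[OF that(1)] by blast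
  have im: "fst (\<Phi> z (u - s)) \<in> img c" if "z \<in> ?Z" "u \<in> {s - \<tau><..<s + \<tau>}" for z s u
    using inK[OF that(1), of "u - s"] that(2) r(2) by (auto simp: mem_Times_iff abs_less_iff)
  have de: "((\<lambda>u. \<Phi> z (u - s)) has_vector_derivative spray c (\<Phi> z (u - s))) (at u)"
    if "z \<in> ?Z" "u \<in> {s - \<tau><..<s + \<tau>}" for z s u
    by (rule has_vector_derivative_shift[OF \<Phi>(5)]) (use that in auto)
  note sol = geodesic_of_chart_solution[OF c open_greaterThanLessThan im de]
  show ?thesis
    by (rule that[where \<Gamma> = "\<lambda>z s u. chart_inv c (fst (\<Phi> z (u - s)))", OF \<Phi>(1,2) inK \<Phi>(3,5-7)])
      (use sol in blast)+
qed

section \<open>Uniqueness of geodesics\<close>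

definition agree :: "(real \<Rightarrow> 'a) \<Rightarrow> (real \<Rightarrow> 'a) \<Rightarrow> real \<Rightarrow> bool" where
  "agree \<gamma> \<gamma>' t \<longleftrightarrow> \<gamma> t = \<gamma>' t \<and> velocity A \<gamma> t = velocity A \<gamma>' t"

lemma agree_iff_state:
  assumes 1: "open J" "is_geodesic A g J \<gamma>" "t \<in> J" "c \<in> charts_at A (\<gamma> t)"
    and 2: "open J'" "is_geodesic A g J' \<gamma>'" "t \<in> J'" "c \<in> charts_at A (\<gamma>' t)"
  shows "agree \<gamma> \<gamma>' t \<longleftrightarrow> state c \<gamma> t = state c \<gamma>' t"
proof -
  have "\<gamma> t = \<gamma>' t \<longleftrightarrow> snd c (\<gamma> t) = snd c (\<gamma>' t)"
    using 1(4) 2(4) by (metis charts_atD chart_inv_left)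
  moreover have "velocity A \<gamma> t = velocity A \<gamma>' t \<longleftrightarrow> snd (state c \<gamma> t) = snd (state c \<gamma>' t)"
    if "\<gamma> t = \<gamma>' t"
    using is_geodesic_velocity[OF 1] is_geodesic_velocity[OF 2] from_components_inject[OF 1(4)] that by simp
  ultimately show ?thesis
    unfolding agree_def prod_eq_iff by (auto simp: state_def)
qed

lemma state_isCont:
  "\<lbrakk>open J; is_geodesic A g J \<gamma>; t \<in> J; c \<in> charts_at A (\<gamma> t)\<rbrakk> \<Longrightarrow> isCont (state c \<gamma>) t"
  using has_vector_derivative_continuous[OF is_geodesic_state] .

text \<open>In a common chart agreement means equality of states, and both states solve the spray
  equation in a closed ball on which the spray is Lipschitz.\<close>

lemma geodesic_unique_local:
  assumes 1: "open J" "is_geodesic A g J \<gamma>" "t \<in> J" and 2: "open J'" "is_geodesic A g J' \<gamma>'" "t \<in> J'"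
    and ag: "agree \<gamma> \<gamma>' t"
  shows "\<forall>\<^sub>F s in nhds t. agree \<gamma> \<gamma>' s"
proof -
  obtain c where c: "c \<in> charts_at A (\<gamma> t)" using charts_at_nonempty by blast
  have c': "c \<in> charts_at A (\<gamma>' t)" using c ag by (simp add: agree_def)
  have cA: "c \<in> A" using c by simp
  have eq: "state c \<gamma> t = state c \<gamma>' t" using agree_iff_state[OF 1 c 2 c'] ag by blast
  have "open (img c \<times> (UNIV :: (real ^ 'n) set))" using open_img[OF cA] by (intro open_Times) auto
  moreover have "state c \<gamma> t \<in> img c \<times> UNIV" using c by (simp add: state_def)
  ultimately obtain e where e: "e > 0" "cball (state c \<gamma> t) e \<subseteq> img c \<times> UNIV"
    by (meson open_contains_cball)
  obtain L where L: "L-lipschitz_on (cball (state c \<gamma> t) e) (spray c)"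
    using spray_lipschitz[OF cA compact_cball convex_cball e(2)] by blast
  have near: "\<forall>\<^sub>F s in nhds t. s \<in> J \<and> \<gamma> s \<in> fst c \<and> state c \<gamma> s \<in> cball (state c \<gamma> t) e"
    if J: "open J" "is_geodesic A g J \<gamma>" "t \<in> J" "c \<in> charts_at A (\<gamma> t)" for J \<gamma>
  proof -
    have "(state c \<gamma> \<longlongrightarrow> state c \<gamma> t) (nhds t)"
      using state_isCont[OF J] by (simp add: isCont_def tendsto_nhds_iff)
    then have "\<forall>\<^sub>F s in nhds t. dist (state c \<gamma> s) (state c \<gamma> t) < e" using e(1) by (rule tendstoD)
    then show ?thesis
      using eventually_nhds_in_open[OF J(1,3)] eventually_in_dom[OF is_geodesic_isCont[OF J(1-3)] J(4)]
      by eventually_elim (auto simp: dist_commute)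
  qed
  have n1: "\<forall>\<^sub>F s in nhds t. s \<in> J \<and> \<gamma> s \<in> fst c \<and> state c \<gamma> s \<in> cball (state c \<gamma> t) e"
    by (rule near[OF 1 c])
  have n2: "\<forall>\<^sub>F s in nhds t. s \<in> J' \<and> \<gamma>' s \<in> fst c \<and> state c \<gamma>' s \<in> cball (state c \<gamma> t) e"
    unfolding eq by (rule near[OF 2 c'])
  have "\<forall>\<^sub>F s in nhds t. state c \<gamma> s = state c \<gamma>' s"
  proof (rule ode_local_unique[where x = "state c \<gamma>" and y = "state c \<gamma>'", OF L _ _ eq])
    show "\<forall>\<^sub>F s in nhds t. state c \<gamma> s \<in> cball (state c \<gamma> t) e
        \<and> (state c \<gamma> has_vector_derivative spray c (state c \<gamma> s)) (at s)"
      using n1 by eventually_elim (auto intro: is_geodesic_state[OF 1(1,2)] charts_atI[OF cA])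
    show "\<forall>\<^sub>F s in nhds t. state c \<gamma>' s \<in> cball (state c \<gamma> t) e
        \<and> (state c \<gamma>' has_vector_derivative spray c (state c \<gamma>' s)) (at s)"
      using n2 by eventually_elim (auto intro: is_geodesic_state[OF 2(1,2)] charts_atI[OF cA])
  qed
  then show ?thesis
    using n1 n2
    by eventually_elim (use agree_iff_state[OF 1(1,2) _ _ 2(1,2)] charts_atI[OF cA] in blast)
qed

text \<open>Agreement is an open condition by local uniqueness. Disagreement is open too: different
  positions are separated by the Hausdorff property, and different velocities at the same position
  by continuity of the states in a common chart.\<close>

lemma geodesic_unique:
  assumes J: "open J" "connected J" and 1: "is_geodesic A g J \<gamma>" and 2: "is_geodesic A g J \<gamma>'"
    and s: "s \<in> J" "agree \<gamma> \<gamma>' s" and t: "t \<in> J"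
  shows "agree \<gamma> \<gamma>' t"
proof (rule connected_clopen_induct[OF J(2) s(1) t, of "agree \<gamma> \<gamma>'", OF s(2)])
  fix t assume t: "t \<in> J"
  note cont = is_geodesic_isCont[OF J(1) 1 t] is_geodesic_isCont[OF J(1) 2 t]
  consider "agree \<gamma> \<gamma>' t" | "\<gamma> t \<noteq> \<gamma>' t" | "\<gamma> t = \<gamma>' t" "\<not> agree \<gamma> \<gamma>' t" by blast
  then show "(\<forall>\<^sub>F s in nhds t. s \<in> J \<longrightarrow> agree \<gamma> \<gamma>' s) \<or> (\<forall>\<^sub>F s in nhds t. \<not> agree \<gamma> \<gamma>' s)"
  proof cases
    case 1
    then show ?thesis
      using geodesic_unique_local[OF J(1) assms(3) t J(1) 2 t] by (auto elim: eventually_mono)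
  next
    case 2
    then obtain U V where UV: "open U" "open V" "\<gamma> t \<in> U" "\<gamma>' t \<in> V" "U \<inter> V = {}"
      using hausdorff by metis
    have "\<forall>\<^sub>F s in nhds t. \<gamma> s \<in> U" "\<forall>\<^sub>F s in nhds t. \<gamma>' s \<in> V"
      using cont UV by (metis isCont_def tendsto_nhds_iff topological_tendstoD)+
    then have "\<forall>\<^sub>F s in nhds t. \<not> agree \<gamma> \<gamma>' s"
      by eventually_elim (use UV(5) in \<open>auto simp: agree_def\<close>)
    then show ?thesis by blast
  next
    case 3
    obtain c where c: "c \<in> charts_at A (\<gamma> t)" using charts_at_nonempty by blast
    have c': "c \<in> charts_at A (\<gamma>' t)" using c 3 by simp
    have "state c \<gamma> t - state c \<gamma>' t \<noteq> 0"
      using agree_iff_state[OF J(1) 1 t c J(1) 2 t c'] 3(2) by simp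
    moreover have "((\<lambda>s. state c \<gamma> s - state c \<gamma>' s) \<longlongrightarrow> state c \<gamma> t - state c \<gamma>' t) (nhds t)"
      using state_isCont[OF J(1) 1 t c] state_isCont[OF J(1) 2 t c']
      by (intro tendsto_diff) (simp_all add: isCont_def tendsto_nhds_iff)
    ultimately have "\<forall>\<^sub>F s in nhds t. state c \<gamma> s - state c \<gamma>' s \<noteq> 0"
      using tendsto_imp_eventually_ne by blast
    then have "\<forall>\<^sub>F s in nhds t. \<not> agree \<gamma> \<gamma>' s"
      using eventually_nhds_in_open[OF J(1) t] eventually_in_dom[OF cont(1) c] eventually_in_dom[OF cont(2) c']
      by eventually_elim
        (use agree_iff_state[where c = c, OF J(1) 1 _ _ J(1) 2] charts_atI[OF charts_atD(1)[OF c]] in auto)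
    then show ?thesis by blast
  qed
qed

lemma is_geodesic_subset: "is_geodesic A g J \<gamma> \<Longrightarrow> J' \<subseteq> J \<Longrightarrow> is_geodesic A g J' \<gamma>"
  unfolding is_geodesic_def by (meson continuous_on_subset subsetD)

lemma is_geodesic_glue:
  assumes 1: "open J" "is_interval J" "is_geodesic A g J \<gamma>"
    and 2: "open J'" "is_interval J'" "is_geodesic A g J' \<gamma>'"
    and s: "s \<in> J" "s \<in> J'" "agree \<gamma> \<gamma>' s"
  obtains \<delta> where "is_geodesic A g (J \<union> J') \<delta>" "\<And>t. t \<in> J \<Longrightarrow> \<gamma> t = \<delta> t" "\<And>t. t \<in> J' \<Longrightarrow> \<gamma>' t = \<delta> t"
proof
  define \<delta> where "\<delta> t = (if t \<in> J then \<gamma> t else \<gamma>' t)" for t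
  have J: "open (J \<inter> J')" "connected (J \<inter> J')"
    using 1 2 by (auto intro: is_interval_connected is_interval_Int)
  have "agree \<gamma> \<gamma>' t" if "t \<in> J \<inter> J'" for t
    by (rule geodesic_unique[OF J is_geodesic_subset[OF 1(3)] is_geodesic_subset[OF 2(3)] _ s(3) that])
      (use s in auto)
  then show eq2: "\<gamma>' t = \<delta> t" if "t \<in> J'" for t
    using that by (auto simp: \<delta>_def agree_def)
  show eq1: "\<gamma> t = \<delta> t" if "t \<in> J" for t
    using that by (simp add: \<delta>_def)
  have "is_geodesic A g J \<delta>" "is_geodesic A g J' \<delta>"
    using is_geodesic_cong(1)[OF 1(1,3) eq1] is_geodesic_cong(1)[OF 2(1,3) eq2] by auto
  then show "is_geodesic A g (J \<union> J') \<delta>"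
    using 1(1) 2(1) by (auto simp: is_geodesic_iff open_Un intro!: continuous_on_open_Un)
qed

definition geodesic_to :: "'a \<Rightarrow> 'a tvec \<Rightarrow> real \<Rightarrow> real set \<Rightarrow> (real \<Rightarrow> 'a) \<Rightarrow> bool" where
  "geodesic_to p \<xi> t J \<gamma> \<longleftrightarrow> open J \<and> is_interval J \<and> 0 \<in> J \<and> t \<in> J \<and>
     is_geodesic A g J \<gamma> \<and> \<gamma> 0 = p \<and> velocity A \<gamma> 0 = \<xi>"

lemma geodesic_alt: "geodesic A g p t \<xi> = (THE q. \<exists>J \<gamma>. geodesic_to p \<xi> t J \<gamma> \<and> \<gamma> t = q)"
  by (simp add: geodesic_def geodesic_to_def conj_assoc)

text \<open>Two candidates may live on different intervals; both are geodesics on the intersection,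
  which is again an interval and contains 0 and \<open>t\<close>.\<close>

lemma geodesic_eqI:
  assumes "geodesic_to p \<xi> t J \<gamma>"
  shows "geodesic A g p t \<xi> = \<gamma> t"
  unfolding geodesic_alt
proof (rule the_equality)
  fix q assume "\<exists>J \<gamma>. geodesic_to p \<xi> t J \<gamma> \<and> \<gamma> t = q"
  then obtain J' \<gamma>' where *: "geodesic_to p \<xi> t J' \<gamma>'" "\<gamma>' t = q" by blast
  have J: "open (J \<inter> J')" "connected (J \<inter> J')"
    using assms * unfolding geodesic_to_def by (auto intro: is_interval_connected is_interval_Int)
  have "agree \<gamma> \<gamma>' t"
    by (rule geodesic_unique[OF J, of _ _ 0])
      (use assms * in \<open>auto simp: geodesic_to_def agree_def intro: is_geodesic_subset\<close>)
  then show "q = \<gamma> t" using * by (simp add: agree_def)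
qed (use assms in blast)

section \<open>Continuous dependence on the initial velocity\<close>

text \<open>Continuity at \<open>v0\<close> of the map from initial velocities, in components of
  \<open>c0\<close>, to states at time \<open>s\<close>, in coordinates of \<open>c\<close>,
  combined with existence up to time \<open>s\<close> for all velocities near \<open>v0\<close>.
  Coupling the two lets both be propagated along \<gamma> at once.\<close>

definition reaches_near where
  "reaches_near p c0 v0 \<gamma> c s \<longleftrightarrow> (\<forall>e>0. \<forall>\<^sub>F v in nhds v0. \<exists>J' \<gamma>'.
    geodesic_to p (from_components A c0 p v) s J' \<gamma>' \<and> \<gamma>' s \<in> fst c \<and> dist (state c \<gamma>' s) (state c \<gamma> s) < e)"

text \<open>The state in \<open>d\<close> is a continuous function \<open>?T\<close> of the state in
  \<open>c\<close>, and the overlap of the charts is open, so states close enough to that of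
  \<gamma> have their position in it.\<close>

lemma reaches_near_transition:
  assumes \<gamma>: "geodesic_to p \<xi> t J \<gamma>" "s \<in> J" and c: "c \<in> charts_at A (\<gamma> s)" and d: "d \<in> charts_at A (\<gamma> s)"
    and near: "reaches_near p c0 v0 \<gamma> c s"
  shows "reaches_near p c0 v0 \<gamma> d s"
  unfolding reaches_near_def
proof (intro allI impI)
  fix e :: real assume e: "e > 0"
  note cA = charts_atD(1)[OF c] and dA = charts_atD(1)[OF d]
  let ?U = "snd c ` (fst c \<inter> fst d)"
  let ?P = "\<lambda>y. frechet_derivative (transition c d) (at y)"
  let ?T = "\<lambda>z. (transition c d (fst z), \<Sum>i\<in>UNIV. snd z $ i *\<^sub>R ?P (fst z) (axis i 1))"
  have lin: "?P y u = (\<Sum>i\<in>UNIV. u $ i *\<^sub>R ?P y (axis i 1))" if "y \<in> ?U" for y u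
    using linear_axis_sum[OF has_derivative_linear[OF dtrans_has_derivative[OF cA dA that]]] .
  have T: "state d \<gamma>' s = ?T (state c \<gamma>' s)"
    if "geodesic_to p \<xi>' s' J' \<gamma>'" "s \<in> J'" "c \<in> charts_at A (\<gamma>' s)" "d \<in> charts_at A (\<gamma>' s)" for \<gamma>' J' \<xi>' s'
  proof -
    have g: "open J'" "is_geodesic A g J' \<gamma>'" using that(1) by (auto simp: geodesic_to_def)
    have "state d \<gamma>' s = (snd d (\<gamma>' s), ?P (snd c (\<gamma>' s)) (snd (state c \<gamma>' s)))"
      using g that by (intro state_transition is_geodesic_isCont state_derivativeD is_geodesic_state)
    also have "?P (snd c (\<gamma>' s)) (snd (state c \<gamma>' s))
      = (\<Sum>i\<in>UNIV. snd (state c \<gamma>' s) $ i *\<^sub>R ?P (snd c (\<gamma>' s)) (axis i 1))"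
      by (rule lin) (use that in simp)
    also have "snd d (\<gamma>' s) = transition c d (fst (state c \<gamma>' s))"
      using that by (simp add: state_def)
    also have "snd c (\<gamma>' s) = fst (state c \<gamma>' s)" by (simp add: state_def)
    finally show ?thesis .
  qed
  have z: "fst (state c \<gamma> s) \<in> ?U" using c d by (simp add: state_def)
  have "isCont ?T (state c \<gamma> s)"
  proof -
    have "isCont (transition c d) (fst (state c \<gamma> s))" "isCont (\<lambda>y. ?P y u) (fst (state c \<gamma> s))" for u
      using z open_overlap[OF cA dA] smooth_transition[OF cA dA]
      by (metis continuous_on_eq_continuous_at smooth_on_continuous_on smooth_on_frechet_derivative)+
    note * = this[THEN isCont_o2[OF continuous_fst[OF continuous_ident]]]
    have "isCont (\<lambda>z. snd z $ i) (state c \<gamma> s)" for i :: 'n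
      by (intro linear_continuous_at bounded_linear_compose[OF bounded_linear_vec_nth bounded_linear_snd])
    then show ?thesis by (intro continuous_Pair continuous_sum continuous_scaleR *)
  qed
  from this[unfolded continuous_at_eps_delta, THEN spec, THEN mp, OF e]
  obtain \<delta> where \<delta>: "\<delta> > 0" "\<And>z. dist z (state c \<gamma> s) < \<delta> \<Longrightarrow> dist (?T z) (?T (state c \<gamma> s)) < e"
    by blast
  obtain \<delta>' where \<delta>': "\<delta>' > 0" "ball (fst (state c \<gamma> s)) \<delta>' \<subseteq> ?U"
    using z open_overlap[OF cA dA] openE by blast
  have "\<forall>\<^sub>F v in nhds v0. \<exists>J' \<gamma>'. geodesic_to p (from_components A c0 p v) s J' \<gamma>' \<and> \<gamma>' s \<in> fst c
      \<and> dist (state c \<gamma>' s) (state c \<gamma> s) < min \<delta> \<delta>'"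
    using near[unfolded reaches_near_def, rule_format, of "min \<delta> \<delta>'"] \<delta>(1) \<delta>'(1) by linarith
  then show "\<forall>\<^sub>F v in nhds v0. \<exists>J' \<gamma>'. geodesic_to p (from_components A c0 p v) s J' \<gamma>' \<and> \<gamma>' s \<in> fst d
      \<and> dist (state d \<gamma>' s) (state d \<gamma> s) < e"
  proof eventually_elim
    case (elim v)
    then obtain J' \<gamma>' where g': "geodesic_to p (from_components A c0 p v) s J' \<gamma>'" "\<gamma>' s \<in> fst c"
      "dist (state c \<gamma>' s) (state c \<gamma> s) < \<delta>" "dist (state c \<gamma>' s) (state c \<gamma> s) < \<delta>'" by auto
    have "fst (state c \<gamma>' s) \<in> ?U"
      using \<delta>'(2) dist_fst_le[of "state c \<gamma>' s" "state c \<gamma> s"] g'(4) by (auto simp: dist_commute subset_iff)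
    then have "\<gamma>' s \<in> fst d" using g'(2) chart_inv_left[OF cA] by (auto simp: state_def) metis
    then show ?case
      using g' \<delta>(2)[OF g'(3)] T[OF g'(1) _ charts_atI[OF cA g'(2)] charts_atI[OF dA]] T[OF \<gamma> c d]
      by (intro exI[of _ J'] exI[of _ \<gamma>']) (auto simp: geodesic_to_def)
  qed
qed

text \<open>At time 0 the state is the initial datum itself, so closeness is immediate and only
  short-time existence is needed, which the flow box gives.\<close>

lemma reaches_near_0:
  assumes c0: "c0 \<in> charts_at A p" and \<gamma>: "geodesic_to p (from_components A c0 p v0) t J \<gamma>"
  shows "reaches_near p c0 v0 \<gamma> c0 0"
  unfolding reaches_near_def
proof (intro allI impI)
  fix e :: real assume e: "e > 0"
  note c0A = charts_atD(1)[OF c0]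
  have \<gamma>0: "\<gamma> 0 = p" using \<gamma> by (simp add: geodesic_to_def)
  have "from_components A c0 p (snd (state c0 \<gamma> 0)) = from_components A c0 p v0"
    using is_geodesic_velocity[of J \<gamma> 0 c0] \<gamma> c0 by (simp add: geodesic_to_def)
  then have st: "state c0 \<gamma> 0 = (snd c0 p, v0)"
    using from_components_inject[OF c0] \<gamma>0 by (simp add: state_def)
  have "snd c0 p \<in> img c0" using c0 by simp
  then obtain r' where r': "r' > 0" "cball (snd c0 p) r' \<subseteq> img c0"
    using open_img[OF c0A] by (meson open_contains_cball)
  define r where "r = r' / 2"
  have r: "r > 0" "cball (snd c0 p) (2 * r) \<subseteq> img c0" using r' by (auto simp: r_def)
  let ?Z = "cball (snd c0 p) r \<times> cball (0 :: real ^ 'n) (norm v0 + 1)"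
  obtain \<tau> \<Phi> \<Gamma> where box: "\<tau> > 0"
    "\<And>z. z \<in> ?Z \<Longrightarrow> \<Phi> z 0 = z"
    "\<And>z s. z \<in> ?Z \<Longrightarrow> is_geodesic A g {s - \<tau><..<s + \<tau>} (\<Gamma> z s)"
    "\<And>z s u. z \<in> ?Z \<Longrightarrow> u \<in> {s - \<tau><..<s + \<tau>} \<Longrightarrow>
      c0 \<in> charts_at A (\<Gamma> z s u) \<and> state c0 (\<Gamma> z s) u = \<Phi> z (u - s)"
    by (rule geodesic_flow_box[OF c0A r, of "norm v0 + 1"]) (rule that; assumption)
  have "\<forall>\<^sub>F v in nhds v0. dist v v0 < min e 1"
    using e by (intro eventually_nhds_dist) simp
  then show "\<forall>\<^sub>F v in nhds v0. \<exists>J' \<gamma>'. geodesic_to p (from_components A c0 p v) 0 J' \<gamma>' \<and>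
    \<gamma>' 0 \<in> fst c0 \<and> dist (state c0 \<gamma>' 0) (state c0 \<gamma> 0) < e"
  proof eventually_elim
    case (elim v)
    have "norm v \<le> norm v0 + 1" using elim norm_triangle_ineq2[of v v0] by (simp add: dist_norm)
    then have z: "(snd c0 p, v) \<in> ?Z" using r by simp
    define \<gamma>' where "\<gamma>' = \<Gamma> (snd c0 p, v) 0"
    have c': "c0 \<in> charts_at A (\<gamma>' 0)" and st': "state c0 \<gamma>' 0 = (snd c0 p, v)"
      using box(4)[OF z, of 0 0] box(1,2) z by (auto simp: \<gamma>'_def)
    have g': "is_geodesic A g {-\<tau><..<\<tau>} \<gamma>'" using box(3)[OF z, of 0] by (simp add: \<gamma>'_def)
    have "snd c0 (\<gamma>' 0) = snd c0 p" using st' by (simp add: state_def)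
    then have p: "\<gamma>' 0 = p" using c' c0 by (metis charts_atD chart_inv_left)
    have "velocity A \<gamma>' 0 = from_components A c0 p v"
      using is_geodesic_velocity[OF _ g' _ c'] box(1) st' p by simp
    then have "geodesic_to p (from_components A c0 p v) 0 {-\<tau><..<\<tau>} \<gamma>'"
      using g' p box(1) by (simp add: geodesic_to_def is_interval_oo)
    moreover have "dist (state c0 \<gamma>' 0) (state c0 \<gamma> 0) < e"
      using elim by (simp add: st st' dist_Pair_Pair)
    ultimately show ?case using c' by (metis charts_atD(2))
  qed
qed

text \<open>Near a fixed state, a flow box of uniform length extends all geodesics and preserves the
  closeness of states, so whether \<open>reaches_near\<close> holds is locally constant in time.\<close>

lemma reaches_near_locally_constant:
  assumes c0: "c0 \<in> charts_at A p" and \<gamma>: "geodesic_to p (from_components A c0 p v0) t J \<gamma>"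
    and s0: "s0 \<in> J" and c: "c \<in> charts_at A (\<gamma> s0)"
  shows "\<exists>T. open T \<and> s0 \<in> T \<and> (\<forall>s\<in>T \<inter> J. c \<in> charts_at A (\<gamma> s)) \<and>
    (\<forall>s1\<in>T \<inter> J. \<forall>s2\<in>T \<inter> J. reaches_near p c0 v0 \<gamma> c s1 \<longrightarrow> reaches_near p c0 v0 \<gamma> c s2)"
proof -
  note cA = charts_atD(1)[OF c]
  have J: "open J" "is_interval J" "is_geodesic A g J \<gamma>"
    using \<gamma> by (auto simp: geodesic_to_def)
  define z0 where "z0 = state c \<gamma> s0"
  have "fst z0 \<in> img c" using c by (simp add: z0_def state_def)
  then obtain r' where r': "r' > 0" "cball (fst z0) r' \<subseteq> img c"
    using open_img[OF cA] by (meson open_contains_cball)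
  define r where "r = r' / 2"
  have r: "r > 0" "cball (fst z0) (2 * r) \<subseteq> img c" using r' by (auto simp: r_def)
  \<comment> \<open>States within \<open>m\<close> of \<open>z0\<close> lie in \<open>?Z\<close>:
    the position moves by at most \<open>r\<close>, and the speed grows by at most 1.\<close>
  define m where "m = min r 1"
  have m: "m > 0" using r by (simp add: m_def)
  let ?Z = "cball (fst z0) r \<times> cball (0 :: real ^ 'n) (norm (snd z0) + 1)"
  have Z: "z \<in> ?Z" if "dist z z0 < m" for z
    using that dist_fst_le[of z z0] dist_snd_le[of z z0] norm_triangle_ineq2[of "snd z" "snd z0"]
    by (auto simp: mem_Times_iff dist_commute m_def) (simp add: dist_norm norm_minus_commute)
  obtain \<tau> \<Phi> \<Gamma> where box: "\<tau> > 0"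
    "\<And>z. z \<in> ?Z \<Longrightarrow> \<Phi> z 0 = z"
    "\<And>z w t. z \<in> ?Z \<Longrightarrow> w \<in> ?Z \<Longrightarrow> \<bar>t\<bar> < \<tau> \<Longrightarrow> dist (\<Phi> z t) (\<Phi> w t) \<le> 2 * dist z w"
    "\<And>z s. z \<in> ?Z \<Longrightarrow> is_geodesic A g {s - \<tau><..<s + \<tau>} (\<Gamma> z s)"
    "\<And>z s u. z \<in> ?Z \<Longrightarrow> u \<in> {s - \<tau><..<s + \<tau>} \<Longrightarrow>
      c \<in> charts_at A (\<Gamma> z s u) \<and> state c (\<Gamma> z s) u = \<Phi> z (u - s)"
    by (rule geodesic_flow_box[OF cA r, of "norm (snd z0) + 1"]) (rule that; assumption)
  \<comment> \<open>Any geodesic whose state at \<open>s1\<close> lies in the flow box is glued to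
    the box geodesic through that state and thereby reaches \<open>s2\<close>.\<close>
  have ext: "\<exists>J'' \<delta>. geodesic_to p \<xi> s2 J'' \<delta> \<and> \<delta> s2 \<in> fst c \<and> state c \<delta> s2 = \<Phi> (state c \<delta>' s1) (s2 - s1)
      \<and> (\<forall>u\<in>J'. \<delta>' u = \<delta> u)"
    if g': "geodesic_to p \<xi> s1 J' \<delta>'" and c': "c \<in> charts_at A (\<delta>' s1)"
      and z: "state c \<delta>' s1 \<in> ?Z" and s2: "\<bar>s2 - s1\<bar> < \<tau>" for \<xi> s1 s2 J' \<delta>'
  proof -
    let ?I = "{s1 - \<tau><..<s1 + \<tau>}"
    let ?\<Gamma> = "\<Gamma> (state c \<delta>' s1) s1"
    have I: "s1 \<in> ?I" "s2 \<in> ?I" using box(1) s2 by auto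
    have J': "open J'" "is_interval J'" "is_geodesic A g J' \<delta>'" "s1 \<in> J'"
      using g' by (auto simp: geodesic_to_def)
    have "agree \<delta>' ?\<Gamma> s1"
      using box(5)[OF z I(1)] box(2)[OF z]
      by (subst agree_iff_state[OF J'(1,3,4) c' open_greaterThanLessThan box(4)[OF z] I(1)]) auto
    from is_geodesic_glue[OF J'(1-3) open_greaterThanLessThan is_interval_oo box(4)[OF z] J'(4) I(1) this]
    obtain \<delta> where \<delta>: "is_geodesic A g (J' \<union> ?I) \<delta>" "\<And>t. t \<in> J' \<Longrightarrow> \<delta>' t = \<delta> t" "\<And>t. t \<in> ?I \<Longrightarrow> ?\<Gamma> t = \<delta> t"
      by blast
    have int: "is_interval (J' \<union> ?I)"
      unfolding is_interval_connected_1
      using J'(2,4) I(1) by (intro connected_Un) (auto simp: is_interval_connected_1)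
    have zero: "0 \<in> J'" "\<delta>' 0 = p" "velocity A \<delta>' 0 = \<xi>" using g' by (auto simp: geodesic_to_def)
    have "velocity A \<delta> 0 = velocity A \<delta>' 0"
    proof -
      obtain d where d: "d \<in> charts_at A (\<delta>' 0)" using charts_at_nonempty by blast
      have \<delta>J: "is_geodesic A g J' \<delta>" using is_geodesic_subset[OF \<delta>(1)] by blast
      show ?thesis
        using is_geodesic_velocity[OF J'(1,3) zero(1) d] is_geodesic_velocity[OF J'(1) \<delta>J zero(1)]
          is_geodesic_cong(2)[OF J'(1,3) \<delta>(2) zero(1), of d] d \<delta>(2)[OF zero(1)] by simp
    qed
    then have "geodesic_to p \<xi> s2 (J' \<union> ?I) \<delta>"
      using J'(1) I int \<delta>(1) zero \<delta>(2)[OF zero(1)] by (simp add: geodesic_to_def open_Un)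
    moreover have "state c \<delta> s2 = \<Phi> (state c \<delta>' s1) (s2 - s1)" "\<delta> s2 \<in> fst c"
      using is_geodesic_cong(2)[OF open_greaterThanLessThan box(4)[OF z] \<delta>(3) I(2), of c]
        box(5)[OF z I(2)] \<delta>(3)[OF I(2)] charts_atD(2)[of c "?\<Gamma> s2"] by auto
    ultimately show ?thesis using \<delta>(2) by blast
  qed
  have "(state c \<gamma> \<longlongrightarrow> z0) (nhds s0)"
    using state_isCont[OF J(1,3) s0 c] by (simp add: isCont_def tendsto_nhds_iff z0_def)
  then have "\<forall>\<^sub>F s in nhds s0. dist (state c \<gamma> s) z0 < m" using m by (rule tendstoD)
  moreover have "\<forall>\<^sub>F s in nhds s0. \<gamma> s \<in> fst c"
    by (rule eventually_in_dom[OF is_geodesic_isCont[OF J(1,3) s0] c])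
  moreover have "\<forall>\<^sub>F s in nhds s0. dist s s0 < \<tau> / 2"
    using box(1) by (intro eventually_nhds_dist) simp
  ultimately have "\<forall>\<^sub>F s in nhds s0. dist (state c \<gamma> s) z0 < m \<and> \<gamma> s \<in> fst c \<and> dist s s0 < \<tau> / 2"
    by eventually_elim simp
  then obtain T where T: "open T" "s0 \<in> T" "\<And>s. s \<in> T \<Longrightarrow> dist (state c \<gamma> s) z0 < m"
    "\<And>s. s \<in> T \<Longrightarrow> \<gamma> s \<in> fst c" "\<And>s. s \<in> T \<Longrightarrow> dist s s0 < \<tau> / 2"
    unfolding eventually_nhds by blast
  have "reaches_near p c0 v0 \<gamma> c s2" if s: "s1 \<in> T \<inter> J" "s2 \<in> T \<inter> J" and near: "reaches_near p c0 v0 \<gamma> c s1" for s1 s2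
    unfolding reaches_near_def
  proof (intro allI impI)
    fix e :: real assume e: "e > 0"
    have "dist s1 s0 < \<tau> / 2" "dist s2 s0 < \<tau> / 2" using T(5) s by auto
    then have s12: "\<bar>s2 - s1\<bar> < \<tau>" unfolding dist_real_def by linarith
    have z: "state c \<gamma> s1 \<in> ?Z" using Z T(3) s by blast
    have st2: "state c \<gamma> s2 = \<Phi> (state c \<gamma> s1) (s2 - s1)"
    proof -
      have "geodesic_to p (from_components A c0 p v0) s1 J \<gamma>" using \<gamma> s(1) by (simp add: geodesic_to_def)
      moreover have "c \<in> charts_at A (\<gamma> s1)" using charts_atI[OF cA T(4)] s by blast
      ultimately obtain J'' \<delta> where \<delta>: "geodesic_to p (from_components A c0 p v0) s2 J'' \<delta>"
        "state c \<delta> s2 = \<Phi> (state c \<gamma> s1) (s2 - s1)" "\<And>u. u \<in> J \<Longrightarrow> \<gamma> u = \<delta> u"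
        using ext[OF _ _ z s12] by blast
      then show ?thesis using is_geodesic_cong(2)[OF J(1,3) \<delta>(3)] s(2) by simp
    qed
    \<comment> \<open>The flow at most doubles distances, which accounts for \<open>e / 2\<close>;
      the other bound keeps the perturbed state within \<open>m\<close> of \<open>z0\<close>, hence
      in \<open>?Z\<close>.\<close>
    define e' where "e' = min (e / 2) (m - dist (state c \<gamma> s1) z0)"
    have "e' > 0" using e T(3) s by (auto simp: e'_def)
    then have "\<forall>\<^sub>F v in nhds v0. \<exists>J' \<gamma>'. geodesic_to p (from_components A c0 p v) s1 J' \<gamma>' \<and>
      \<gamma>' s1 \<in> fst c \<and> dist (state c \<gamma>' s1) (state c \<gamma> s1) < e'"
      using near unfolding reaches_near_def by blast
    then show "\<forall>\<^sub>F v in nhds v0. \<exists>J' \<gamma>'. geodesic_to p (from_components A c0 p v) s2 J' \<gamma>' \<and>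
      \<gamma>' s2 \<in> fst c \<and> dist (state c \<gamma>' s2) (state c \<gamma> s2) < e"
    proof eventually_elim
      case (elim v)
      then obtain J' \<gamma>' where g': "geodesic_to p (from_components A c0 p v) s1 J' \<gamma>'" "\<gamma>' s1 \<in> fst c"
        "dist (state c \<gamma>' s1) (state c \<gamma> s1) < e / 2"
        "dist (state c \<gamma>' s1) (state c \<gamma> s1) < m - dist (state c \<gamma> s1) z0"
        by (auto simp: e'_def)
      have "dist (state c \<gamma>' s1) z0 < m"
        using g'(4) dist_triangle[of "state c \<gamma>' s1" z0 "state c \<gamma> s1"] by linarith
      then have z': "state c \<gamma>' s1 \<in> ?Z" by (rule Z)
      obtain J'' \<delta> where \<delta>: "geodesic_to p (from_components A c0 p v) s2 J'' \<delta>" "\<delta> s2 \<in> fst c"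
        "state c \<delta> s2 = \<Phi> (state c \<gamma>' s1) (s2 - s1)"
        using ext[OF g'(1) charts_atI[OF cA g'(2)] z' s12] by blast
      have "dist (state c \<delta> s2) (state c \<gamma> s2) < e"
        using box(3)[OF z' z s12] g'(3) by (simp add: \<delta>(3) st2)
      then show ?case using \<delta> by blast
    qed
  qed
  moreover have "c \<in> charts_at A (\<gamma> s)" if "s \<in> T \<inter> J" for s using charts_atI[OF cA T(4)] that by blast
  ultimately show ?thesis using T(1,2) by blast
qed

text \<open>Quantifying over all charts at the current point makes the property independent of the
  chart in which it is locally constant, so connectedness of \<open>J\<close> carries it from time 0
  to \<open>t\<close>.\<close>

lemma reaches_near_end:
  assumes c0: "c0 \<in> charts_at A p" and \<gamma>: "geodesic_to p (from_components A c0 p v0) t J \<gamma>"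
    and c: "c \<in> charts_at A (\<gamma> t)"
  shows "reaches_near p c0 v0 \<gamma> c t"
proof -
  define P where "P s \<longleftrightarrow> (\<forall>c\<in>charts_at A (\<gamma> s). reaches_near p c0 v0 \<gamma> c s)" for s
  have J: "is_interval J" "0 \<in> J" "t \<in> J" and \<gamma>0: "\<gamma> 0 = p" using \<gamma> by (auto simp: geodesic_to_def)
  have "P t"
  proof (rule connected_induction_simple[OF is_interval_connected[OF J(1)] J(2,3)])
    show "P 0"
      unfolding P_def using reaches_near_transition[OF \<gamma> J(2), of c0] reaches_near_0[OF c0 \<gamma>] c0 \<gamma>0 by blast
    fix s0 assume s0: "s0 \<in> J"
    obtain c where c: "c \<in> charts_at A (\<gamma> s0)" using charts_at_nonempty by blast
    obtain T where T: "open T" "s0 \<in> T" "\<And>s. s \<in> T \<inter> J \<Longrightarrow> c \<in> charts_at A (\<gamma> s)"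
      "\<And>s1 s2. s1 \<in> T \<inter> J \<Longrightarrow> s2 \<in> T \<inter> J \<Longrightarrow> reaches_near p c0 v0 \<gamma> c s1 \<Longrightarrow> reaches_near p c0 v0 \<gamma> c s2"
      using reaches_near_locally_constant[OF c0 \<gamma> s0 c] by blast
    have "P s2" if s: "s1 \<in> T \<inter> J" "s2 \<in> T \<inter> J" "P s1" for s1 s2
    proof -
      have "reaches_near p c0 v0 \<gamma> c s1" using s(3) T(3)[OF s(1)] unfolding P_def by blast
      then have "reaches_near p c0 v0 \<gamma> c s2" by (rule T(4)[OF s(1,2)])
      then show ?thesis
        unfolding P_def using reaches_near_transition[OF \<gamma> _ T(3)[OF s(2)]] s(2) by blast
    qed
    then show "\<exists>T. openin (top_of_set J) T \<and> s0 \<in> T \<and> (\<forall>x\<in>T. \<forall>y\<in>T. P x \<longrightarrow> P y)"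
      using T(1,2) s0 by (intro exI[of _ "J \<inter> T"]) auto
  qed
  then show ?thesis using c unfolding P_def by blast
qed

lemma geodesic_isCont:
  assumes c0: "c0 \<in> charts_at A p" and \<gamma>: "geodesic_to p (from_components A c0 p v0) t J \<gamma>"
  shows "\<forall>\<^sub>F v in nhds v0. \<exists>J \<gamma>. geodesic_to p (from_components A c0 p v) t J \<gamma>"
    and "isCont (\<lambda>v. geodesic A g p t (from_components A c0 p v)) v0"
proof -
  obtain c where c: "c \<in> charts_at A (\<gamma> t)" using charts_at_nonempty by blast
  note cA = charts_atD(1)[OF c]
  let ?E = "\<lambda>v. geodesic A g p t (from_components A c0 p v)"
  have near: "\<forall>\<^sub>F v in nhds v0. \<exists>J' \<gamma>'. geodesic_to p (from_components A c0 p v) t J' \<gamma>' \<and>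
      \<gamma>' t \<in> fst c \<and> dist (state c \<gamma>' t) (state c \<gamma> t) < e" if "e > 0" for e
    using reaches_near_end[OF c0 \<gamma> c] that unfolding reaches_near_def by blast
  show "\<forall>\<^sub>F v in nhds v0. \<exists>J \<gamma>. geodesic_to p (from_components A c0 p v) t J \<gamma>"
    by (rule eventually_mono[OF near[OF zero_less_one]]) blast
  have E0: "?E v0 = \<gamma> t" by (rule geodesic_eqI[OF \<gamma>])
  have close: "\<forall>\<^sub>F v in nhds v0. ?E v \<in> fst c \<and> dist (snd c (?E v)) (snd c (?E v0)) < e" if "e > 0" for e
    using near[OF that]
  proof eventually_elim
    case (elim v)
    then obtain J' \<gamma>' where g': "geodesic_to p (from_components A c0 p v) t J' \<gamma>'" "\<gamma>' t \<in> fst c"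
      "dist (state c \<gamma>' t) (state c \<gamma> t) < e" by blast
    then show ?case
      using geodesic_eqI[OF g'(1)] E0 dist_fst_le[of "state c \<gamma>' t" "state c \<gamma> t"] by (simp add: state_def)
  qed
  have "((\<lambda>v. snd c (?E v)) \<longlongrightarrow> snd c (?E v0)) (nhds v0)"
    by (rule tendstoI, rule eventually_mono[OF close]) auto
  moreover have "isCont (chart_inv c) (snd c (?E v0))"
    using chart_inv_isCont[OF cA] c E0 by simp
  \<comment> \<open>Coordinates of the endpoint converge; continuity of the inverse chart transfers
    this to the manifold.\<close>
  ultimately have "((\<lambda>v. chart_inv c (snd c (?E v))) \<longlongrightarrow> chart_inv c (snd c (?E v0))) (nhds v0)"
    using isCont_tendsto_compose by blast
  moreover have "\<forall>\<^sub>F v in nhds v0. chart_inv c (snd c (?E v)) = ?E v"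
    using close[OF zero_less_one] by eventually_elim (simp add: cA)
  ultimately have "(?E \<longlongrightarrow> ?E v0) (nhds v0)"
    using c E0 by (simp add: tendsto_cong)
  then show "isCont ?E v0" by (simp add: isCont_def tendsto_nhds_iff)
qed

text \<open>Where the geodesic does not exist, its definite description is a constant.\<close>

lemma geodesic_borel_measurable:
  fixes f :: "'a \<Rightarrow> real"
  assumes c0: "c0 \<in> charts_at A p" and f: "\<And>q. isCont f q"
  shows "(\<lambda>v. f (geodesic A g p t (from_components A c0 p v))) \<in> borel_measurable borel"
proof -
  define D where "D = {v. \<exists>J \<gamma>. geodesic_to p (from_components A c0 p v) t J \<gamma>}"
  have "open D"
    unfolding D_def
  proof (subst open_subopen, rule ballI)
    fix v assume "v \<in> {v. \<exists>J \<gamma>. geodesic_to p (from_components A c0 p v) t J \<gamma>}"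
    then have "\<forall>\<^sub>F w in nhds v. \<exists>J \<gamma>. geodesic_to p (from_components A c0 p w) t J \<gamma>"
      using geodesic_isCont(1)[OF c0] by auto
    then show "\<exists>T. open T \<and> v \<in> T \<and> T \<subseteq> {v. \<exists>J \<gamma>. geodesic_to p (from_components A c0 p v) t J \<gamma>}"
      unfolding eventually_nhds by auto
  qed
  have cont: "continuous_on D (\<lambda>v. f (geodesic A g p t (from_components A c0 p v)))"
  proof (rule continuous_at_imp_continuous_on, rule ballI)
    fix v assume "v \<in> D"
    then have "isCont (\<lambda>v. geodesic A g p t (from_components A c0 p v)) v"
      using geodesic_isCont(2)[OF c0] by (auto simp: D_def)
    then show "isCont (\<lambda>v. f (geodesic A g p t (from_components A c0 p v))) v"
      by (rule isCont_o2) (rule f)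
  qed
  have "(\<lambda>v. if v \<in> D then f (geodesic A g p t (from_components A c0 p v)) else f (THE q. False))
      \<in> borel_measurable borel"
    using \<open>open D\<close> cont by (intro borel_measurable_continuous_on_if) auto
  moreover have "geodesic A g p t (from_components A c0 p v) = (THE q. False)" if "v \<notin> D" for v
    using that unfolding geodesic_alt D_def by simp
  then have "(\<lambda>v. if v \<in> D then f (geodesic A g p t (from_components A c0 p v)) else f (THE q. False))
      = (\<lambda>v. f (geodesic A g p t (from_components A c0 p v)))"
    by auto
  ultimately show ?thesis by simp
qed

subsection \<open>Taylor expansion along geodesics\<close>

text \<open>The components of the covariant Hessian, the covariant derivative of the differential of
  \<open>f\<close>.\<close>

definition hessian :: "('a, 'n) chart \<Rightarrow> ('a \<Rightarrow> real) \<Rightarrow> 'n \<Rightarrow> 'n \<Rightarrow> real ^ 'n \<Rightarrow> real" where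
  "hessian c f i j x =
    frechet_derivative (\<lambda>y. frechet_derivative (f \<circ> chart_inv c) (at y) (axis i 1)) (at x) (axis j 1)
    - (\<Sum>k\<in>UNIV. christoffel A g c k i j (chart_inv c x)
        * frechet_derivative (f \<circ> chart_inv c) (at x) (axis k 1))"

definition hessian_form :: "('a, 'n) chart \<Rightarrow> ('a \<Rightarrow> real) \<Rightarrow> (real ^ 'n) \<times> (real ^ 'n) \<Rightarrow> real" where
  "hessian_form c f z = (\<Sum>i\<in>UNIV. \<Sum>j\<in>UNIV. hessian c f i j (fst z) * (snd z $ i * snd z $ j))"

lemma smooth_fun_chart: "smooth_fun A f \<Longrightarrow> c \<in> A \<Longrightarrow> smooth_on (img c) (f \<circ> chart_inv c)"
  by (simp add: smooth_fun_def)

lemma smooth_fun_isCont: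
  fixes f :: "'a \<Rightarrow> real"
  assumes "smooth_fun A f" shows "isCont f q"
proof -
  obtain c where c: "c \<in> charts_at A q" using charts_at_nonempty by blast
  note cA = charts_atD(1)[OF c]
  have "isCont (f \<circ> chart_inv c) (snd c q)"
    using smooth_on_continuous_on[OF smooth_fun_chart[OF assms cA]] c open_img[OF cA]
    by (simp add: continuous_on_eq_continuous_at o_def)
  then have "isCont (\<lambda>q. (f \<circ> chart_inv c) (snd c q)) q"
    using isCont_o2[OF chart_isCont[OF cA charts_atD(2)[OF c]]] by blast
  moreover have ev: "\<forall>\<^sub>F p in nhds q. (f \<circ> chart_inv c) (snd c p) = f p"
    using eventually_nhds_in_open[OF open_dom[OF cA] charts_atD(2)[OF c]]
    by eventually_elim (simp add: cA)
  ultimately show ?thesis using isCont_cong[OF ev] by simp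
qed

lemma continuous_on_hessian:
  assumes "smooth_fun A f" "c \<in> A"
  shows "continuous_on (img c) (hessian c f i j)"
  unfolding hessian_def[abs_def]
  by (rule smooth_on_continuous_on)
    (intro smooth_on_diff smooth_on_sum smooth_on_mult smooth_christoffel smooth_on_frechet_derivative
      smooth_fun_chart assms open_img)

lemma continuous_on_hessian_form:
  assumes "smooth_fun A f" "c \<in> A"
  shows "continuous_on (img c \<times> UNIV) (hessian_form c f)"
proof -
  have "continuous_on (img c \<times> UNIV) (\<lambda>z. hessian c f i j (fst z))" for i j
    by (rule continuous_on_compose2[OF continuous_on_hessian[OF assms]]) (auto intro: continuous_intros)
  then show ?thesis
    unfolding hessian_form_def[abs_def] by (intro continuous_intros)
qed

text \<open>In the second derivative, the acceleration given by the geodesic equation supplies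
  precisely the Christoffel term of the covariant Hessian.\<close>

lemma derivative_along_solution:
  assumes f: "smooth_fun A f" and c: "c \<in> A" and x: "fst (\<phi> t) \<in> img c"
    and \<phi>: "(\<phi> has_vector_derivative spray c (\<phi> t)) (at t)"
  shows "((\<lambda>t. (f \<circ> chart_inv c) (fst (\<phi> t))) has_real_derivative
      (\<Sum>i\<in>UNIV. snd (\<phi> t) $ i * frechet_derivative (f \<circ> chart_inv c) (at (fst (\<phi> t))) (axis i 1))) (at t)"
    and "((\<lambda>t. \<Sum>i\<in>UNIV. snd (\<phi> t) $ i * frechet_derivative (f \<circ> chart_inv c) (at (fst (\<phi> t))) (axis i 1))
      has_real_derivative hessian_form c f (\<phi> t)) (at t)"
proof -
  let ?F = "f \<circ> chart_inv c"
  let ?x = "fst (\<phi> t)" and ?v = "snd (\<phi> t)"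
  have sm: "smooth_on (img c) ?F" by (rule smooth_fun_chart[OF f c])
  have xd: "((\<lambda>t. fst (\<phi> t)) has_vector_derivative ?v) (at t)"
    and vd: "((\<lambda>t. snd (\<phi> t)) has_vector_derivative acceleration c ?x ?v) (at t)"
    using bounded_linear.has_vector_derivative[OF bounded_linear_fst \<phi>]
      bounded_linear.has_vector_derivative[OF bounded_linear_snd \<phi>] by (simp_all add: spray_def)
  have chain: "((\<lambda>t. h (fst (\<phi> t))) has_real_derivative
      (\<Sum>i\<in>UNIV. ?v $ i * frechet_derivative h (at ?x) (axis i 1))) (at t)"
    if "smooth_on (img c) h" for h :: "real ^ 'n \<Rightarrow> real"
  proof -
    have D: "(h has_derivative frechet_derivative h (at ?x)) (at ?x)"
      by (rule smooth_on_has_derivative[OF that x])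
    have "((\<lambda>t. h (fst (\<phi> t))) has_derivative (\<lambda>s. frechet_derivative h (at ?x) (s *\<^sub>R ?v))) (at t)"
      using diff_chain_at[OF xd[unfolded has_vector_derivative_def] D] by (simp add: o_def)
    then have "((\<lambda>t. h (fst (\<phi> t))) has_real_derivative frechet_derivative h (at ?x) ?v) (at t)"
      by (rule has_derivative_imp_has_field_derivative)
        (simp add: linear_scale[OF has_derivative_linear[OF D]])
    also have "frechet_derivative h (at ?x) ?v = (\<Sum>i\<in>UNIV. ?v $ i * frechet_derivative h (at ?x) (axis i 1))"
      using linear_axis_sum[OF has_derivative_linear[OF D], of ?v] by simp
    finally show ?thesis .
  qed
  show "((\<lambda>t. ?F (fst (\<phi> t))) has_real_derivative
      (\<Sum>i\<in>UNIV. ?v $ i * frechet_derivative ?F (at ?x) (axis i 1))) (at t)"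
    by (rule chain[OF sm])
  let ?dF = "\<lambda>i y. frechet_derivative ?F (at y) (axis i 1)"
  have "((\<lambda>t. snd (\<phi> t) $ i) has_real_derivative acceleration c ?x ?v $ i) (at t)" for i
    using bounded_linear.has_vector_derivative[OF bounded_linear_vec_nth vd]
    by (simp add: has_real_derivative_iff_has_vector_derivative)
  then have "((\<lambda>t. \<Sum>i\<in>UNIV. snd (\<phi> t) $ i * ?dF i (fst (\<phi> t))) has_real_derivative
      (\<Sum>i\<in>UNIV. acceleration c ?x ?v $ i * ?dF i ?x
        + (\<Sum>j\<in>UNIV. ?v $ j * frechet_derivative (?dF i) (at ?x) (axis j 1)) * ?v $ i)) (at t)"
    by (intro DERIV_sum DERIV_mult chain smooth_on_frechet_derivative sm)
  also have "(\<Sum>i\<in>UNIV. acceleration c ?x ?v $ i * ?dF i ?x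
        + (\<Sum>j\<in>UNIV. ?v $ j * frechet_derivative (?dF i) (at ?x) (axis j 1)) * ?v $ i)
      = hessian_form c f (\<phi> t)"
  proof -
    have "(\<Sum>k\<in>UNIV. acceleration c ?x ?v $ k * ?dF k ?x)
      = - (\<Sum>k\<in>UNIV. \<Sum>i\<in>UNIV. \<Sum>j\<in>UNIV. christoffel A g c k i j (chart_inv c ?x) * ?dF k ?x * (?v $ i * ?v $ j))"
      by (simp add: acceleration_def sum_distrib_left sum_distrib_right sum_negf mult_ac)
    also have "\<dots> = - (\<Sum>i\<in>UNIV. \<Sum>k\<in>UNIV. \<Sum>j\<in>UNIV. christoffel A g c k i j (chart_inv c ?x) * ?dF k ?x * (?v $ i * ?v $ j))"
      by (intro arg_cong[of _ _ uminus] sum.swap)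
    also have "\<dots> = - (\<Sum>i\<in>UNIV. \<Sum>j\<in>UNIV. \<Sum>k\<in>UNIV. christoffel A g c k i j (chart_inv c ?x) * ?dF k ?x * (?v $ i * ?v $ j))"
      by (intro arg_cong[of _ _ uminus] sum.cong refl sum.swap)
    finally have "(\<Sum>k\<in>UNIV. acceleration c ?x ?v $ k * ?dF k ?x)
      = - (\<Sum>i\<in>UNIV. \<Sum>j\<in>UNIV. \<Sum>k\<in>UNIV. christoffel A g c k i j (chart_inv c ?x) * ?dF k ?x * (?v $ i * ?v $ j))" .
    moreover have "hessian_form c f (\<phi> t)
      = (\<Sum>i\<in>UNIV. \<Sum>j\<in>UNIV. frechet_derivative (?dF i) (at ?x) (axis j 1) * (?v $ i * ?v $ j))
      - (\<Sum>i\<in>UNIV. \<Sum>j\<in>UNIV. \<Sum>k\<in>UNIV. christoffel A g c k i j (chart_inv c ?x) * ?dF k ?x * (?v $ i * ?v $ j))"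
      by (simp only: hessian_form_def hessian_def left_diff_distrib sum_subtractf sum_distrib_right)
    moreover have "(\<Sum>i\<in>UNIV. (\<Sum>j\<in>UNIV. ?v $ j * frechet_derivative (?dF i) (at ?x) (axis j 1)) * ?v $ i)
      = (\<Sum>i\<in>UNIV. \<Sum>j\<in>UNIV. frechet_derivative (?dF i) (at ?x) (axis j 1) * (?v $ i * ?v $ j))"
      by (simp add: sum_distrib_left sum_distrib_right mult_ac)
    ultimately show ?thesis by (simp only: sum.distrib)
  qed
  finally show "((\<lambda>t. \<Sum>i\<in>UNIV. snd (\<phi> t) $ i * ?dF i (fst (\<phi> t)))
      has_real_derivative hessian_form c f (\<phi> t)) (at t)" .
qed

text \<open>Taylor's formula with Lagrange remainder, so the Hessian is evaluated at an intermediate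
  state, still to be compared with the initial one.\<close>

lemma taylor_along_solution:
  assumes f: "smooth_fun A f" and c: "c \<in> A" and t: "0 < t" "t < \<tau>"
    and x: "\<And>s. \<bar>s\<bar> < \<tau> \<Longrightarrow> fst (\<phi> s) \<in> img c"
    and \<phi>: "\<And>s. \<bar>s\<bar> < \<tau> \<Longrightarrow> (\<phi> has_vector_derivative spray c (\<phi> s)) (at s)"
  obtains \<theta> where "0 < \<theta>" "\<theta> \<le> t" "(f \<circ> chart_inv c) (fst (\<phi> t)) = (f \<circ> chart_inv c) (fst (\<phi> 0))
    + t * (\<Sum>i\<in>UNIV. snd (\<phi> 0) $ i * frechet_derivative (f \<circ> chart_inv c) (at (fst (\<phi> 0))) (axis i 1))
    + t\<^sup>2 / 2 * hessian_form c f (\<phi> \<theta>)"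
proof -
  define D where "D m = (if m = 0 then (\<lambda>t. (f \<circ> chart_inv c) (fst (\<phi> t)))
    else if m = 1 then (\<lambda>t. \<Sum>i\<in>UNIV. snd (\<phi> t) $ i * frechet_derivative (f \<circ> chart_inv c) (at (fst (\<phi> t))) (axis i 1))
    else (\<lambda>t. hessian_form c f (\<phi> t)))" for m :: nat
  have "\<forall>m s. m < 2 \<and> 0 \<le> s \<and> s \<le> t \<longrightarrow> DERIV (D m) s :> D (Suc m) s"
  proof (intro allI impI)
    fix m :: nat and s :: real assume a: "m < 2 \<and> 0 \<le> s \<and> s \<le> t"
    then have s: "\<bar>s\<bar> < \<tau>" using t by auto
    show "DERIV (D m) s :> D (Suc m) s"
      using derivative_along_solution[OF f c x[OF s] \<phi>[OF s]] a
      by (cases "m = 0") (auto simp: D_def less_2_cases_iff)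
  qed
  from Maclaurin2[OF t(1) refl this] obtain \<theta> where "0 < \<theta>" "\<theta> \<le> t"
    "D 0 t = (\<Sum>m<2. D m 0 / fact m * t ^ m) + D 2 \<theta> / fact 2 * t ^ 2" by blast
  then show ?thesis
    by (intro that[of \<theta>]) (simp_all add: D_def numeral_2_eq_2 mult_ac)
qed

text \<open>By time \<theta> the state has moved by at most \<open>B * \<theta>\<close>, so for
  short times the intermediate and the initial state are within the modulus of uniform continuity of
  the Hessian form on \<open>?K\<close>. The flow box makes \<tau> and \<open>B\<close> the same for
  all starting states.\<close>

lemma geodesic_taylor_uniform:
  assumes f: "smooth_fun A f" and c: "c \<in> A" and r: "r > 0" "cball x0 (2 * r) \<subseteq> img c" and e: "e > 0"
  obtains \<delta> where "\<delta> > 0" "\<And>p v t. c \<in> charts_at A p \<Longrightarrow> snd c p \<in> cball x0 r \<Longrightarrow> norm v \<le> R \<Longrightarrow> 0 < t \<Longrightarrow> t < \<delta> \<Longrightarrow>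
    \<bar>f (geodesic A g p t (from_components A c p v)) - f p
      - t * (\<Sum>i\<in>UNIV. v $ i * frechet_derivative (f \<circ> chart_inv c) (at (snd c p)) (axis i 1))
      - t\<^sup>2 / 2 * hessian_form c f (snd c p, v)\<bar> \<le> t\<^sup>2 / 2 * e"
proof -
  let ?Z = "cball x0 r \<times> cball (0 :: real ^ 'n) R"
  let ?K = "cball x0 (2 * r) \<times> cball (0 :: real ^ 'n) (R + r)"
  obtain \<tau> B \<Phi> \<Gamma> where box: "\<tau> > 0" "B \<ge> 0"
    "\<And>z t. z \<in> ?Z \<Longrightarrow> \<bar>t\<bar> < \<tau> \<Longrightarrow> \<Phi> z t \<in> ?K"
    "\<And>z. z \<in> ?Z \<Longrightarrow> \<Phi> z 0 = z"
    "\<And>z t. z \<in> ?Z \<Longrightarrow> \<bar>t\<bar> < \<tau> \<Longrightarrow> (\<Phi> z has_vector_derivative spray c (\<Phi> z t)) (at t)"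
    "\<And>z t. z \<in> ?Z \<Longrightarrow> \<bar>t\<bar> < \<tau> \<Longrightarrow> dist (\<Phi> z t) z \<le> B * \<bar>t\<bar>"
    "\<And>z s. z \<in> ?Z \<Longrightarrow> is_geodesic A g {s - \<tau><..<s + \<tau>} (\<Gamma> z s)"
    "\<And>z s u. z \<in> ?Z \<Longrightarrow> u \<in> {s - \<tau><..<s + \<tau>} \<Longrightarrow>
      c \<in> charts_at A (\<Gamma> z s u) \<and> state c (\<Gamma> z s) u = \<Phi> z (u - s)"
    by (rule geodesic_flow_box[OF c r, of R]) (rule that; assumption)
  have "?K \<subseteq> img c \<times> UNIV" using r(2) by auto
  then have "uniformly_continuous_on ?K (hessian_form c f)"
    by (intro compact_uniformly_continuous continuous_on_subset[OF continuous_on_hessian_form[OF f c]] compact_Times)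
      auto
  then obtain d where d: "d > 0"
    "\<And>z w. z \<in> ?K \<Longrightarrow> w \<in> ?K \<Longrightarrow> dist w z < d \<Longrightarrow> dist (hessian_form c f w) (hessian_form c f z) < e"
    using e unfolding uniformly_continuous_on_def by meson
  define \<delta> where "\<delta> = min \<tau> (d / (B + 1))"
  have \<delta>: "\<delta> > 0" using box(1,2) d(1) by (simp add: \<delta>_def)
  show ?thesis
  proof (rule that[OF \<delta>])
    fix p and v :: "real ^ 'n" and t :: real
    assume p: "c \<in> charts_at A p" "snd c p \<in> cball x0 r" and v: "norm v \<le> R" and t: "0 < t" "t < \<delta>"
    define z where "z = (snd c p, v)"
    have z: "z \<in> ?Z" using p v by (simp add: z_def)
    have tt: "t < \<tau>" using t by (simp add: \<delta>_def)
    define \<gamma> where "\<gamma> = \<Gamma> z 0"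
    have \<gamma>: "is_geodesic A g {-\<tau><..<\<tau>} \<gamma>" using box(7)[OF z, of 0] by (simp add: \<gamma>_def)
    have st: "c \<in> charts_at A (\<gamma> u)" "state c \<gamma> u = \<Phi> z u" if "\<bar>u\<bar> < \<tau>" for u
      using box(8)[OF z, of u 0] that by (auto simp: \<gamma>_def abs_less_iff)
    have eq: "\<gamma> u = chart_inv c (fst (\<Phi> z u))" if "\<bar>u\<bar> < \<tau>" for u
      using st[OF that] c by (simp add: state_def flip: st(2)[OF that])
    have st0: "state c \<gamma> 0 = (snd c p, v)" using st(2)[of 0] box(1) box(4)[OF z] by (simp add: z_def)
    have \<gamma>0: "\<gamma> 0 = p" using eq[of 0] box(1) box(4)[OF z] p(1) by (simp add: z_def)
    have "geodesic_to p (from_components A c p v) t {-\<tau><..<\<tau>} \<gamma>"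
      using is_geodesic_velocity[OF _ \<gamma>, of 0 c] st0 \<gamma>0 \<gamma> box(1) tt t(1) p(1)
      by (simp add: geodesic_to_def is_interval_oo)
    then have E: "f (geodesic A g p t (from_components A c p v)) = (f \<circ> chart_inv c) (fst (\<Phi> z t))"
      using eq[of t] tt t(1) by (simp add: geodesic_eqI)
    have "fst (\<Phi> z s) \<in> img c" if "\<bar>s\<bar> < \<tau>" for s
      using box(3)[OF z that] r(2) by (auto simp: mem_Times_iff)
    from taylor_along_solution[OF f c t(1) tt this box(5)[OF z]]
    obtain \<theta> where \<theta>: "0 < \<theta>" "\<theta> \<le> t" "(f \<circ> chart_inv c) (fst (\<Phi> z t)) = (f \<circ> chart_inv c) (fst (\<Phi> z 0))
      + t * (\<Sum>i\<in>UNIV. snd (\<Phi> z 0) $ i * frechet_derivative (f \<circ> chart_inv c) (at (fst (\<Phi> z 0))) (axis i 1))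
      + t\<^sup>2 / 2 * hessian_form c f (\<Phi> z \<theta>)" by blast
    have \<theta>\<tau>: "\<bar>\<theta>\<bar> < \<tau>" using \<theta> tt by simp
    have "dist (\<Phi> z \<theta>) z \<le> B * \<theta>" using box(6)[OF z \<theta>\<tau>] \<theta>(1) by simp
    also have "\<dots> \<le> (B + 1) * t" using box(2) \<theta> by (intro mult_mono) auto
    also have "\<dots> < d" using t box(2) by (simp add: \<delta>_def field_simps)
    finally have "dist (hessian_form c f (\<Phi> z \<theta>)) (hessian_form c f z) < e"
      using d(2)[of z "\<Phi> z \<theta>"] box(3)[OF z \<theta>\<tau>] box(3)[OF z, of 0] box(1) box(4)[OF z] by simp
    then have "\<bar>t\<^sup>2 / 2 * (hessian_form c f (\<Phi> z \<theta>) - hessian_form c f z)\<bar> \<le> t\<^sup>2 / 2 * e"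
      unfolding abs_mult by (intro mult_mono) (auto simp: dist_real_def)
    moreover have "(f \<circ> chart_inv c) (fst z) = f p" using p(1) by (simp add: z_def)
    ultimately show "\<bar>f (geodesic A g p t (from_components A c p v)) - f p
      - t * (\<Sum>i\<in>UNIV. v $ i * frechet_derivative (f \<circ> chart_inv c) (at (snd c p)) (axis i 1))
      - t\<^sup>2 / 2 * hessian_form c f (snd c p, v)\<bar> \<le> t\<^sup>2 / 2 * e"
      unfolding E \<theta>(3) box(4)[OF z] by (simp add: right_diff_distrib) (simp add: z_def)
  qed
qed

text \<open>The metric attains a positive minimum \<open>m\<close> on pairs of a point of
  \<open>K\<close> and a Euclidean unit vector. By homogeneity, m|v|^2 bounds the squared Riemannian
  length from below.\<close>

lemma components_bounded:
  assumes c: "c \<in> A" and K: "compact K" "K \<subseteq> img c"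
  shows "\<exists>R. \<forall>p \<eta>. c \<in> charts_at A p \<longrightarrow> snd c p \<in> K \<longrightarrow> \<eta> \<in> tangent_space A p \<longrightarrow>
    tangent_norm g p \<eta> \<le> C \<longrightarrow> norm (tvec_components A c p \<eta>) \<le> R"
proof (cases "K = {}")
  case False
  let ?S = "K \<times> sphere (0 :: real ^ 'n) 1"
  have "continuous_on ?S (\<lambda>z. gmat c (fst z) $ i $ j)" for i j
    by (rule continuous_on_compose2[OF smooth_on_continuous_on[OF smooth_gmat[OF c]]])
      (use K(2) in \<open>auto intro: continuous_intros\<close>)
  moreover have "continuous_on ?S (\<lambda>z. snd z $ i)" for i :: 'n
    by (intro continuous_intros)
  ultimately have "continuous_on ?S (\<lambda>z. gform c (snd z) (snd z) (fst z))"
    unfolding gform_def by (intro continuous_on_sum continuous_on_mult)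
  moreover have "compact ?S" using K(1) by (intro compact_Times) auto
  moreover have "?S \<noteq> {}" using False by auto
  ultimately obtain z where z: "z \<in> ?S"
    "\<And>w. w \<in> ?S \<Longrightarrow> gform c (snd z) (snd z) (fst z) \<le> gform c (snd w) (snd w) (fst w)"
    using continuous_attains_inf[of ?S "\<lambda>z. gform c (snd z) (snd z) (fst z)"] by blast
  define m where "m = gform c (snd z) (snd z) (fst z)"
  have m: "m > 0" unfolding m_def using z(1) K(2) by (intro gform_pos[OF c]) auto
  have scale: "gform c (a *\<^sub>R v) (a *\<^sub>R v) x = a\<^sup>2 * gform c v v x" for a v x
    by (simp add: gform_def sum_distrib_left power2_eq_square mult_ac)
  have low: "m * (norm v)\<^sup>2 \<le> gform c v v x" if "x \<in> K" for x v
  proof (cases "v = 0")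
    case True
    then show ?thesis by (simp add: gform_def)
  next
    case False
    have "gform c v v x = (norm v)\<^sup>2 * gform c (v /\<^sub>R norm v) (v /\<^sub>R norm v) x"
      using False by (simp add: scale field_simps)
    moreover have "m \<le> gform c (v /\<^sub>R norm v) (v /\<^sub>R norm v) x"
      using z(2)[of "(x, v /\<^sub>R norm v)"] that False by (simp add: m_def)
    ultimately show ?thesis by (simp add: mult.commute[of m] mult_left_mono)
  qed
  show ?thesis
  proof (intro exI[of _ "\<bar>C\<bar> / sqrt m"] allI impI)
    fix p \<eta> assume p: "c \<in> charts_at A p" "snd c p \<in> K" and \<eta>: "\<eta> \<in> tangent_space A p" "tangent_norm g p \<eta> \<le> C"
    let ?v = "tvec_components A c p \<eta>"
    have g: "g p \<eta> \<eta> = gform c ?v ?v (snd c p)"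
      using metric_from_components[OF p(1), of ?v ?v] from_components_tvec_components[OF p(1) \<eta>(1)] by simp
    have "sqrt m * norm ?v = sqrt (m * (norm ?v)\<^sup>2)" using m by (simp add: real_sqrt_mult)
    also have "\<dots> \<le> sqrt (gform c ?v ?v (snd c p))" using low[OF p(2)] by simp
    also have "\<dots> \<le> \<bar>C\<bar>" using \<eta>(2) g by (simp add: tangent_norm_def)
    finally show "norm ?v \<le> \<bar>C\<bar> / sqrt m" using m by (simp add: field_simps)
  qed
qed auto

end

subsection \<open>Integration over tangent spaces\<close>

context smooth_manifold
begin

text \<open>In any other chart the image of this set is the preimage of \<open>S\<close> under the
  linear change of components.\<close>

lemma tangent_open_vimage:
  assumes c: "c \<in> charts_at A p" and S: "open S"
  shows "tangent_open A p (tvec_components A c p -` S \<inter> tangent_space A p)" (is "tangent_open A p ?W")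
  unfolding tangent_open_def
proof (intro conjI ballI)
  fix d assume d: "d \<in> charts_at A p"
  let ?M = "frechet_derivative (transition d c) (at (snd d p))"
  have M: "tvec_components A c p (from_components A d p w) = ?M w" for w
    using from_components_transition[OF d c] c by simp
  have "tvec_components A d p ` ?W = ?M -` S"
  proof (intro set_eqI iffI)
    fix w assume "w \<in> tvec_components A d p ` ?W"
    then obtain \<eta> where "\<eta> \<in> ?W" "w = tvec_components A d p \<eta>" by blast
    then show "w \<in> ?M -` S" using M[of w] from_components_tvec_components[OF d, of \<eta>] by simp
  next
    fix w assume "w \<in> ?M -` S"
    then have "from_components A d p w \<in> ?W" using M[of w] d by simp
    then show "w \<in> tvec_components A d p ` ?W" using d by (intro image_eqI) auto
  qed
  moreover have "continuous_on UNIV ?M"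
    using has_derivative_bounded_linear[OF transition_has_derivative[OF d c]]
    by (rule linear_continuous_on)
  ultimately show "open (tvec_components A d p ` ?W)" using S by (simp add: open_vimage)
qed simp

lemma sets_tangent_borel: "tangent_open A p W \<Longrightarrow> W \<in> sets (tangent_borel A p)"
  and space_tangent_borel: "space (tangent_borel A p) = tangent_space A p"
proof -
  have sub: "{W. tangent_open A p W} \<subseteq> Pow (tangent_space A p)" by (auto simp: tangent_open_def)
  show "tangent_open A p W \<Longrightarrow> W \<in> sets (tangent_borel A p)"
    unfolding tangent_borel_def sets_measure_of[OF sub] by (rule sigma_sets.Basic) simp
  show "space (tangent_borel A p) = tangent_space A p"
    unfolding tangent_borel_def by (rule space_measure_of[OF sub])
qed

lemma tvec_components_measurable:
  assumes c: "c \<in> charts_at A p" and M: "sets M = sets (tangent_borel A p)"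
  shows "tvec_components A c p \<in> borel_measurable M"
proof (rule borel_measurableI)
  fix S :: "(real ^ 'n) set" assume "open S"
  then show "tvec_components A c p -` S \<inter> space M \<in> sets M"
    using sets_tangent_borel[OF tangent_open_vimage[OF c]] sets_eq_imp_space_eq[OF M] M
    by (simp add: space_tangent_borel)
qed

text \<open>Every vector outside the support has an open null neighbourhood. The union of all these
  could be uncountable; Lindelof's theorem in coordinates reduces it to countably many null
  sets.\<close>

lemma AE_in_support:
  assumes M: "sets M = sets (tangent_borel A p)"
  shows "AE \<eta> in M. \<eta> \<in> support A p M"
proof -
  obtain c where c: "c \<in> charts_at A p" using charts_at_nonempty by blast
  let ?\<psi> = "tvec_components A c p"
  have sp: "space M = tangent_space A p"
    using sets_eq_imp_space_eq[OF M] by (simp add: space_tangent_borel)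
  define F where "F = {S. open S \<and> emeasure M (?\<psi> -` S \<inter> tangent_space A p) = 0}"
  obtain F' where F': "F' \<subseteq> F" "countable F'" "\<Union>F' = \<Union>F"
    by (rule Lindelof[of F]) (auto simp: F_def)
  have "(\<Union>S\<in>F'. ?\<psi> -` S \<inter> tangent_space A p) \<in> null_sets M"
  proof (rule null_sets_UN'[OF F'(2)])
    fix S assume "S \<in> F'"
    then have "open S" "emeasure M (?\<psi> -` S \<inter> tangent_space A p) = 0" using F'(1) by (auto simp: F_def)
    then show "?\<psi> -` S \<inter> tangent_space A p \<in> null_sets M"
      using sets_tangent_borel[OF tangent_open_vimage[OF c]] M by (intro null_setsI) auto
  qed
  moreover have "{\<eta> \<in> space M. \<eta> \<notin> support A p M} \<subseteq> (\<Union>S\<in>F'. ?\<psi> -` S \<inter> tangent_space A p)"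
  proof
    fix \<eta> assume "\<eta> \<in> {\<eta> \<in> space M. \<eta> \<notin> support A p M}"
    then obtain W where W: "\<eta> \<in> tangent_space A p" "tangent_open A p W" "\<eta> \<in> W" "emeasure M W = 0"
      using sp by (auto simp: support_def not_gr_zero)
    \<comment> \<open>Injectivity of the components makes the null neighbourhood \<open>W\<close>
      the preimage of an open set of coordinates, hence a member of the family \<open>F\<close>
      covers it.\<close>
    have "?\<psi> -` (?\<psi> ` W) \<inter> tangent_space A p = W"
    proof -
      have "W \<subseteq> tangent_space A p" using W(2) by (simp add: tangent_open_def)
      moreover have "inj_on ?\<psi> (tangent_space A p)"
        using from_components_tvec_components[OF c] by (metis inj_on_inverseI)
      ultimately show ?thesis by (auto dest: inj_onD)
    qed
    then have "?\<psi> ` W \<in> F" using W c by (simp add: F_def tangent_open_def)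
    then have "?\<psi> \<eta> \<in> \<Union>F'" using W(3) F'(3) by blast
    then show "\<eta> \<in> (\<Union>S\<in>F'. ?\<psi> -` S \<inter> tangent_space A p)" using W(1) by blast
  qed
  ultimately show ?thesis by (rule AE_I'[of _ M])
qed

end

context riemannian_manifold
begin

text \<open>The integrand is split into the Taylor polynomial \<open>P\<close>, whose integral is
  given by the moments, and the error \<open>E\<close>, bounded by \<open>b\<close> almost
  everywhere. The bound on components over the support gives integrability, since the measure is
  finite.\<close>

lemma integral_geodesic_increment:
  assumes f: "smooth_fun A f" and c: "c \<in> charts_at A p"
    and M: "sets M = sets (tangent_borel A p)" "finite_measure M"
    and R: "\<And>\<eta>. \<eta> \<in> support A p M \<Longrightarrow> norm (tvec_components A c p \<eta>) \<le> R"
    and m1: "\<And>i. (LINT \<eta>|M. tvec_components A c p \<eta> $ i) = 0"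
    and m2: "\<And>i j. (LINT \<eta>|M. tvec_components A c p \<eta> $ i * tvec_components A c p \<eta> $ j)
      = inverse_metric A g c p $ i $ j"
    and est: "\<And>v. norm v \<le> R \<Longrightarrow> \<bar>f (geodesic A g p t (from_components A c p v)) - f p
      - t * (\<Sum>i\<in>UNIV. v $ i * a i) - t\<^sup>2 / 2 * hessian_form c f (snd c p, v)\<bar> \<le> b"
  shows "\<bar>(LINT \<eta>|M. f (geodesic A g p t \<eta>) - f p)
    - t\<^sup>2 / 2 * (\<Sum>i\<in>UNIV. \<Sum>j\<in>UNIV. hessian c f i j (snd c p) * inverse_metric A g c p $ i $ j)\<bar>
    \<le> b * measure M (space M)"
proof -
  interpret finite_measure M by (rule M(2))
  let ?\<psi> = "tvec_components A c p"
  have sp: "space M = tangent_space A p"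
    using sets_eq_imp_space_eq[OF M(1)] by (simp add: space_tangent_borel)
  have \<psi>[measurable]: "?\<psi> \<in> borel_measurable M" by (rule tvec_components_measurable[OF c M(1)])
  have \<psi>n[measurable]: "(\<lambda>\<eta>. ?\<psi> \<eta> $ i) \<in> borel_measurable M" for i
    by (rule borel_measurable_continuous_on[OF _ \<psi>]) (intro continuous_intros)
  have bd: "AE \<eta> in M. norm (?\<psi> \<eta>) \<le> R"
    using AE_in_support[OF M(1)] by eventually_elim (rule R)
  have comp: "\<bar>?\<psi> \<eta> $ i\<bar> \<le> R" if "norm (?\<psi> \<eta>) \<le> R" for \<eta> i
    using component_le_norm_cart[of "?\<psi> \<eta>" i] that by linarith
  have i1: "integrable M (\<lambda>\<eta>. ?\<psi> \<eta> $ i)" for i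
    by (rule integrable_const_bound[of _ R]) (use bd in \<open>auto elim!: eventually_mono intro: comp\<close>)
  have i2: "integrable M (\<lambda>\<eta>. ?\<psi> \<eta> $ i * ?\<psi> \<eta> $ j)" for i j
    by (rule integrable_const_bound[of _ "R * R"])
      (use bd in \<open>auto elim!: eventually_mono intro!: mult_mono' comp simp: abs_mult\<close>)
  define P where "P \<eta> = t * (\<Sum>i\<in>UNIV. ?\<psi> \<eta> $ i * a i) + t\<^sup>2 / 2 * hessian_form c f (snd c p, ?\<psi> \<eta>)" for \<eta>
  have iP: "integrable M P"
    unfolding P_def[abs_def] hessian_form_def
    by (intro Bochner_Integration.integrable_add integrable_mult_right integrable_mult_left
        Bochner_Integration.integrable_sum i1) (simp add: i2)
  have PI: "(LINT \<eta>|M. P \<eta>) = t\<^sup>2 / 2 * (\<Sum>i\<in>UNIV. \<Sum>j\<in>UNIV. hessian c f i j (snd c p) * inverse_metric A g c p $ i $ j)"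
    by (simp add: P_def hessian_form_def i1 i2 m1 m2)
  define E where "E \<eta> = f (geodesic A g p t \<eta>) - f p - P \<eta>" for \<eta>
  have "(\<lambda>\<eta>. f (geodesic A g p t (from_components A c p (?\<psi> \<eta>)))) \<in> borel_measurable M"
    using measurable_compose[OF \<psi> geodesic_borel_measurable[OF c smooth_fun_isCont[OF f]]] .
  then have mf: "(\<lambda>\<eta>. f (geodesic A g p t \<eta>)) \<in> borel_measurable M"
    by (rule measurable_cong[THEN iffD1, rotated]) (simp add: sp from_components_tvec_components[OF c])
  then have mE: "E \<in> borel_measurable M"
    unfolding E_def[abs_def] using borel_measurable_integrable[OF iP] by measurable
  have Eb: "AE \<eta> in M. norm (E \<eta>) \<le> b"
    using bd AE_space
  proof eventually_elim
    case (elim \<eta>)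
    then show ?case
      using est[OF elim(1)] from_components_tvec_components[OF c, of \<eta>] sp
      by (simp add: E_def P_def diff_diff_eq)
  qed
  have iE: "integrable M E" by (rule integrable_const_bound[OF Eb mE])
  have "(LINT \<eta>|M. f (geodesic A g p t \<eta>) - f p) = (LINT \<eta>|M. E \<eta> + P \<eta>)" by (simp add: E_def)
  also have "\<dots> = (LINT \<eta>|M. E \<eta>) + (LINT \<eta>|M. P \<eta>)" by (rule Bochner_Integration.integral_add[OF iE iP])
  finally have "(LINT \<eta>|M. f (geodesic A g p t \<eta>) - f p)
    - t\<^sup>2 / 2 * (\<Sum>i\<in>UNIV. \<Sum>j\<in>UNIV. hessian c f i j (snd c p) * inverse_metric A g c p $ i $ j)
    = (LINT \<eta>|M. E \<eta>)" by (simp add: PI)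
  moreover have "\<bar>LINT \<eta>|M. E \<eta>\<bar> \<le> (LINT \<eta>|M. norm (E \<eta>))"
    using integral_norm_bound[of M E] by simp
  moreover have "(LINT \<eta>|M. norm (E \<eta>)) \<le> (LINT \<eta>|M. b)"
    using iE Eb by (intro integral_mono_AE) auto
  moreover have "(LINT \<eta>|M. b) = b * measure M (space M)" by simp
  ultimately show ?thesis by linarith
qed

subsection \<open>The Laplace--Beltrami operator as the trace of the Hessian\<close>

abbreviation ginv :: "('a, 'n) chart \<Rightarrow> real ^ 'n \<Rightarrow> real ^ 'n ^ 'n" where
  "ginv c x \<equiv> matrix_inv (gmat c x)"

context
  fixes c x assumes c: "c \<in> A" and x: "x \<in> img c"
begin

lemma ginv_sym: "ginv c x $ i $ j = ginv c x $ j $ i"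
proof -
  have G: "transpose (gmat c x) = gmat c x"
    by (simp add: transpose_def vec_eq_iff gmat_sym[OF c x])
  have I: "gmat c x ** ginv c x = mat 1" by (rule matrix_inv_mult[OF det_gmat[OF c x]])
  have "transpose (ginv c x) ** gmat c x = transpose (gmat c x ** ginv c x)"
    by (simp add: matrix_transpose_mul G)
  then have "transpose (ginv c x) ** gmat c x = mat 1" by (simp add: I)
  then have "transpose (ginv c x) ** (gmat c x ** ginv c x) = ginv c x"
    by (simp add: matrix_mul_assoc)
  then have "transpose (ginv c x) = ginv c x" by (simp add: I)
  then have "transpose (ginv c x) $ j $ i = ginv c x $ j $ i" by simp
  then show ?thesis by (simp add: transpose_def)
qed

text \<open>Differentiate the identity of the metric matrix times its inverse with
  \<open>mat 1\<close>, then multiply by the inverse from the left.\<close>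

lemma frechet_derivative_ginv:
  "frechet_derivative (\<lambda>x. ginv c x $ i $ j) (at x) h
    = - (\<Sum>a\<in>UNIV. \<Sum>b\<in>UNIV. ginv c x $ i $ a
        * frechet_derivative (\<lambda>x. gmat c x $ a $ b) (at x) h * ginv c x $ b $ j)"
proof -
  let ?DG = "\<lambda>a b. frechet_derivative (\<lambda>x. gmat c x $ a $ b) (at x)"
  let ?DI = "\<lambda>a b. frechet_derivative (\<lambda>x. ginv c x $ a $ b) (at x)"
  have zero: "(\<Sum>b\<in>UNIV. gmat c x $ a $ b * ?DI b j h) = - (\<Sum>b\<in>UNIV. ?DG a b h * ginv c x $ b $ j)" for a
  proof -
    have "((\<lambda>y. \<Sum>b\<in>UNIV. gmat c y $ a $ b * ginv c y $ b $ j) has_derivative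
      (\<lambda>h. \<Sum>b\<in>UNIV. gmat c x $ a $ b * ?DI b j h + ?DG a b h * ginv c x $ b $ j)) (at x)"
      by (intro has_derivative_sum has_derivative_mult smooth_on_has_derivative[OF _ x]
          smooth_gmat[OF c] smooth_gmat_inv[OF c])
    then have "((\<lambda>y. (mat 1 :: real ^ 'n ^ 'n) $ a $ j) has_derivative
      (\<lambda>h. \<Sum>b\<in>UNIV. gmat c x $ a $ b * ?DI b j h + ?DG a b h * ginv c x $ b $ j)) (at x)"
    proof (rule has_derivative_transform_within_open[OF _ open_img[OF c] x])
      fix y assume "y \<in> img c"
      from matrix_inv_mult(1)[OF det_gmat[OF c this]]
      have "(gmat c y ** ginv c y) $ a $ j = (mat 1 :: real ^ 'n ^ 'n) $ a $ j" by simp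
      then show "(\<Sum>b\<in>UNIV. gmat c y $ a $ b * ginv c y $ b $ j) = (mat 1 :: real ^ 'n ^ 'n) $ a $ j"
        by (simp add: matrix_matrix_mult_def)
    qed
    from has_derivative_unique[OF this has_derivative_const]
    have "(\<Sum>b\<in>UNIV. gmat c x $ a $ b * ?DI b j h + ?DG a b h * ginv c x $ b $ j) = 0" by meson
    then show ?thesis by (simp add: sum.distrib eq_neg_iff_add_eq_0)
  qed
  have "?DI i j h = (\<Sum>b\<in>UNIV. (ginv c x ** gmat c x) $ i $ b * ?DI b j h)"
    by (simp add: matrix_inv_mult[OF det_gmat[OF c x]] mat_def if_distrib[of "\<lambda>x. x * _"] cong: if_cong)
  also have "\<dots> = (\<Sum>b\<in>UNIV. \<Sum>a\<in>UNIV. ginv c x $ i $ a * (gmat c x $ a $ b * ?DI b j h))"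
    by (simp add: matrix_matrix_mult_def sum_distrib_right mult.assoc)
  also have "\<dots> = (\<Sum>a\<in>UNIV. \<Sum>b\<in>UNIV. ginv c x $ i $ a * (gmat c x $ a $ b * ?DI b j h))"
    by (rule sum.swap)
  also have "\<dots> = (\<Sum>a\<in>UNIV. ginv c x $ i $ a * - (\<Sum>b\<in>UNIV. ?DG a b h * ginv c x $ b $ j))"
    by (simp only: zero flip: sum_distrib_left)
  finally show ?thesis by (simp add: sum_distrib_left sum_negf mult.assoc)
qed

text \<open>All traces in the divergence of a gradient reduce to two contractions of the derivatives
  of the metric: \<open>w\<close>, where the derivative index is contracted, and \<open>u\<close>,
  which is the derivative of the logarithm of the square root of the determinant.\<close>

lemma christoffel_contractions:
  defines "w \<equiv> \<lambda>l. \<Sum>a\<in>UNIV. \<Sum>b\<in>UNIV. ginv c x $ a $ b * dgmat c a b l x"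
    and "u \<equiv> \<lambda>l. 1/2 * (\<Sum>a\<in>UNIV. \<Sum>b\<in>UNIV. ginv c x $ a $ b * dgmat c l a b x)"
  shows "(\<Sum>i\<in>UNIV. christoffel A g c i i k (chart_inv c x)) = u k"
    and "(\<Sum>i\<in>UNIV. \<Sum>j\<in>UNIV. ginv c x $ i $ j * christoffel A g c k i j (chart_inv c x))
      = (\<Sum>l\<in>UNIV. ginv c x $ k $ l * (w l - u l))"
    and "(\<Sum>i\<in>UNIV. frechet_derivative (\<lambda>x. ginv c x $ i $ k) (at x) (axis i 1))
      = - (\<Sum>l\<in>UNIV. ginv c x $ k $ l * w l)"
proof -
  have swap: "(\<Sum>i\<in>UNIV. \<Sum>l\<in>UNIV. ginv c x $ i $ l * dgmat c l i k x)
      = (\<Sum>i\<in>UNIV. \<Sum>l\<in>UNIV. ginv c x $ i $ l * dgmat c i k l x)"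
    by (subst sum.swap) (simp only: ginv_sym dgmat_sym[OF c x, of _ k])
  have "(\<Sum>i\<in>UNIV. christoffel A g c i i k (chart_inv c x))
    = 1/2 * ((\<Sum>i\<in>UNIV. \<Sum>l\<in>UNIV. ginv c x $ i $ l * dgmat c i k l x)
      + (\<Sum>i\<in>UNIV. \<Sum>l\<in>UNIV. ginv c x $ i $ l * dgmat c k i l x)
      - (\<Sum>i\<in>UNIV. \<Sum>l\<in>UNIV. ginv c x $ i $ l * dgmat c l i k x))"
    by (simp only: christoffel_eq[OF c x] distrib_left right_diff_distrib sum.distrib sum_subtractf
        flip: sum_distrib_left)
  then show "(\<Sum>i\<in>UNIV. christoffel A g c i i k (chart_inv c x)) = u k"
    by (simp add: swap u_def)
  have 1: "(\<Sum>i\<in>UNIV. \<Sum>j\<in>UNIV. ginv c x $ i $ j * dgmat c j i l x) = w l" for l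
    unfolding w_def by (subst sum.swap) (simp only: ginv_sym)
  have "(\<Sum>i\<in>UNIV. \<Sum>j\<in>UNIV. ginv c x $ i $ j * christoffel A g c k i j (chart_inv c x))
    = (\<Sum>i\<in>UNIV. \<Sum>j\<in>UNIV. \<Sum>l\<in>UNIV. ginv c x $ k $ l * (1/2 * (ginv c x $ i $ j *
        (dgmat c i j l x + dgmat c j i l x - dgmat c l i j x))))"
    by (simp add: christoffel_eq[OF c x] sum_distrib_left mult_ac)
  also have "\<dots> = (\<Sum>i\<in>UNIV. \<Sum>l\<in>UNIV. \<Sum>j\<in>UNIV. ginv c x $ k $ l * (1/2 * (ginv c x $ i $ j *
        (dgmat c i j l x + dgmat c j i l x - dgmat c l i j x))))"
    by (intro sum.cong refl sum.swap)
  also have "\<dots> = (\<Sum>l\<in>UNIV. \<Sum>i\<in>UNIV. \<Sum>j\<in>UNIV. ginv c x $ k $ l * (1/2 * (ginv c x $ i $ j *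
        (dgmat c i j l x + dgmat c j i l x - dgmat c l i j x))))"
    by (rule sum.swap)
  also have "\<dots> = (\<Sum>l\<in>UNIV. ginv c x $ k $ l * (1/2 * (w l
      + (\<Sum>i\<in>UNIV. \<Sum>j\<in>UNIV. ginv c x $ i $ j * dgmat c j i l x)
      - (\<Sum>i\<in>UNIV. \<Sum>j\<in>UNIV. ginv c x $ i $ j * dgmat c l i j x))))"
    unfolding w_def
    by (simp only: distrib_left[of "ginv c x $ _ $ _"] right_diff_distrib[of "ginv c x $ _ $ _"]
        sum.distrib sum_subtractf flip: sum_distrib_left)
  finally show "(\<Sum>i\<in>UNIV. \<Sum>j\<in>UNIV. ginv c x $ i $ j * christoffel A g c k i j (chart_inv c x))
      = (\<Sum>l\<in>UNIV. ginv c x $ k $ l * (w l - u l))"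
    by (simp add: 1 u_def diff_divide_distrib)
  have "(\<Sum>i\<in>UNIV. frechet_derivative (\<lambda>x. ginv c x $ i $ k) (at x) (axis i 1))
    = - (\<Sum>i\<in>UNIV. \<Sum>a\<in>UNIV. \<Sum>l\<in>UNIV. ginv c x $ k $ l * (ginv c x $ i $ a * dgmat c i a l x))"
    by (simp add: frechet_derivative_ginv sum_negf ginv_sym[of _ k] mult_ac)
  also have "\<dots> = - (\<Sum>i\<in>UNIV. \<Sum>l\<in>UNIV. \<Sum>a\<in>UNIV. ginv c x $ k $ l * (ginv c x $ i $ a * dgmat c i a l x))"
    by (intro arg_cong[of _ _ uminus] sum.cong refl sum.swap)
  also have "\<dots> = - (\<Sum>l\<in>UNIV. \<Sum>i\<in>UNIV. \<Sum>a\<in>UNIV. ginv c x $ k $ l * (ginv c x $ i $ a * dgmat c i a l x))"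
    by (intro arg_cong[of _ _ uminus] sum.swap)
  finally show "(\<Sum>i\<in>UNIV. frechet_derivative (\<lambda>x. ginv c x $ i $ k) (at x) (axis i 1))
      = - (\<Sum>l\<in>UNIV. ginv c x $ k $ l * w l)"
    by (simp add: w_def sum_distrib_left)
qed

end

text \<open>The inverse metric applied to the differential represents it; a second representing
  vector would differ from it by a vector of length zero.\<close>

lemma gradient_components:
  assumes f: "smooth_fun A f" and c: "c \<in> charts_at A p"
  shows "tvec_components A c p (gradient A g f p) $ i
    = (\<Sum>j\<in>UNIV. ginv c (snd c p) $ i $ j * frechet_derivative (f \<circ> chart_inv c) (at (snd c p)) (axis j 1))"
proof -
  note cA = charts_atD(1)[OF c]
  have x: "snd c p \<in> img c" using c by simp
  let ?D = "frechet_derivative (f \<circ> chart_inv c) (at (snd c p))"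
  define df :: "real ^ 'n" where "df = (\<chi> j. ?D (axis j 1))"
  define u where "u = ginv c (snd c p) *v df"
  have sn: "smooth_near A p f" by (rule smooth_fun_smooth_near[OF f])
  have D: "?D w = w \<bullet> df" for w
    using linear_axis_sum[OF linear_frechet_derivative[OF smooth_near_differentiable[OF c sn]], of w]
    by (simp add: inner_vec_def df_def)
  have gu: "gform c w u (snd c p) = ?D w" for w
    unfolding gform_inner[OF cA] u_def D
    by (simp add: matrix_vector_mul_assoc matrix_inv_mult[OF det_gmat[OF cA x]])
  have "gradient A g f p = from_components A c p u"
    unfolding gradient_def
  proof (rule the_equality)
    show "from_components A c p u \<in> tangent_space A p \<and>
      (\<forall>\<eta>\<in>tangent_space A p. g p (from_components A c p u) \<eta> = \<eta> f)"
      using gu gform_sym[OF cA x, of u] sn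
      by (auto simp: tangent_space_eq[OF c] metric_from_components[OF c] from_components_apply[OF c])
    fix \<xi> assume \<xi>: "\<xi> \<in> tangent_space A p \<and> (\<forall>\<eta>\<in>tangent_space A p. g p \<xi> \<eta> = \<eta> f)"
    then obtain v where v: "\<xi> = from_components A c p v" using tangent_space_eq[OF c] by blast
    have "gform c v w (snd c p) = ?D w" for w
      using \<xi> c sn unfolding v
      by (simp add: tangent_space_eq[OF c] metric_from_components[OF c] from_components_apply[OF c])
    then have "gform c w v (snd c p) = gform c w u (snd c p)" for w
      using gu gform_sym[OF cA x, of w v] by simp
    then have "gform c (v - u) (v - u) (snd c p) = 0"
      using linear_diff[OF linear_gform(1)[of c "v - u" "snd c p"], of v u] by simp
    then show "\<xi> = from_components A c p u" using gform_pos[OF cA x, of "v - u"] v by fastforce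
  qed
  then show ?thesis using c by (simp add: u_def df_def matrix_vector_mult_def)
qed

text \<open>Differentiating the inverse metric contributes -w and the Christoffel trace contributes
  u, each raised with the inverse metric and paired with the differential of \<open>f\<close>. Their
  sum matches the contraction w - u that the Hessian subtracts.\<close>

lemma divergence_gradient:
  assumes f: "smooth_fun A f" and c: "c \<in> charts_at A p"
  shows "(\<Sum>i\<in>UNIV. (partial c i (\<lambda>q. tvec_components A c q (gradient A g f q) $ i) p
       + (\<Sum>k\<in>UNIV. christoffel A g c i i k p * tvec_components A c p (gradient A g f p) $ k)))
    = (\<Sum>i\<in>UNIV. \<Sum>j\<in>UNIV. hessian c f i j (snd c p) * inverse_metric A g c p $ i $ j)"
proof -
  note cA = charts_atD(1)[OF c]
  define x where "x = snd c p"
  have x: "x \<in> img c" and p: "chart_inv c x = p" using c by (auto simp: x_def)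
  let ?F = "f \<circ> chart_inv c"
  let ?dF = "\<lambda>i y. frechet_derivative ?F (at y) (axis i 1)"
  let ?ddF = "\<lambda>i j. frechet_derivative (?dF i) (at x) (axis j 1)"
  let ?DI = "\<lambda>i j. frechet_derivative (\<lambda>x. ginv c x $ i $ j) (at x)"
  have sm: "smooth_on (img c) ?F" by (rule smooth_fun_chart[OF f cA])
  have part: "partial c i (\<lambda>q. tvec_components A c q (gradient A g f q) $ i) p
    = (\<Sum>j\<in>UNIV. ginv c x $ i $ j * ?ddF j i + ?DI i j (axis i 1) * ?dF j x)" for i
  proof -
    have "((\<lambda>y. \<Sum>j\<in>UNIV. ginv c y $ i $ j * ?dF j y) has_derivative
      (\<lambda>h. \<Sum>j\<in>UNIV. ginv c x $ i $ j * frechet_derivative (?dF j) (at x) h + ?DI i j h * ?dF j x)) (at x)"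
      by (intro has_derivative_sum has_derivative_mult smooth_on_has_derivative[OF _ x]
          smooth_on_frechet_derivative sm smooth_gmat_inv[OF cA])
    then have "((\<lambda>q. tvec_components A c q (gradient A g f q) $ i) \<circ> chart_inv c has_derivative
      (\<lambda>h. \<Sum>j\<in>UNIV. ginv c x $ i $ j * frechet_derivative (?dF j) (at x) h + ?DI i j h * ?dF j x)) (at x)"
    proof (rule has_derivative_transform_within_open[OF _ open_img[OF cA] x])
      fix y assume y: "y \<in> img c"
      show "(\<Sum>j\<in>UNIV. ginv c y $ i $ j * ?dF j y)
        = ((\<lambda>q. tvec_components A c q (gradient A g f q) $ i) \<circ> chart_inv c) y"
        using gradient_components[OF f charts_atI[OF cA chart_inv_dom[OF cA y]], of i] y cA by simp
    qed
    from frechet_derivative_at[OF this, symmetric] show ?thesis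
      by (simp add: partial_def flip: x_def)
  qed
  have grad: "tvec_components A c p (gradient A g f p) $ k = (\<Sum>j\<in>UNIV. ginv c x $ k $ j * ?dF j x)" for k
    using gradient_components[OF f c] by (simp add: x_def)
  define w where "w = (\<lambda>l. \<Sum>a\<in>UNIV. \<Sum>b\<in>UNIV. ginv c x $ a $ b * dgmat c a b l x)"
  define u where "u = (\<lambda>l. 1/2 * (\<Sum>a\<in>UNIV. \<Sum>b\<in>UNIV. ginv c x $ a $ b * dgmat c l a b x))"
  note cc = christoffel_contractions[OF cA x, folded fun_cong[OF w_def] fun_cong[OF u_def]]
  define H where "H = (\<Sum>i\<in>UNIV. \<Sum>j\<in>UNIV. ginv c x $ i $ j * ?ddF i j)"
  have "(\<Sum>i\<in>UNIV. \<Sum>j\<in>UNIV. ginv c x $ i $ j * ?ddF j i) = H"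
    unfolding H_def by (subst sum.swap) (simp only: ginv_sym[OF cA x])
  moreover have "(\<Sum>i\<in>UNIV. \<Sum>j\<in>UNIV. ?DI i j (axis i 1) * ?dF j x)
      = (\<Sum>j\<in>UNIV. - (\<Sum>l\<in>UNIV. ginv c x $ j $ l * w l) * ?dF j x)"
    by (subst sum.swap) (simp only: cc(3) flip: sum_distrib_right)
  moreover have "(\<Sum>i\<in>UNIV. \<Sum>k\<in>UNIV. christoffel A g c i i k p * tvec_components A c p (gradient A g f p) $ k)
      = (\<Sum>j\<in>UNIV. (\<Sum>l\<in>UNIV. ginv c x $ j $ l * u l) * ?dF j x)"
  proof -
    have "(\<Sum>i\<in>UNIV. \<Sum>k\<in>UNIV. christoffel A g c i i k p * tvec_components A c p (gradient A g f p) $ k)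
      = (\<Sum>k\<in>UNIV. u k * (\<Sum>j\<in>UNIV. ginv c x $ k $ j * ?dF j x))"
      by (subst sum.swap) (simp only: cc(1)[unfolded p] grad flip: sum_distrib_right)
    also have "\<dots> = (\<Sum>k\<in>UNIV. \<Sum>j\<in>UNIV. ginv c x $ j $ k * u k * ?dF j x)"
      by (simp add: sum_distrib_left ginv_sym[OF cA x] mult_ac)
    also have "\<dots> = (\<Sum>j\<in>UNIV. \<Sum>k\<in>UNIV. ginv c x $ j $ k * u k * ?dF j x)"
      by (rule sum.swap)
    finally show ?thesis by (simp add: sum_distrib_right)
  qed
  moreover have "(\<Sum>i\<in>UNIV. \<Sum>j\<in>UNIV. hessian c f i j x * inverse_metric A g c p $ i $ j)
      = H - (\<Sum>j\<in>UNIV. (\<Sum>l\<in>UNIV. ginv c x $ j $ l * (w l - u l)) * ?dF j x)"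
  proof -
    have "(\<Sum>i\<in>UNIV. \<Sum>j\<in>UNIV. hessian c f i j x * inverse_metric A g c p $ i $ j)
      = H - (\<Sum>i\<in>UNIV. \<Sum>j\<in>UNIV. \<Sum>k\<in>UNIV. ginv c x $ i $ j * christoffel A g c k i j p * ?dF k x)"
      unfolding H_def hessian_def p inverse_metric_eq[of c x, unfolded p]
      by (simp add: left_diff_distrib right_diff_distrib sum_subtractf sum_distrib_left sum_distrib_right mult_ac)
    also have "(\<Sum>i\<in>UNIV. \<Sum>j\<in>UNIV. \<Sum>k\<in>UNIV. ginv c x $ i $ j * christoffel A g c k i j p * ?dF k x)
      = (\<Sum>i\<in>UNIV. \<Sum>k\<in>UNIV. \<Sum>j\<in>UNIV. ginv c x $ i $ j * christoffel A g c k i j p * ?dF k x)"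
      by (intro sum.cong refl sum.swap)
    also have "\<dots> = (\<Sum>k\<in>UNIV. \<Sum>i\<in>UNIV. \<Sum>j\<in>UNIV. ginv c x $ i $ j * christoffel A g c k i j p * ?dF k x)"
      by (rule sum.swap)
    also have "\<dots> = (\<Sum>j\<in>UNIV. (\<Sum>l\<in>UNIV. ginv c x $ j $ l * (w l - u l)) * ?dF j x)"
      by (simp only: cc(2)[unfolded p] flip: sum_distrib_right)
    finally show ?thesis .
  qed
  ultimately show ?thesis
    unfolding part sum.distrib x_def[symmetric]
    by (simp add: right_diff_distrib left_diff_distrib sum_subtractf sum_negf)
qed

subsection \<open>Convergence\<close>

context
  fixes \<mu> :: "'a \<Rightarrow> 'a tvec measure" and f :: "'a \<Rightarrow> real" and C m :: real
  assumes f: "smooth_fun A f"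
    and sets: "\<And>p. sets (\<mu> p) = sets (tangent_borel A p)" and fin: "\<And>p. finite_measure (\<mu> p)"
    and C: "\<And>p \<eta>. \<eta> \<in> support A p (\<mu> p) \<Longrightarrow> tangent_norm g p \<eta> \<le> C"
    and m: "\<And>p. measure (\<mu> p) (space (\<mu> p)) \<le> m"
    and m1: "\<And>p c i. c \<in> charts_at A p \<Longrightarrow> (LINT \<eta>|\<mu> p. tvec_components A c p \<eta> $ i) = 0"
    and m2: "\<And>p c i j. c \<in> charts_at A p \<Longrightarrow>
           (LINT \<eta>|\<mu> p. tvec_components A c p \<eta> $ i * tvec_components A c p \<eta> $ j)
             = inverse_metric A g c p $ i $ j"
begin

abbreviation scaled_gen :: "nat \<Rightarrow> 'a \<Rightarrow> real" where
  "scaled_gen N p \<equiv> (real N)\<^sup>2 * L_gen A g \<mu> N f p"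

abbreviation trace_hessian :: "('a, 'n) chart \<Rightarrow> 'a \<Rightarrow> real" where
  "trace_hessian c p \<equiv> \<Sum>i\<in>UNIV. \<Sum>j\<in>UNIV. hessian c f i j (snd c p) * inverse_metric A g c p $ i $ j"

text \<open>The Taylor error is integrated at time 1/N; multiplying by the square of N cancels the
  quadratic factor and leaves at most e'm/2, the same bound at every point of the ball.\<close>

lemma L_gen_uniform_limit_ball:
  assumes c: "c \<in> A" and r: "r > 0" "cball x0 (2 * r) \<subseteq> img c"
  shows "uniform_limit {p \<in> fst c. snd c p \<in> cball x0 r} scaled_gen
    (\<lambda>p. 1/2 * trace_hessian c p) sequentially"
proof (rule uniform_limitI)
  fix e :: real assume e: "e > 0"
  have "cball x0 r \<subseteq> img c" using r by (auto simp: subset_iff)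
  from components_bounded[OF c compact_cball this, of C] obtain R where R:
    "\<And>p \<eta>. c \<in> charts_at A p \<Longrightarrow> snd c p \<in> cball x0 r \<Longrightarrow> \<eta> \<in> tangent_space A p \<Longrightarrow>
      tangent_norm g p \<eta> \<le> C \<Longrightarrow> norm (tvec_components A c p \<eta>) \<le> R" by blast
  have m0: "m \<ge> 0" using m measure_nonneg order_trans by blast
  \<comment> \<open>Compensates the total mass of the measures; the summand 1 covers the case of
    mass zero.\<close>
  define e' where "e' = e / (m + 1)"
  have e': "e' > 0" using e m0 by (simp add: e'_def)
  obtain \<delta> where \<delta>: "\<delta> > 0" "\<And>p v t. c \<in> charts_at A p \<Longrightarrow> snd c p \<in> cball x0 r \<Longrightarrow> norm v \<le> R \<Longrightarrow> 0 < t \<Longrightarrow> t < \<delta> \<Longrightarrow>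
    \<bar>f (geodesic A g p t (from_components A c p v)) - f p
      - t * (\<Sum>i\<in>UNIV. v $ i * frechet_derivative (f \<circ> chart_inv c) (at (snd c p)) (axis i 1))
      - t\<^sup>2 / 2 * hessian_form c f (snd c p, v)\<bar> \<le> t\<^sup>2 / 2 * e'"
    by (rule geodesic_taylor_uniform[OF f c r e', where R = R]) (rule that; assumption)
  have "\<forall>\<^sub>F N in sequentially. 1 / real N < \<delta>"
    using order_tendstoD(2)[OF lim_1_over_n \<delta>(1)] by simp
  then show "\<forall>\<^sub>F N in sequentially. \<forall>p\<in>{p \<in> fst c. snd c p \<in> cball x0 r}.
    dist (scaled_gen N p) (1/2 * trace_hessian c p) < e"
    using eventually_gt_at_top[of 0]
  proof eventually_elim
    case (elim N)
    show ?case
    proof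
      fix p assume "p \<in> {p \<in> fst c. snd c p \<in> cball x0 r}"
      then have p: "c \<in> charts_at A p" "snd c p \<in> cball x0 r" using c by (auto intro: charts_atI)
      define t where "t = 1 / real N"
      have t: "0 < t" "t < \<delta>" using elim by (auto simp: t_def)
      have "\<bar>L_gen A g \<mu> N f p - t\<^sup>2 / 2 * trace_hessian c p\<bar> \<le> (t\<^sup>2 / 2 * e') * measure (\<mu> p) (space (\<mu> p))"
        unfolding L_gen_def t_def[symmetric]
        by (rule integral_geodesic_increment[OF f p(1) sets fin _ m1[OF p(1)] m2[OF p(1)] \<delta>(2)[OF p _ t]])
          (use R[OF p] C in \<open>auto simp: support_def\<close>)
      also have "\<dots> \<le> (t\<^sup>2 / 2 * e') * m" using e' m by (intro mult_left_mono) auto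
      finally have "\<bar>L_gen A g \<mu> N f p - t\<^sup>2 / 2 * trace_hessian c p\<bar> \<le> (t\<^sup>2 / 2 * e') * m" .
      then have "(real N)\<^sup>2 * \<bar>L_gen A g \<mu> N f p - t\<^sup>2 / 2 * trace_hessian c p\<bar> \<le> (real N)\<^sup>2 * ((t\<^sup>2 / 2 * e') * m)"
        by (rule mult_left_mono) simp
      moreover have "(real N)\<^sup>2 * t\<^sup>2 = 1" using elim by (simp add: t_def power_divide)
      then have "(real N)\<^sup>2 * ((t\<^sup>2 / 2 * e') * m) = e' * m / 2"
        "(real N)\<^sup>2 * (t\<^sup>2 / 2 * trace_hessian c p) = 1/2 * trace_hessian c p"
        by (simp_all add: mult.assoc[symmetric])
      moreover have "(real N)\<^sup>2 * \<bar>L_gen A g \<mu> N f p - t\<^sup>2 / 2 * trace_hessian c p\<bar>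
        = \<bar>scaled_gen N p - (real N)\<^sup>2 * (t\<^sup>2 / 2 * trace_hessian c p)\<bar>"
        unfolding right_diff_distrib[symmetric] abs_mult by simp
      ultimately have "\<bar>scaled_gen N p - 1/2 * trace_hessian c p\<bar> \<le> e' * m / 2"
        by (simp only:)
      also have "e' * m / 2 < e" using e m0 by (simp add: e'_def field_simps add_strict_increasing2)
      finally show "dist (scaled_gen N p) (1/2 * trace_hessian c p) < e"
        by (simp add: dist_real_def)
    qed
  qed
qed

lemma L_gen_uniform_limit_chart:
  assumes c: "c \<in> charts_at A p"
  obtains W where "open W" "p \<in> W" "W \<subseteq> fst c"
    "uniform_limit W scaled_gen (\<lambda>p. 1/2 * trace_hessian c p) sequentially"
proof -
  note cA = charts_atD(1)[OF c]
  have "snd c p \<in> img c" using c by simp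
  then obtain r' where r': "r' > 0" "cball (snd c p) r' \<subseteq> img c"
    using open_img[OF cA] by (meson open_contains_cball)
  define r where "r = r' / 2"
  have r: "r > 0" "cball (snd c p) (2 * r) \<subseteq> img c" using r' by (auto simp: r_def)
  define W where "W = fst c \<inter> snd c -` ball (snd c p) r"
  have "continuous_on (fst c) (snd c)"
    using chart_homeo[OF cA] by (simp add: homeomorphism_def)
  then have "open W" unfolding W_def by (intro continuous_open_preimage open_dom[OF cA]) auto
  moreover have "p \<in> W" "W \<subseteq> fst c" using c r by (auto simp: W_def)
  moreover have "uniform_limit W scaled_gen (\<lambda>p. 1/2 * trace_hessian c p) sequentially"
    by (rule uniform_limit_on_subset[OF L_gen_uniform_limit_ball[OF cA r]]) (auto simp: W_def)
  ultimately show ?thesis by (rule that)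
qed

text \<open>The trace of the Hessian does not depend on the chart because it is, in every chart, the same
  pointwise limit.\<close>

lemma trace_hessian_eq_laplace_beltrami:
  assumes c: "c \<in> charts_at A p"
  shows "trace_hessian c p = laplace_beltrami A g f p"
proof -
  have lim: "(\<lambda>N. scaled_gen N p) \<longlonglongrightarrow> 1/2 * trace_hessian d p" if d: "d \<in> charts_at A p" for d
  proof -
    obtain W where W: "p \<in> W"
      "uniform_limit W scaled_gen (\<lambda>p. 1/2 * trace_hessian d p) sequentially"
      by (rule L_gen_uniform_limit_chart[OF d]) (rule that; assumption)
    show ?thesis using tendsto_uniform_limitI[OF W(2,1)] by simp
  qed
  \<comment> \<open>This is the chart that \<open>divergence\<close> selects at
    \<open>p\<close>.\<close>
  let ?d = "SOME c. c \<in> charts_at A p"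
  have d: "?d \<in> charts_at A p" using charts_at_nonempty by (rule someI_ex)
  have "trace_hessian c p = trace_hessian ?d p"
    using LIMSEQ_unique[OF lim[OF c] lim[OF d]] by simp
  also have "\<dots> = laplace_beltrami A g f p"
    unfolding laplace_beltrami_def divergence_def Let_def by (rule divergence_gradient[OF f d, symmetric])
  finally show ?thesis .
qed

text \<open>Convergence is uniform on a neighbourhood of each point, finitely many of these cover
  the compact manifold, and uniform convergence passes to finite unions.\<close>

lemma L_gen_uniform_limit:
  assumes "compact (UNIV :: 'a set)"
  shows "uniform_limit UNIV scaled_gen
    (\<lambda>p. 1/2 * laplace_beltrami A g f p) sequentially"
proof -
  let ?U = "\<lambda>W. uniform_limit W scaled_gen
    (\<lambda>p. 1/2 * laplace_beltrami A g f p) sequentially"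
  have ex: "\<exists>W. open W \<and> p \<in> W \<and> ?U W" for p
  proof -
    obtain c where c: "c \<in> charts_at A p" using charts_at_nonempty by blast
    obtain W where W: "open W" "p \<in> W" "W \<subseteq> fst c"
      "uniform_limit W scaled_gen (\<lambda>p. 1/2 * trace_hessian c p) sequentially"
      by (rule L_gen_uniform_limit_chart[OF c])
    have "trace_hessian c q = laplace_beltrami A g f q" if "q \<in> W" for q
      using trace_hessian_eq_laplace_beltrami[OF charts_atI[OF charts_atD(1)[OF c]]] that W(3) by blast
    then have "uniform_limit W scaled_gen
        (\<lambda>p. 1/2 * laplace_beltrami A g f p) sequentially"
      using W(4) by (simp cong: uniform_limit_cong')
    then show ?thesis using W(1,2) by blast
  qed
  have "(UNIV :: 'a set) \<subseteq> \<Union>{W. open W \<and> ?U W}" using ex by blast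
  then obtain D where D: "D \<subseteq> {W. open W \<and> ?U W}" "finite D" "UNIV \<subseteq> \<Union>D"
    by (rule compactE[OF assms]) auto
  have "?U (\<Union>D)" by (rule uniform_limit_on_Union) (use D in auto)
  then show ?thesis by (rule uniform_limit_on_subset) (use D(3) in blast)
qed

end

end

theorem proposition2p1:
  fixes A :: "('a::{t2_space,second_countable_topology}, 'n::finite) chart set"
    and g :: "'a metric"
    and \<mu> :: "'a \<Rightarrow> 'a tvec measure"
    and f :: "'a \<Rightarrow> real"
  assumes "smooth_structure A"
    and "compact (UNIV :: 'a set)"
    and "connected (UNIV :: 'a set)"
    and "riemannian_metric A g"
    and "\<And>p. sets (\<mu> p) = sets (tangent_borel A p)"
    and "\<And>p. finite_measure (\<mu> p)"
    and "(SUP p. SUP \<eta>\<in>support A p (\<mu> p). ennreal (tangent_norm g p \<eta>)) < \<infinity>"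
    and "(SUP p. emeasure (\<mu> p) (tangent_space A p)) < \<infinity>"
    and "\<And>p c i. c \<in> charts_at A p \<Longrightarrow> (LINT \<eta>|\<mu> p. tvec_components A c p \<eta> $ i) = 0"
    and "\<And>p c i j. c \<in> charts_at A p \<Longrightarrow>
           (LINT \<eta>|\<mu> p. tvec_components A c p \<eta> $ i * tvec_components A c p \<eta> $ j)
             = inverse_metric A g c p $ i $ j"
    and "smooth_fun A f"
  shows "uniform_limit UNIV
           (\<lambda>N p. (real N)\<^sup>2 * L_gen A g \<mu> N f p)
           (\<lambda>p. 1/2 * laplace_beltrami A g f p) sequentially"
proof -
  interpret riemannian_manifold A g by unfold_locales (rule assms)+
  let ?C = "SUP p. SUP \<eta>\<in>support A p (\<mu> p). ennreal (tangent_norm g p \<eta>)"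
  let ?m = "SUP p. emeasure (\<mu> p) (tangent_space A p)"
  show ?thesis
  \<comment> \<open>The two suprema are finite, so \<open>enn2real\<close> turns them into the real
    bounds on norms and masses that remain to be checked.\<close>
  proof (rule L_gen_uniform_limit[OF assms(11,5,6) _ _ assms(9,10,2)])
    fix p \<eta> assume \<eta>: "\<eta> \<in> support A p (\<mu> p)"
    have "ennreal (tangent_norm g p \<eta>) \<le> (SUP \<eta>\<in>support A p (\<mu> p). ennreal (tangent_norm g p \<eta>))"
      using \<eta> by (rule SUP_upper)
    also have "\<dots> \<le> ?C" by (rule SUP_upper) simp
    also have "?C = ennreal (enn2real ?C)"
      using assms(7) by (intro ennreal_enn2real[symmetric]) (simp only: infinity_ennreal_def)
    finally show "tangent_norm g p \<eta> \<le> enn2real ?C"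
      by (rule ennreal_le_iff[OF enn2real_nonneg, THEN iffD1])
  next
    fix p
    have sp: "space (\<mu> p) = tangent_space A p"
      using sets_eq_imp_space_eq[OF assms(5)] by (simp add: space_tangent_borel)
    have "emeasure (\<mu> p) (space (\<mu> p)) \<le> ?m" unfolding sp by (rule SUP_upper) simp
    then show "measure (\<mu> p) (space (\<mu> p)) \<le> enn2real ?m"
      unfolding measure_def using assms(8) by (intro enn2real_mono) (simp_all add: infinity_ennreal_def)
  qed
qed

end
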